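(* Let $p$ be a prime, let $R$ be a commutative Noetherian local pro-$p$ domain and let $W$ be a finitely generated $R$-torsion-free $R$-module. Let $G$ be a closed subgroup of $\operatorname{Aut}_R(W)$. Then there exists a commutative Noetherian local pro-$p$ domain $S$, satisfying $\operatorname{char} S=\operatorname{char} R$ and $K\dim S=K\dim R$, such that $G$ is $S$-linear. Moreover, if $R$ is regular, then one can take $S=R$.
   Context: A commutative Noetherian local pro-$p$ domain $R$ is a commutative Noetherian local integral domain with maximal ideal $\mathfrak m$ which is complete in its $\mathfrak m$-adic topology and whose residue field is finite of characteristic $p$; it carries the $\mathfrak m$-adic (profinite) topology. $K\dim R$ denotes the Krull dimension of $R$. The group $\operatorname{Aut}_R(W)$ of $R$-module automorphisms of $W$ has its natural profinite topology, in which the kernels of the actions on $W/\mathfrak m^iW$, $i\ge 1$, form a base of neighbourhoods of the identity. A profinite group is $S$-linear if it is isomorphic, as a topological group, to a closed subgroup of $\mathrm{GL}_n(S)$ for some $n$. *)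

theory Defs
  imports "HOL-Algebra.Algebra" "HOL-Analysis.Analysis"
begin

section \<open>Complete local rings\<close>

text \<open>The order of \<open>1\<close> in the additive group; \<^const>\<open>group.ord\<close> is \<open>0\<close> on elements of
  infinite order, so this gives characteristic \<open>0\<close> as usual.\<close>

definition ring_characteristic :: "('a, 'm) ring_scheme \<Rightarrow> nat" where
  "ring_characteristic R = group.ord (add_monoid R) \<one>\<^bsub>R\<^esub>"

definition krull_dim :: "('a, 'm) ring_scheme \<Rightarrow> enat" where
  "krull_dim R = Sup {enat n | n. \<exists>P :: nat \<Rightarrow> 'a set.
     (\<forall>i\<le>n. primeideal (P i) R) \<and> (\<forall>i<n. P i \<subset> P (Suc i))}"

text \<open>Meaningful only for local rings.\<close>

definition max_ideal :: "('a, 'm) ring_scheme \<Rightarrow> 'a set" where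
  "max_ideal R = (THE M. maximalideal M R)"

text \<open>Powers in \<^const>\<open>ideals_set\<close> are powers of ideals for \<^const>\<open>ideal_prod\<close>, with zeroth
  power the unit ideal.\<close>

abbreviation max_ideal_pow :: "('a, 'm) ring_scheme \<Rightarrow> nat \<Rightarrow> 'a set" where
  "max_ideal_pow R i \<equiv> max_ideal R [^]\<^bsub>ideals_set R\<^esub> i"

text \<open>The last two assumptions say that the map from \<open>R\<close> to the inverse limit of the rings
  \<open>R/\<mm>\<^sup>i\<close> is injective and surjective, respectively.\<close>

locale noetherian_local_pro_p_domain = noetherian_domain R
  for p :: nat and R (structure) +
  assumes local: "\<exists>!M. maximalideal M R"
    and finite_residue_field: "finite (carrier (R Quot max_ideal R))"
    and characteristic_residue_field: "ring_characteristic (R Quot max_ideal R) = p"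
    and separated: "(\<Inter>i. max_ideal_pow R i) = {\<zero>}"
    and complete: "\<lbrakk>\<And>i. x i \<in> carrier R; \<And>i. x (Suc i) \<ominus> x i \<in> max_ideal_pow R i\<rbrakk>
      \<Longrightarrow> \<exists>y\<in>carrier R. \<forall>i::nat. y \<ominus> x i \<in> max_ideal_pow R i"

definition adic_topology :: "('a, 'm) ring_scheme \<Rightarrow> 'a topology" where
  "adic_topology R =
     topology_generated_by {max_ideal_pow R i +>\<^bsub>R\<^esub> a | i a. a \<in> carrier R}"

text \<open>For a Noetherian local ring: the minimal number of generators of the maximal ideal equals
  the Krull dimension.\<close>

definition regular_local :: "('a, 'm) ring_scheme \<Rightarrow> bool" where
  "regular_local R \<longleftrightarrow>
     krull_dim R = enat (LEAST d. \<exists>A\<subseteq>carrier R. finite A \<and> card A = d \<and> genideal R A = max_ideal R)"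


section \<open>Modules and their automorphism groups\<close>

definition submodule_span :: "('a, 'm) ring_scheme \<Rightarrow> ('a, 'b, 'k) module_scheme \<Rightarrow> 'b set \<Rightarrow> 'b set"
  where "submodule_span R W A = \<Inter>{N. submodule N R W \<and> A \<subseteq> N}"

definition finitely_generated_module :: "('a, 'm) ring_scheme \<Rightarrow> ('a, 'b, 'k) module_scheme \<Rightarrow> bool"
  where "finitely_generated_module R W \<longleftrightarrow>
    (\<exists>A\<subseteq>carrier W. finite A \<and> submodule_span R W A = carrier W)"

definition torsion_free_module :: "('a, 'm) ring_scheme \<Rightarrow> ('a, 'b, 'k) module_scheme \<Rightarrow> bool"
  where "torsion_free_module R W \<longleftrightarrow>
    (\<forall>a\<in>carrier R. \<forall>w\<in>carrier W. a \<odot>\<^bsub>W\<^esub> w = \<zero>\<^bsub>W\<^esub> \<longrightarrow> a = \<zero>\<^bsub>R\<^esub> \<or> w = \<zero>\<^bsub>W\<^esub>)"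

definition ideal_smult ::
    "('a, 'm) ring_scheme \<Rightarrow> ('a, 'b, 'k) module_scheme \<Rightarrow> 'a set \<Rightarrow> 'b set"
  where "ideal_smult R W I =
    submodule_span R W {a \<odot>\<^bsub>W\<^esub> w | a w. a \<in> I \<and> w \<in> carrier W}"

definition module_Aut :: "('a, 'm) ring_scheme \<Rightarrow> ('a, 'b, 'k) module_scheme \<Rightarrow> ('b \<Rightarrow> 'b) monoid"
  where "module_Aut R W = BijGroup (carrier W)
    \<lparr>carrier := {f \<in> Bij (carrier W).
       (\<forall>x\<in>carrier W. \<forall>y\<in>carrier W. f (x \<oplus>\<^bsub>W\<^esub> y) = f x \<oplus>\<^bsub>W\<^esub> f y) \<and>
       (\<forall>a\<in>carrier R. \<forall>x\<in>carrier W. f (a \<odot>\<^bsub>W\<^esub> x) = a \<odot>\<^bsub>W\<^esub> f x)}\<rparr>"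

text \<open>The kernel of the action on \<open>W/\<mm>\<^sup>iW\<close>.\<close>

definition congruence_kernel ::
    "('a, 'm) ring_scheme \<Rightarrow> ('a, 'b, 'k) module_scheme \<Rightarrow> nat \<Rightarrow> ('b \<Rightarrow> 'b) set"
  where "congruence_kernel R W i = {f \<in> carrier (module_Aut R W). \<forall>w\<in>carrier W.
     ideal_smult R W (max_ideal_pow R i) +>\<^bsub>W\<^esub> f w =
     ideal_smult R W (max_ideal_pow R i) +>\<^bsub>W\<^esub> w}"

definition module_Aut_topology ::
    "('a, 'm) ring_scheme \<Rightarrow> ('a, 'b, 'k) module_scheme \<Rightarrow> ('b \<Rightarrow> 'b) topology"
  where "module_Aut_topology R W = topology_generated_by
    {g <#\<^bsub>module_Aut R W\<^esub> congruence_kernel R W i | g i. g \<in> carrier (module_Aut R W) \<and> i \<ge> 1}"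


section \<open>General linear groups and linearity\<close>

text \<open>Matrices are extensional functions on pairs of indices, so that entrywise convergence is
  convergence in \<^const>\<open>product_topology\<close>.\<close>

definition matrix_monoid :: "nat \<Rightarrow> ('a, 'm) ring_scheme \<Rightarrow> (nat \<times> nat \<Rightarrow> 'a) monoid" where
  "matrix_monoid n S =
    \<lparr>carrier = ({..<n} \<times> {..<n}) \<rightarrow>\<^sub>E carrier S,
     monoid.mult = (\<lambda>A B. \<lambda>(i, j)\<in>{..<n} \<times> {..<n}. \<Oplus>\<^bsub>S\<^esub>k\<in>{..<n}. A (i, k) \<otimes>\<^bsub>S\<^esub> B (k, j)),
     one = (\<lambda>(i, j)\<in>{..<n} \<times> {..<n}. if i = j then \<one>\<^bsub>S\<^esub> else \<zero>\<^bsub>S\<^esub>)\<rparr>"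

definition general_linear_group :: "nat \<Rightarrow> ('a, 'm) ring_scheme \<Rightarrow> (nat \<times> nat \<Rightarrow> 'a) monoid" where
  "general_linear_group n S = units_of (matrix_monoid n S)"

definition general_linear_topology :: "nat \<Rightarrow> ('a, 'm) ring_scheme \<Rightarrow> (nat \<times> nat \<Rightarrow> 'a) topology" where
  "general_linear_topology n S =
     subtopology (product_topology (\<lambda>_. adic_topology S) ({..<n} \<times> {..<n}))
       (carrier (general_linear_group n S))"

definition closed_subgroup :: "'g set \<Rightarrow> ('g, 'm) monoid_scheme \<Rightarrow> 'g topology \<Rightarrow> bool" where
  "closed_subgroup H G T \<longleftrightarrow> subgroup H G \<and> closedin T H"

text \<open>\<open>G\<close> with the topology \<open>T\<close> is \<open>S\<close>-linear.\<close>

definition linear_over ::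
    "('a, 'm) ring_scheme \<Rightarrow> ('g, 'k) monoid_scheme \<Rightarrow> 'g topology \<Rightarrow> bool" where
  "linear_over S G T \<longleftrightarrow> (\<exists>n\<ge>1. \<exists>H.
     closed_subgroup H (general_linear_group n S) (general_linear_topology n S) \<and>
     (\<exists>\<phi> \<in> iso G (general_linear_group n S\<lparr>carrier := H\<rparr>).
        homeomorphic_map T (subtopology (general_linear_topology n S) H) \<phi>))"

end

theory Submission
  imports Defs
begin

text \<open>In fact \<open>S = R\<close> always works. Choose \<open>\<xi>\<^sub>1, \<dots>, \<xi>\<^sub>d\<close> in the maximal ideal with \<open>d\<close> minimal such that
  \<open>p, \<xi>\<^sub>1, \<dots>, \<xi>\<^sub>d\<close> generate an ideal containing a power of the maximal ideal. Then \<open>R\<close> is a finite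
  module over the closed subring \<open>A\<close> of power series in the \<open>\<xi>\<^sub>i\<close> over the closure of the integers,
  and minimality of \<open>d\<close> forces these power series to be unique. So \<open>A\<close> has the injective endomorphisms
  \<open>\<phi>\<close> with \<open>\<phi>(\<xi>\<^sub>i) = t\<^sub>i \<xi>\<^sub>i\<close>, where \<open>t\<^sub>i\<close> is a nonzero power series in \<open>\<xi>\<^sub>1, \<dots>, \<xi>\<^sub>i\<^sub>-\<^sub>1\<close>; taking the
  \<open>t\<^sub>i\<close> sufficiently divisible, \<open>\<phi>\<close> maps any given finite set of nonzero elements of \<open>A\<close> to a set that is
  totally ordered by divisibility. Hence, for suitable \<open>\<phi>\<close>, relations over \<open>A\<close> between generators of
  \<open>W\<close> can be solved for one of the generators after base change along \<open>\<phi>\<close>, so that the base change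
  of \<open>W\<close> to \<open>R\<close> modulo torsion is free. This embeds the automorphism group of \<open>W\<close> continuously in some
  \<open>GL\<^sub>n(R)\<close>, and the embedding is closed because the automorphism group is compact.\<close>

section \<open>Convergent power series\<close>

text \<open>The obstacle is that \<open>W\<close> is only torsion-free: it embeds in free modules,
  but its automorphisms need not extend to any of them. Over a valuation ring this obstacle
  disappears, because a linear relation can be divided by its coefficient of least value and thus
  solved for a generator. The proof imitates this for finitely many coefficients. Relations are
  needed only for the dependent subsets of one finite generating set, so a single
  \<open>\<phi>\<close> can make all the coefficients that ever occur comparable. Comparability
  comes from leading terms: once the substituted factor is divisible by the leading coefficients,
  the later terms of each power series are multiples of its leading term. Because
  \<open>\<phi>\<close> maps \<open>A\<close> into itself, the matrices have entries in
  \<open>R\<close> and the ring need not be enlarged. The size of the matrices is the rank of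
  \<open>W\<close> over \<open>A\<close>, not over \<open>R\<close>. Injectivity of
  \<open>\<phi>\<close> keeps the representation faithful; that \<open>\<phi>\<close> keeps
  \<open>p\<close> and the parameters inside the maximal ideal makes it continuous.\<close>

lemma (in ideal) minus_closed: "\<lbrakk>a \<in> I; b \<in> I\<rbrakk> \<Longrightarrow> a \<ominus> b \<in> I"
  unfolding minus_eq by (simp add: a_closed a_inv_closed)

lemma (in ideal) add_cancel_mem:
  assumes "a \<in> carrier R" "b \<in> I" "a \<oplus> b \<in> I"
  shows "a \<in> I"
proof -
  have "a = (a \<oplus> b) \<ominus> b" using assms Icarr[of b] by algebra
  then show ?thesis using minus_closed[OF assms(3,2)] by simp
qed

context noetherian_local_pro_p_domain
begin

section \<open>Powers of the maximal ideal\<close>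

lemma maximalideal_max_ideal: "maximalideal (max_ideal R) R"
  unfolding max_ideal_def by (rule theI') (rule local)

lemma ideal_max_ideal: "ideal (max_ideal R) R"
  using maximalideal_max_ideal by (rule maximalideal.axioms)

lemma max_ideal_carr: "x \<in> max_ideal R \<Longrightarrow> x \<in> carrier R"
  by (rule ideal.Icarr[OF ideal_max_ideal])

lemma ideals_set_simps:
  "carrier (ideals_set R) = {I. ideal I R}" "monoid.mult (ideals_set R) = ideal_prod R"
  "one (ideals_set R) = carrier R"
  by (simp_all add: ideals_set_def)

text \<open>A constant in place of the abbreviation \<open>max_ideal_pow\<close>, so that rewriting
  does not expose the power in \<open>ideals_set R\<close>; \<open>mpow_def\<close> translates the
  locale assumptions into this form.\<close>

definition mpow :: "nat \<Rightarrow> 'a set" where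
  "mpow i = max_ideal_pow R i"

lemma mpow_0 [simp]: "mpow 0 = carrier R"
proof -
  interpret comm_monoid "ideals_set R" by (rule ideals_set_is_comm_monoid)
  show ?thesis by (simp add: mpow_def ideals_set_simps)
qed

lemma mpow_Suc: "mpow (Suc i) = ideal_prod R (mpow i) (max_ideal R)"
proof -
  interpret I: comm_monoid "ideals_set R" by (rule ideals_set_is_comm_monoid)
  show ?thesis using I.nat_pow_Suc[of "max_ideal R" i] by (simp add: mpow_def ideals_set_simps)
qed

lemma ideal_mpow: "ideal (mpow i) R"
proof (induction i)
  case 0
  then show ?case by (simp add: oneideal)
next
  case (Suc i)
  then show ?case unfolding mpow_Suc by (rule ideal_prod_is_ideal[OF _ ideal_max_ideal])
qed

lemma mpow_add:
  "mpow (i + j) = ideal_prod R (mpow i) (mpow j)"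
proof -
  interpret I: comm_monoid "ideals_set R" by (rule ideals_set_is_comm_monoid)
  show ?thesis using I.nat_pow_mult[of "max_ideal R" i j] ideal_max_ideal
    by (simp add: mpow_def ideals_set_simps)
qed

lemma mpow_carr: "x \<in> mpow i \<Longrightarrow> x \<in> carrier R"
  by (rule ideal.Icarr[OF ideal_mpow])

lemma mpow_1: "mpow (Suc 0) = max_ideal R"
proof -
  interpret I: comm_monoid "ideals_set R" by (rule ideals_set_is_comm_monoid)
  show ?thesis using I.nat_pow_eone[of "max_ideal R"] ideal_max_ideal
    by (simp add: mpow_def ideals_set_simps)
qed

lemma mpow_mult:
  assumes "a \<in> mpow i" "b \<in> mpow j"
  shows "a \<otimes> b \<in> mpow (i + j)"
  unfolding mpow_add using assms by (rule ideal_prod.prod)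

lemma mpow_mono:
  assumes "i \<le> j"
  shows "mpow j \<subseteq> mpow i"
proof -
  obtain k where k: "j = i + k" using assms le_Suc_ex by blast
  show ?thesis unfolding k mpow_add
    using ideal_prod_inter[OF ideal_mpow ideal_mpow] by blast
qed

lemma mpow_SucI: "\<lbrakk>x \<in> max_ideal R; a \<in> mpow i\<rbrakk> \<Longrightarrow> x \<otimes> a \<in> mpow (Suc i)"
  using mpow_mult[of x "Suc 0" a i] by (simp add: mpow_1)

lemma mpow_l_closed: "\<lbrakk>x \<in> carrier R; a \<in> mpow i\<rbrakk> \<Longrightarrow> x \<otimes> a \<in> mpow i"
  by (rule ideal.I_l_closed[OF ideal_mpow])

lemma pow_mem_mpow: "x \<in> max_ideal R \<Longrightarrow> x [^] n \<in> mpow n"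
proof (induction n)
  case (Suc n)
  then show ?case
    using mpow_mult[of "x [^] n" n x "Suc 0"] by (simp add: mpow_1 max_ideal_carr)
qed simp

lemma eq_zero_if_mem_all:
  assumes "\<And>i. a \<in> mpow i"
  shows "a = \<zero>"
  using assms separated by (auto simp: mpow_def)

lemma eq_if_diff_mem_all:
  assumes "a \<in> carrier R" "b \<in> carrier R" "\<And>i. a \<ominus> b \<in> mpow i"
  shows "a = b"
  using eq_zero_if_mem_all[OF assms(3)] assms(1,2) by simp

text \<open>Identities between convergent series are proved by showing that their discrepancy
  reproduces itself up to a factor in the maximal ideal.\<close>

lemma zero_if_self_similar:
  assumes x: "x \<in> max_ideal R" and e: "\<And>n. e n \<in> carrier R" "\<And>n. e n = x \<otimes> e (Suc n)"
  shows "e (0::nat) = \<zero>"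
proof (rule eq_zero_if_mem_all)
  fix i
  have "e n \<in> mpow i" for n
  proof (induction i arbitrary: n)
    case 0
    then show ?case by (simp add: e(1))
  next
    case (Suc i)
    show ?case unfolding e(2)[of n] by (rule mpow_SucI[OF x Suc])
  qed
  then show "e 0 \<in> mpow i" .
qed

section \<open>Limits of power series and their arithmetic\<close>

primrec partial_series :: "'a \<Rightarrow> (nat \<Rightarrow> 'a) \<Rightarrow> nat \<Rightarrow> 'a" where
  "partial_series x b 0 = \<zero>"
| "partial_series x b (Suc n) = partial_series x b n \<oplus> b n \<otimes> x [^] n"

text \<open>For \<open>x\<close> in the maximal ideal and coefficients in the ring, the terms from
  index \<open>n\<close> on lie in \<open>mpow n\<close>. Completeness then supplies a limit, and
  separatedness makes it unique, so the choice is harmless.\<close>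

definition series :: "'a \<Rightarrow> (nat \<Rightarrow> 'a) \<Rightarrow> 'a" where
  "series x b = (SOME y. y \<in> carrier R \<and> (\<forall>n. y \<ominus> partial_series x b n \<in> mpow n))"

lemma partial_series_closed:
  assumes "x \<in> carrier R" "\<And>n. b n \<in> carrier R"
  shows "partial_series x b n \<in> carrier R"
  by (induction n) (auto simp: assms)

lemma series_props:
  assumes x: "x \<in> max_ideal R" and b: "\<And>n. b n \<in> carrier R"
  shows "series x b \<in> carrier R" "series x b \<ominus> partial_series x b n \<in> mpow n"
proof -
  note xc = max_ideal_carr[OF x]
  have "partial_series x b (Suc i) \<ominus> partial_series x b i = b i \<otimes> x [^] i" for i
  proof -
    have "u \<oplus> v \<ominus> u = v" if "u \<in> carrier R" "v \<in> carrier R" for u v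
      using that by algebra
    then show ?thesis using partial_series_closed[of x b, OF xc b] b xc by simp
  qed
  then have d: "partial_series x b (Suc i) \<ominus> partial_series x b i \<in> mpow i" for i
    using pow_mem_mpow[OF x, of i] b mpow_l_closed by simp
  have "\<exists>y\<in>carrier R. \<forall>n. y \<ominus> partial_series x b n \<in> mpow n"
    by (rule complete[folded mpow_def, OF partial_series_closed[OF xc b] d])
  then have "\<exists>y. y \<in> carrier R \<and> (\<forall>n. y \<ominus> partial_series x b n \<in> mpow n)"
    by (simp only: Bex_def)
  from someI_ex[OF this]
  show "series x b \<in> carrier R" "series x b \<ominus> partial_series x b n \<in> mpow n"
    unfolding series_def by blast+
qed

lemma partial_series_shift:
  assumes "x \<in> carrier R" "\<And>n. b n \<in> carrier R"
  shows "partial_series x b (Suc n) = b 0 \<oplus> x \<otimes> partial_series x (\<lambda>i. b (Suc i)) n"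
proof (induction n)
  case 0
  then show ?case using assms by simp
next
  case (Suc n)
  have *: "partial_series x b (Suc (Suc n)) = partial_series x b (Suc n) \<oplus> b (Suc n) \<otimes> (x [^] n \<otimes> x)"
    by simp
  have alg: "u \<oplus> x \<otimes> s \<oplus> v \<otimes> (w \<otimes> x) = u \<oplus> x \<otimes> (s \<oplus> v \<otimes> w)"
    if "u \<in> carrier R" "s \<in> carrier R" "v \<in> carrier R" "w \<in> carrier R" for u s v w
    using that assms(1) by algebra
  have "partial_series x (\<lambda>i. b (Suc i)) n \<in> carrier R" using assms by (intro partial_series_closed)
  then show ?case unfolding * Suc
    unfolding partial_series.simps(2)[of x "\<lambda>i. b (Suc i)"] by (intro alg) (use assms in simp_all)
qed

text \<open>This recursion determines the limit. Later identities rest on it and on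
  \<open>series_eqI\<close>; partial sums do not return after this point.\<close>

lemma series_shift:
  assumes x: "x \<in> max_ideal R" and b: "\<And>n. b n \<in> carrier R"
  shows "series x b = b 0 \<oplus> x \<otimes> series x (\<lambda>i. b (Suc i))"
proof (rule eq_if_diff_mem_all)
  note xc = max_ideal_carr[OF x]
  let ?b = "\<lambda>i. b (Suc i)"
  show c: "series x b \<in> carrier R" "b 0 \<oplus> x \<otimes> series x ?b \<in> carrier R"
    using series_props(1) x b xc by simp_all
  fix i
  have alg: "s \<ominus> (u \<oplus> x \<otimes> t) = (s \<ominus> (u \<oplus> x \<otimes> q)) \<ominus> x \<otimes> (t \<ominus> q)"
    if "s \<in> carrier R" "u \<in> carrier R" "t \<in> carrier R" "q \<in> carrier R" for s t u q
    using that xc by algebra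
  have "series x b \<ominus> (b 0 \<oplus> x \<otimes> series x ?b) =
    (series x b \<ominus> partial_series x b (Suc i)) \<ominus> x \<otimes> (series x ?b \<ominus> partial_series x ?b i)"
    unfolding partial_series_shift[of x b, OF xc b]
    by (intro alg series_props(1)[OF x] partial_series_closed[OF xc] b)
  moreover have "series x b \<ominus> partial_series x b (Suc i) \<in> mpow i"
    using series_props(2)[OF x, of b, OF b, of "Suc i"] mpow_mono[of i "Suc i"] by auto
  moreover have "x \<otimes> (series x ?b \<ominus> partial_series x ?b i) \<in> mpow i"
    using series_props(2)[OF x, of ?b, OF b, of i] xc mpow_l_closed by blast
  ultimately show "series x b \<ominus> (b 0 \<oplus> x \<otimes> series x ?b) \<in> mpow i"
    using ideal.minus_closed[OF ideal_mpow] by simp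
qed

lemma series_closed: "\<lbrakk>x \<in> max_ideal R; \<And>n. b n \<in> carrier R\<rbrakk> \<Longrightarrow> series x b \<in> carrier R"
  by (rule series_props)

text \<open>The difference of two solutions of the recursion gains a factor \<open>x\<close> at
  every step and so lies in all powers of the maximal ideal. This serves as a coinduction principle
  for the identities below.\<close>

lemma series_eqI:
  assumes x: "x \<in> max_ideal R" and b: "\<And>n. b n \<in> carrier R"
    and y: "\<And>n. y n \<in> carrier R" "\<And>n. y n = b n \<oplus> x \<otimes> y (Suc n)"
  shows "y 0 = series x b"
proof -
  note xc = max_ideal_carr[OF x]
  let ?s = "\<lambda>n. series x (\<lambda>i. b (i + n))"
  have s: "?s n \<in> carrier R" for n using series_closed x b by simp
  have ss: "?s n = b n \<oplus> x \<otimes> ?s (Suc n)" for n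
    using series_shift[OF x, of "\<lambda>i. b (i + n)"] b by simp
  have "y 0 \<ominus> ?s 0 = \<zero>"
  proof (rule zero_if_self_similar[OF x, of "\<lambda>n. y n \<ominus> ?s n"])
    fix n
    have "y n \<ominus> ?s n = (b n \<oplus> x \<otimes> y (Suc n)) \<ominus> (b n \<oplus> x \<otimes> ?s (Suc n))"
      using y(2)[of n] ss[of n] by argo
    also have "\<dots> = x \<otimes> (y (Suc n) \<ominus> ?s (Suc n))"
    proof -
      have "(u \<oplus> x \<otimes> v) \<ominus> (u \<oplus> x \<otimes> w) = x \<otimes> (v \<ominus> w)"
        if "u \<in> carrier R" "v \<in> carrier R" "w \<in> carrier R" for u v w
        using that xc by algebra
      then show ?thesis using b y(1) s by blast
    qed
    finally show "y n \<ominus> ?s n = x \<otimes> (y (Suc n) \<ominus> ?s (Suc n))" .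
  qed (use y(1) s in simp)
  then show ?thesis using y(1) s[of 0] by simp
qed

lemma series_zero_tail:
  assumes x: "x \<in> max_ideal R" and b: "b 0 \<in> carrier R" "\<And>n. b (Suc n) = \<zero>"
  shows "series x b = b 0"
proof -
  have c: "b n \<in> carrier R" for n using b by (cases n) auto
  show ?thesis
    by (rule series_eqI[OF x c, symmetric]) (use c b(2) max_ideal_carr[OF x] in simp_all)
qed

lemma series_add:
  assumes x: "x \<in> max_ideal R" and b: "\<And>n. b n \<in> carrier R" and c: "\<And>n. c n \<in> carrier R"
  shows "series x b \<oplus> series x c = series x (\<lambda>n. b n \<oplus> c n)"
proof -
  let ?y = "\<lambda>n. series x (\<lambda>i. b (i + n)) \<oplus> series x (\<lambda>i. c (i + n))"
  have "?y 0 = series x (\<lambda>n. b n \<oplus> c n)"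
  proof (rule series_eqI[OF x])
    fix n
    have s: "series x (\<lambda>i. b (i + Suc n)) \<in> carrier R" "series x (\<lambda>i. c (i + Suc n)) \<in> carrier R"
      using series_closed x b c by simp_all
    have "series x (\<lambda>i. b (i + n)) = b n \<oplus> x \<otimes> series x (\<lambda>i. b (i + Suc n))"
      "series x (\<lambda>i. c (i + n)) = c n \<oplus> x \<otimes> series x (\<lambda>i. c (i + Suc n))"
      using series_shift[OF x, of "\<lambda>i. b (i + n)"] series_shift[OF x, of "\<lambda>i. c (i + n)"] b c by simp_all
    moreover have "(u \<oplus> x \<otimes> s) \<oplus> (v \<oplus> x \<otimes> t) = u \<oplus> v \<oplus> x \<otimes> (s \<oplus> t)"
      if "u \<in> carrier R" "v \<in> carrier R" "s \<in> carrier R" "t \<in> carrier R" for u v s t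
      using that max_ideal_carr[OF x] by algebra
    ultimately show "?y n = b n \<oplus> c n \<oplus> x \<otimes> ?y (Suc n)"
      using s b c by presburger
  qed (use b c x series_closed in simp_all)
  then show ?thesis by simp
qed

lemma series_smult:
  assumes x: "x \<in> max_ideal R" and b: "\<And>n. b n \<in> carrier R" and a: "a \<in> carrier R"
  shows "a \<otimes> series x b = series x (\<lambda>n. a \<otimes> b n)"
proof -
  let ?y = "\<lambda>n. a \<otimes> series x (\<lambda>i. b (i + n))"
  have "?y 0 = series x (\<lambda>n. a \<otimes> b n)"
  proof (rule series_eqI[OF x])
    fix n
    have s: "series x (\<lambda>i. b (i + Suc n)) \<in> carrier R"
      using series_closed x b by simp_all
    have "series x (\<lambda>i. b (i + n)) = b n \<oplus> x \<otimes> series x (\<lambda>i. b (i + Suc n))"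
      using series_shift[OF x, of "\<lambda>i. b (i + n)"] b by simp_all
    moreover have "a \<otimes> (u \<oplus> x \<otimes> s) = a \<otimes> u \<oplus> x \<otimes> (a \<otimes> s)"
      if "u \<in> carrier R" "s \<in> carrier R" for u s
      using that a max_ideal_carr[OF x] by algebra
    ultimately show "?y n = a \<otimes> b n \<oplus> x \<otimes> ?y (Suc n)"
      using s b by presburger
  qed (use b a x series_closed in simp_all)
  then show ?thesis by simp
qed

text \<open>The Cauchy product, by recursion on the tail of the first factor.\<close>

primrec conv :: "(nat \<Rightarrow> 'a) \<Rightarrow> (nat \<Rightarrow> 'a) \<Rightarrow> nat \<Rightarrow> 'a" where
  "conv b c 0 = b 0 \<otimes> c 0"
| "conv b c (Suc n) = b 0 \<otimes> c (Suc n) \<oplus> conv (\<lambda>i. b (Suc i)) c n"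

lemma conv_closed:
  assumes "subring B R" "\<And>n. b n \<in> B" "\<And>n. c n \<in> B"
  shows "conv b c n \<in> B"
  using assms(2,3)
proof (induction n arbitrary: b)
  case (Suc n)
  then show ?case using subringE(6,7)[OF assms(1)] by simp
qed (use subringE(6)[OF assms(1)] in simp)

lemma conv_carr: "\<lbrakk>\<And>n. b n \<in> carrier R; \<And>n. c n \<in> carrier R\<rbrakk> \<Longrightarrow> conv b c n \<in> carrier R"
  by (rule conv_closed[OF carrier_is_subring])

text \<open>For every \<open>n\<close>, the product of the \<open>n\<close>-th tail of
  \<open>b\<close> with \<open>series x c\<close> is compared with the series of the Cauchy product
  of that tail with \<open>c\<close>. Peeling off \<open>b n\<close> shows that each discrepancy is
  \<open>x\<close> times the next one.\<close>

lemma series_mult: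
  assumes x: "x \<in> max_ideal R" and b: "\<And>n. b n \<in> carrier R" and c: "\<And>n. c n \<in> carrier R"
  shows "series x b \<otimes> series x c = series x (conv b c)"
proof -
  note xc = max_ideal_carr[OF x]
  define B where "B n = (\<lambda>i. b (i + n))" for n
  define s where "s n = series x (B n)" for n
  define q where "q n = series x (conv (B n) c)" for n
  define t where "t = series x c"
  define t' where "t' = series x (\<lambda>i. c (Suc i))"
  have Bc: "B n i \<in> carrier R" for n i by (simp add: B_def b)
  have sc: "s n \<in> carrier R" for n unfolding s_def by (intro series_closed x Bc)
  have qc: "q n \<in> carrier R" for n unfolding q_def by (intro series_closed x conv_carr Bc c)
  have tc: "t \<in> carrier R" "t' \<in> carrier R" unfolding t_def t'_def by (intro series_closed x c)+
  have ss: "s n = b n \<oplus> x \<otimes> s (Suc n)" for n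
    unfolding s_def using series_shift[OF x, of "B n"] Bc by (simp add: B_def)
  have ts: "t = c 0 \<oplus> x \<otimes> t'" unfolding t_def t'_def by (rule series_shift[OF x c])
  \<comment> \<open>\<open>b n\<close> multiplies all of \<open>c\<close>; the remainder is the
    Cauchy product of the next tail with its index raised by one, hence the factor
    \<open>x\<close>.\<close>
  have qs: "q n = b n \<otimes> c 0 \<oplus> x \<otimes> (b n \<otimes> t' \<oplus> q (Suc n))" for n
  proof -
    have B': "(\<lambda>i. B n (Suc i)) = B (Suc n)" by (simp add: B_def)
    have "q n = conv (B n) c 0 \<oplus> x \<otimes> series x (\<lambda>i. conv (B n) c (Suc i))"
      unfolding q_def by (intro series_shift x conv_carr Bc c)
    also have "(\<lambda>i. conv (B n) c (Suc i)) = (\<lambda>i. b n \<otimes> c (Suc i) \<oplus> conv (B (Suc n)) c i)"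
      unfolding conv.simps B' by (simp add: B_def)
    also have "series x \<dots> = series x (\<lambda>i. b n \<otimes> c (Suc i)) \<oplus> series x (conv (B (Suc n)) c)"
      by (rule series_add[OF x, symmetric]) (simp_all add: b c conv_carr Bc)
    also have "series x (\<lambda>i. b n \<otimes> c (Suc i)) = b n \<otimes> t'"
      unfolding t'_def by (rule series_smult[OF x, symmetric]) (simp_all add: b c)
    finally show ?thesis by (simp add: B_def q_def)
  qed
  have "s 0 \<otimes> t \<ominus> q 0 = \<zero>"
  proof (rule zero_if_self_similar[OF x, of "\<lambda>n. s n \<otimes> t \<ominus> q n"])
    fix n
    have "(u \<oplus> x \<otimes> v) \<otimes> (w \<oplus> x \<otimes> t') \<ominus> (u \<otimes> w \<oplus> x \<otimes> (u \<otimes> t' \<oplus> y)) = x \<otimes> (v \<otimes> (w \<oplus> x \<otimes> t') \<ominus> y)"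
      if "u \<in> carrier R" "v \<in> carrier R" "w \<in> carrier R" "y \<in> carrier R" for u v w y
      using that xc tc(2) by algebra
    from this[of "b n" "s (Suc n)" "c 0" "q (Suc n)", folded ts ss qs]
    show "s n \<otimes> t \<ominus> q n = x \<otimes> (s (Suc n) \<otimes> t \<ominus> q (Suc n))" using b sc qc c by blast
  qed (use sc tc qc in simp)
  then have "s 0 \<otimes> t = q 0" using sc[of 0] tc(1) qc[of 0] by simp
  then show ?thesis unfolding s_def t_def q_def B_def by simp
qed

text \<open>The inverse is the geometric series in \<open>x\<close>.\<close>

lemma one_minus_unit:
  assumes "x \<in> max_ideal R"
  shows "\<one> \<ominus> x \<in> Units R"
proof -
  note xc = max_ideal_carr[OF assms]
  define s where "s = series x (\<lambda>_. \<one>)"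
  have sc: "s \<in> carrier R" unfolding s_def by (intro series_closed assms one_closed)
  have "s = \<one> \<oplus> x \<otimes> s" unfolding s_def using series_shift[OF assms, of "\<lambda>_. \<one>"] by simp
  moreover have "(\<one> \<ominus> x) \<otimes> s = s \<ominus> x \<otimes> s" "\<one> \<oplus> x \<otimes> s \<ominus> x \<otimes> s = \<one>"
    using xc sc by algebra+
  ultimately have "(\<one> \<ominus> x) \<otimes> s = \<one>" by simp
  then have "(\<one> \<ominus> x) \<otimes> s \<in> Units R" by simp
  then show ?thesis using unit_factor[of "\<one> \<ominus> x" s] xc sc by simp
qed

section \<open>Units are the elements outside the maximal ideal\<close>

lemma one_notin_max_ideal: "\<one> \<notin> max_ideal R"
proof
  assume "\<one> \<in> max_ideal R"
  then have "carrier R = max_ideal R" using ideal.one_imp_carrier[OF ideal_max_ideal] by simp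
  then show False using maximalideal.I_notcarr[OF maximalideal_max_ideal] by simp
qed

lemma unit_notin_max_ideal:
  assumes "u \<in> Units R"
  shows "u \<notin> max_ideal R"
proof
  assume "u \<in> max_ideal R"
  then have "inv u \<otimes> u \<in> max_ideal R"
    by (intro ideal.I_l_closed[OF ideal_max_ideal]) (use assms in simp_all)
  then show False using one_notin_max_ideal assms by simp
qed

text \<open>The maximal ideal together with an element \<open>a\<close> outside it generates the
  ring. So some multiple of \<open>a\<close> is one minus an element of the maximal ideal, which a
  geometric series inverts.\<close>

lemma unit_iff:
  assumes a: "a \<in> carrier R"
  shows "a \<in> Units R \<longleftrightarrow> a \<notin> max_ideal R"
proof
  assume na: "a \<notin> max_ideal R"
  let ?J = "max_ideal R <+>\<^bsub>R\<^esub> PIdl a"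
  have id: "ideal ?J R" by (intro add_ideals ideal_max_ideal cgenideal_ideal a)
  have mem: "m \<oplus> r \<otimes> a \<in> ?J" if "m \<in> max_ideal R" "r \<in> carrier R" for m r
    using that by (auto simp: set_add_def' cgenideal_def)
  have "max_ideal R \<subseteq> ?J" using mem[of _ \<zero>] a max_ideal_carr by auto
  moreover have "a \<in> ?J"
    using mem[of \<zero> \<one>] a additive_subgroup.zero_closed[OF ideal.axioms(1)[OF ideal_max_ideal]] by simp
  moreover have "?J \<subseteq> carrier R" using ideal.Icarr[OF id] by blast
  ultimately have "?J = carrier R"
    using maximalideal.I_maximal[OF maximalideal_max_ideal id] na by blast
  then have "\<one> \<in> ?J" by simp
  then obtain m r where m: "m \<in> max_ideal R" "r \<in> carrier R" "\<one> = m \<oplus> r \<otimes> a"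
    by (auto simp: set_add_def' cgenideal_def)
  note mc = max_ideal_carr[OF m(1)]
  have "m \<oplus> r \<otimes> a \<ominus> m = r \<otimes> a" using mc m(2) a by algebra
  then have "a \<otimes> r = \<one> \<ominus> m" using m(2,3) a by (simp add: m_comm)
  then have "a \<otimes> r \<in> Units R" using one_minus_unit[OF m(1)] by simp
  then show "a \<in> Units R" using unit_factor a m(2) by blast
qed (rule unit_notin_max_ideal)

lemma unit_add_max_ideal:
  assumes "u \<in> Units R" "m \<in> max_ideal R"
  shows "u \<oplus> m \<in> Units R"
proof -
  have c: "u \<in> carrier R" "m \<in> carrier R" using assms max_ideal_carr by auto
  have "u \<oplus> m \<notin> max_ideal R"
    using ideal.add_cancel_mem[OF ideal_max_ideal c(1) assms(2)] unit_notin_max_ideal[OF assms(1)] by blast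
  then show ?thesis using unit_iff c by simp
qed

section \<open>Rings of power series in elements of the maximal ideal\<close>

definition integers :: "'a set" where
  "integers = range (\<lambda>k::int. add_pow R k \<one>)"

text \<open>This element vanishes exactly when \<open>R\<close> has characteristic \<open>p\<close>.
  The two characteristics are treated together until a division by it becomes necessary.\<close>

definition residue_char :: 'a where
  "residue_char = add_pow R (int p) \<one>"

lemma int_mult: "add_pow R (i::int) \<one> \<otimes> add_pow R (j::int) \<one> = add_pow R (i * j) \<one>"
proof -
  have "(add_pow R i \<one>) \<otimes> (add_pow R j \<one>) = add_pow R i (add_pow R j \<one>)"
    using add_pow_ldistr_int[of \<one> "add_pow R j \<one>" i] by simp
  then show ?thesis by (simp add: add.int_pow_pow mult.commute)
qed

lemma subring_integers: "subring integers R"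
proof (rule subringI)
  show "\<one> \<in> integers" unfolding integers_def by (rule range_eqI[of _ _ 1]) simp
  show "\<ominus> h \<in> integers" if "h \<in> integers" for h
    using that unfolding integers_def by (auto simp: add.int_pow_neg[symmetric])
  show "h \<otimes> k \<in> integers" if "h \<in> integers" "k \<in> integers" for h k
    using that unfolding integers_def by (auto simp: int_mult)
  show "h \<oplus> k \<in> integers" if "h \<in> integers" "k \<in> integers" for h k
    using that unfolding integers_def by (auto simp: add.int_pow_mult[symmetric])
qed (auto simp: integers_def)

lemma residue_char_mem: "residue_char \<in> max_ideal R"
proof -
  interpret I: ideal "max_ideal R" R by (rule ideal_max_ideal)
  let ?Q = "R Quot max_ideal R"
  interpret Q: ring ?Q by (rule I.quotient_is_ring)
  have pow: "add_pow ?Q n \<one>\<^bsub>?Q\<^esub> = max_ideal R +> (add_pow R n \<one>)" for n :: nat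
  proof (induction n)
    case 0
    have "\<zero>\<^bsub>?Q\<^esub> = max_ideal R" by (simp add: FactRing_def)
    then show ?case by (simp add: I.a_rcos_const)
  next
    case (Suc n)
    have "add_pow ?Q (Suc n) \<one>\<^bsub>?Q\<^esub> = (max_ideal R +> add_pow R n \<one>) <+>\<^bsub>R\<^esub> (max_ideal R +> \<one>)"
      unfolding Q.add.nat_pow_Suc[unfolded add_pow_def[symmetric]] Suc by (simp add: FactRing_def)
    then show ?case by (simp add: I.a_rcos_sum)
  qed
  have "group.ord (add_monoid ?Q) \<one>\<^bsub>?Q\<^esub> = p"
    using characteristic_residue_field by (simp add: ring_characteristic_def)
  then have "add_pow ?Q p \<one>\<^bsub>?Q\<^esub> = \<zero>\<^bsub>?Q\<^esub>"
    using Q.add.pow_ord_eq_1[of "\<one>\<^bsub>?Q\<^esub>"] by simp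
  then have "max_ideal R +> (add_pow R p \<one>) = max_ideal R" unfolding pow by (simp add: FactRing_def)
  then have "add_pow R p \<one> \<in> max_ideal R" using I.rcos_const_imp_mem by simp
  then show ?thesis unfolding residue_char_def by (simp add: add_pow_def int_pow_int)
qed

lemma residue_char_carr: "residue_char \<in> carrier R"
  using residue_char_mem by (rule max_ideal_carr)

text \<open>By Bezout, an integer prime to \<open>p\<close> has a multiple that differs from one by
  a multiple of \<open>p\<close>, and such an element is a unit.\<close>

lemma integers_cases:
  assumes "Factorial_Ring.prime p" "a \<in> integers"
  shows "a \<in> Units R \<or> (\<exists>b\<in>integers. a = residue_char \<otimes> b)"
proof -
  obtain k :: int where k: "a = add_pow R k \<one>" using assms(2) unfolding integers_def by (rule rangeE)
  show ?thesis
  proof (cases "int p dvd k")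
    case True
    then obtain l where l: "k = int p * l" by blast
    then have "a = residue_char \<otimes> (add_pow R l \<one>)" unfolding k residue_char_def int_mult by simp
    then show ?thesis unfolding integers_def by blast
  next
    case False
    have "coprime (int p) k" using assms(1) False by (intro prime_imp_coprime) simp_all
    then obtain u v where uv: "u * int p + v * k = 1" by (metis bezout_int coprime_imp_gcd_eq_1)
    define w where "w = (add_pow R u \<one>) \<otimes> residue_char"
    define z where "z = (add_pow R v \<one>)"
    have w: "w \<in> max_ideal R" unfolding w_def
      by (intro ideal.I_l_closed[OF ideal_max_ideal] residue_char_mem) simp
    have c: "a \<in> carrier R" "z \<in> carrier R" "w \<in> carrier R" using k z_def max_ideal_carr[OF w] by simp_all
    have "w \<oplus> z \<otimes> a = \<one>"
      unfolding w_def z_def k residue_char_def int_mult add.int_pow_mult[OF one_closed, symmetric] uv by simp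
    moreover have "(w \<oplus> z \<otimes> a) \<ominus> w = a \<otimes> z" using c by algebra
    ultimately have "a \<otimes> z = \<one> \<ominus> w" by simp
    then have "a \<otimes> z \<in> Units R" using one_minus_unit[OF w] by simp
    then show ?thesis using unit_factor c by blast
  qed
qed

text \<open>The image of the one-variable power series ring over \<open>B\<close> under evaluation
  at \<open>x\<close>. Different coefficient sequences may have the same value; uniqueness is the
  separate property \<open>analytically_independent\<close>.\<close>

definition adjoin :: "'a set \<Rightarrow> 'a \<Rightarrow> 'a set" where
  "adjoin B x = {series x b | b. \<forall>n. b n \<in> B}"

lemma adjoinI: "(\<And>n. b n \<in> B) \<Longrightarrow> series x b \<in> adjoin B x"
  unfolding adjoin_def by blast

lemma adjoinE:
  assumes "a \<in> adjoin B x"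
  obtains b where "\<And>n. b n \<in> B" "a = series x b"
  using assms unfolding adjoin_def by blast

lemma series_Cons:
  assumes x: "x \<in> max_ideal R" and B: "B \<subseteq> carrier R" and "a \<in> B" "\<And>n. b n \<in> B"
  shows "series x (case_nat a b) = a \<oplus> x \<otimes> series x b"
proof -
  have "case_nat a b n \<in> carrier R" for n using assms by (cases n) auto
  from series_shift[OF x this] show ?thesis by simp
qed

lemma adjoin_Cons:
  assumes x: "x \<in> max_ideal R" and B: "B \<subseteq> carrier R" and a: "a \<in> B" and y: "y \<in> adjoin B x"
  shows "a \<oplus> x \<otimes> y \<in> adjoin B x"
proof -
  from y obtain b where b: "\<And>n. b n \<in> B" "y = series x b" unfolding adjoin_def by blast
  have "series x (case_nat a b) \<in> adjoin B x"
    by (rule adjoinI) (use a b in \<open>simp split: nat.split\<close>)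
  then show ?thesis using series_Cons[OF x B a b(1)] b(2) by simp
qed

lemma subset_adjoin:
  assumes "subring B R" "x \<in> max_ideal R"
  shows "B \<subseteq> adjoin B x"
proof
  fix a assume a: "a \<in> B"
  note B = subringE[OF assms(1)]
  have "series x (case_nat a (\<lambda>_. \<zero>)) = a"
    using series_zero_tail[OF assms(2), of "case_nat a (\<lambda>_. \<zero>)"] B a by auto
  then show "a \<in> adjoin B x"
    using adjoinI[of "case_nat a (\<lambda>_. \<zero>)" B x] B(2) a by (auto split: nat.split)
qed

lemma adjoin_closed:
  assumes "subring B R" "x \<in> max_ideal R"
  shows "adjoin B x \<subseteq> carrier R"
  using subringE(1)[OF assms(1)] assms(2) by (auto elim!: adjoinE intro!: series_closed)

lemma subring_adjoin:
  assumes B: "subring B R" and x: "x \<in> max_ideal R"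
  shows "subring (adjoin B x) R"
proof (rule subringI)
  note BE = subringE[OF B]
  have Bc: "\<And>b. b \<in> B \<Longrightarrow> b \<in> carrier R" using BE(1) by blast
  show "adjoin B x \<subseteq> carrier R" using adjoin_closed assms by blast
  show "\<one> \<in> adjoin B x" using subset_adjoin[OF assms] BE(3) by blast
  have mult: "h \<otimes> k \<in> adjoin B x" if "h \<in> adjoin B x" "k \<in> adjoin B x" for h k
  proof -
    from that(1) obtain b where b: "\<And>n. b n \<in> B" "h = series x b" unfolding adjoin_def by blast
    from that(2) obtain c where c: "\<And>n. c n \<in> B" "k = series x c" unfolding adjoin_def by blast
    from b c have "h \<otimes> k = series x (conv b c)" using series_mult[OF x] Bc by blast
    then show ?thesis using adjoinI conv_closed[OF B, of b c] b(1) c(1) by metis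
  qed
  then show "h \<otimes> k \<in> adjoin B x" if "h \<in> adjoin B x" "k \<in> adjoin B x" for h k using that .
  show "h \<oplus> k \<in> adjoin B x" if "h \<in> adjoin B x" "k \<in> adjoin B x" for h k
  proof -
    from that(1) obtain b where b: "\<And>n. b n \<in> B" "h = series x b" unfolding adjoin_def by blast
    from that(2) obtain c where c: "\<And>n. c n \<in> B" "k = series x c" unfolding adjoin_def by blast
    from b c have "h \<oplus> k = series x (\<lambda>n. b n \<oplus> c n)" using series_add[OF x] Bc by blast
    then show ?thesis using adjoinI[of "\<lambda>n. b n \<oplus> c n" B x] BE(7) b(1) c(1) by metis
  qed
  show "\<ominus> h \<in> adjoin B x" if "h \<in> adjoin B x" for h
  proof -
    have "\<ominus> \<one> \<in> adjoin B x" using subset_adjoin[OF assms] BE(3,5) by blast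
    then have "\<ominus> \<one> \<otimes> h \<in> adjoin B x" using mult that by blast
    moreover have "\<ominus> \<one> \<otimes> h = \<ominus> h" using adjoin_closed[OF assms] that by (auto simp: l_minus)
    ultimately show ?thesis by simp
  qed
qed

lemma generator_mem_adjoin:
  assumes B: "subring B R" and x: "x \<in> max_ideal R"
  shows "x \<in> adjoin B x"
proof -
  have "\<zero> \<oplus> x \<otimes> \<one> \<in> adjoin B x"
    by (intro adjoin_Cons x subringE[OF B] subringE(3)[OF subring_adjoin[OF assms]])
  then show ?thesis using max_ideal_carr[OF x] by simp
qed

text \<open>Stage zero is the image of the p-adic integers, obtained by treating
  \<open>residue_char\<close> as one more element to be adjoined, so that all stages fall under
  \<open>adjoin\<close>.\<close>

primrec tower :: "(nat \<Rightarrow> 'a) \<Rightarrow> nat \<Rightarrow> 'a set" where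
  "tower \<xi> 0 = adjoin integers residue_char"
| "tower \<xi> (Suc k) = adjoin (tower \<xi> k) (\<xi> k)"

lemma subring_tower: "(\<And>i. i < k \<Longrightarrow> \<xi> i \<in> max_ideal R) \<Longrightarrow> subring (tower \<xi> k) R"
  by (induction k) (auto intro!: subring_adjoin subring_integers residue_char_mem)

lemma residue_char_mem_tower:
  "(\<And>i. i < k \<Longrightarrow> \<xi> i \<in> max_ideal R) \<Longrightarrow> residue_char \<in> tower \<xi> k"
proof (induction k)
  case 0
  then show ?case using generator_mem_adjoin[OF subring_integers residue_char_mem] by simp
next
  case (Suc k)
  then show ?case using subset_adjoin[OF subring_tower, of k \<xi> "\<xi> k"] by auto
qed

lemma generator_mem_tower:
  "\<lbrakk>\<And>i. i < k \<Longrightarrow> \<xi> i \<in> max_ideal R; i < k\<rbrakk> \<Longrightarrow> \<xi> i \<in> tower \<xi> k"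
proof (induction k)
  case (Suc k)
  have s: "subring (tower \<xi> k) R" by (rule subring_tower) (simp add: Suc.prems)
  show ?case
  proof (cases "i = k")
    case True
    then show ?thesis using generator_mem_adjoin[OF s] Suc.prems(1) by simp
  next
    case False
    then show ?thesis using subset_adjoin[OF s, of "\<xi> k"] Suc by auto
  qed
qed simp

text \<open>Only the constant coefficient matters, since the rest of the series is divisible by
  \<open>residue_char\<close> with quotient in the same subring. The alternative reflects that the
  p-adic integers form a valuation ring.\<close>

lemma tower_0_cases:
  assumes p: "Factorial_Ring.prime p" and a: "a \<in> tower \<xi> 0"
  shows "a \<in> Units R \<or> (\<exists>b\<in>tower \<xi> 0. a = residue_char \<otimes> b)"
proof -
  from a[unfolded tower.simps] obtain b where b: "\<And>n. b n \<in> integers" "a = series residue_char b"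
    unfolding adjoin_def by blast
  have bc: "b n \<in> carrier R" for n using b(1) subringE(1)[OF subring_integers] by blast
  define y where "y = series residue_char (\<lambda>n. b (Suc n))"
  have y: "y \<in> tower \<xi> 0" unfolding y_def tower.simps by (intro adjoinI b)
  have yc: "y \<in> carrier R" unfolding y_def by (intro series_closed residue_char_mem bc)
  have eq: "a = b 0 \<oplus> residue_char \<otimes> y" unfolding b(2) y_def by (intro series_shift residue_char_mem bc)
  show ?thesis
  proof (cases "b 0 \<in> Units R")
    case True
    have "residue_char \<otimes> y \<in> max_ideal R" by (intro ideal.I_r_closed[OF ideal_max_ideal] residue_char_mem yc)
    then show ?thesis using unit_add_max_ideal[OF True] eq by simp
  next
    case False
    then obtain c where c: "c \<in> integers" "b 0 = residue_char \<otimes> c" using integers_cases[OF p b(1)] by blast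
    have s: "subring (tower \<xi> 0) R" by (rule subring_tower) simp
    have "c \<in> tower \<xi> 0" using subset_adjoin[OF subring_integers residue_char_mem] c(1) by auto
    then have "c \<oplus> y \<in> tower \<xi> 0" using y subringE(7)[OF s] by blast
    moreover have "c \<in> carrier R" using c(1) subringE(1)[OF subring_integers] by blast
    then have "a = residue_char \<otimes> (c \<oplus> y)" unfolding eq c(2) using yc residue_char_carr by (simp add: r_distr)
    ultimately show ?thesis by blast
  qed
qed

end

section \<open>Congruences modulo an ideal\<close>

context ideal
begin

lemma cong_trans:
  assumes "a \<in> carrier R" "b \<in> carrier R" "c \<in> carrier R" "a \<ominus> b \<in> I" "b \<ominus> c \<in> I"
  shows "a \<ominus> c \<in> I"
proof -
  have "a \<ominus> c = (a \<ominus> b) \<oplus> (b \<ominus> c)" using assms(1-3) by algebra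
  then show ?thesis using assms(4,5) a_closed by simp
qed

lemma cong_add:
  assumes "a \<in> carrier R" "a' \<in> carrier R" "b \<in> carrier R" "b' \<in> carrier R" "a \<ominus> a' \<in> I" "b \<ominus> b' \<in> I"
  shows "(a \<oplus> b) \<ominus> (a' \<oplus> b') \<in> I"
proof -
  have "(a \<oplus> b) \<ominus> (a' \<oplus> b') = (a \<ominus> a') \<oplus> (b \<ominus> b')" using assms(1-4) by algebra
  then show ?thesis using assms(5,6) a_closed by simp
qed

lemma cong_mult:
  assumes "a \<in> carrier R" "a' \<in> carrier R" "b \<in> carrier R" "b' \<in> carrier R" "a \<ominus> a' \<in> I" "b \<ominus> b' \<in> I"
  shows "a \<otimes> b \<ominus> a' \<otimes> b' \<in> I"
proof -
  have "a \<otimes> b \<ominus> a' \<otimes> b' = (a \<ominus> a') \<otimes> b \<oplus> a' \<otimes> (b \<ominus> b')" using assms(1-4) by algebra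
  then show ?thesis using assms a_closed I_l_closed I_r_closed by simp
qed

lemma cong_refl: "a \<in> carrier R \<Longrightarrow> a \<ominus> a \<in> I"
  by (simp add: a_minus_def r_neg)

lemma cong_pow:
  assumes "a \<in> carrier R" "a' \<in> carrier R" "a \<ominus> a' \<in> I"
  shows "a [^] (n::nat) \<ominus> a' [^] n \<in> I"
  using assms by (induction n) (auto intro: cong_mult cong_refl)

end

lemma (in ring) mem_add_cgenideal:
  "\<lbrakk>a \<in> J; r \<in> carrier R\<rbrakk> \<Longrightarrow> a \<oplus> r \<otimes> z \<in> J <+>\<^bsub>R\<^esub> PIdl z"
  unfolding set_add_def' cgenideal_def by blast

lemma (in ring) mem_add_cgenidealE:
  assumes "x \<in> J <+>\<^bsub>R\<^esub> PIdl z"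
  obtains a r where "a \<in> J" "r \<in> carrier R" "x = a \<oplus> r \<otimes> z"
  using assms unfolding set_add_def' cgenideal_def by blast

section \<open>Regularity modulo \<open>p\<close> and analytic independence\<close>

context noetherian_local_pro_p_domain
begin

text \<open>Used twice: with an ideal containing \<open>residue_char\<close>, to discard
  coefficients divisible by it, and with the zero ideal, to discard vanishing coefficients.\<close>

lemma series_split:
  assumes x: "x \<in> max_ideal R" and b: "\<And>n. b n \<in> carrier R" and J: "ideal J R" and "\<And>n. n < s \<Longrightarrow> b n \<in> J"
  shows "\<exists>j\<in>J. series x b = j \<oplus> x [^] s \<otimes> series x (\<lambda>i. b (i + s))"
  using b assms(4)
proof (induction s arbitrary: b)
  case 0
  have "\<zero> \<in> J" using additive_subgroup.zero_closed[OF ideal.axioms(1)[OF J]] .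
  then show ?case using series_closed[OF x, of b, OF 0(1)] by (intro bexI[of _ \<zero>]) simp_all
next
  case (Suc s)
  note xc = max_ideal_carr[OF x]
  interpret J: ideal J R by (rule J)
  obtain j where j: "j \<in> J" "series x (\<lambda>i. b (Suc i)) = j \<oplus> x [^] s \<otimes> series x (\<lambda>i. b (Suc (i + s)))"
    using Suc.IH[of "\<lambda>i. b (Suc i)"] Suc.prems by auto
  have b0: "b 0 \<in> J" using Suc.prems(2) by simp
  have "b 0 \<oplus> x \<otimes> (j \<oplus> w \<otimes> v) = (b 0 \<oplus> x \<otimes> j) \<oplus> (w \<otimes> x) \<otimes> v"
    if "v \<in> carrier R" "w \<in> carrier R" for v w
  proof -
    have "b0 \<oplus> x \<otimes> (j \<oplus> w \<otimes> v) = (b0 \<oplus> x \<otimes> j) \<oplus> (w \<otimes> x) \<otimes> v" if "b0 \<in> carrier R" for b0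
      using that \<open>v \<in> carrier R\<close> \<open>w \<in> carrier R\<close> xc J.Icarr[OF j(1)] by algebra
    then show ?thesis using J.Icarr[OF b0] by blast
  qed
  moreover have "series x (\<lambda>i. b (Suc (i + s))) \<in> carrier R" by (intro series_closed x Suc.prems)
  ultimately have "b 0 \<oplus> x \<otimes> (j \<oplus> x [^] s \<otimes> series x (\<lambda>i. b (Suc (i + s)))) =
      (b 0 \<oplus> x \<otimes> j) \<oplus> x [^] Suc s \<otimes> series x (\<lambda>i. b (i + Suc s))"
    using xc by simp
  moreover have "series x b = b 0 \<oplus> x \<otimes> (j \<oplus> x [^] s \<otimes> series x (\<lambda>i. b (Suc (i + s))))"
    using series_shift[where b = b, OF x Suc.prems(1)] j(2) by simp
  ultimately have "series x b = (b 0 \<oplus> x \<otimes> j) \<oplus> x [^] Suc s \<otimes> series x (\<lambda>i. b (i + Suc s))" by simp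
  moreover have "b 0 \<oplus> x \<otimes> j \<in> J" using J.a_closed b0 J.I_l_closed[OF j(1)] xc by blast
  ultimately show ?case by blast
qed

text \<open>The recursive choice of the exponents \<open>N\<close> makes the substitution \<open>\<xi>\<^sub>i \<mapsto> \<xi>\<^sub>0\<^bsup>N i\<^esup>\<close> separate the
  leading monomial of a power series from all others, so that a power series that is nonzero modulo
  \<open>p\<close> becomes a unit times a power of \<open>\<xi>\<^sub>0\<close>. If its value is zero, then \<open>\<xi>\<^sub>0\<close> is nilpotent modulo
  \<open>p\<close> and the elements \<open>\<xi>\<^sub>i - \<xi>\<^sub>0\<^bsup>N i\<^esup>\<close>, and there was one parameter too many.\<close>

definition reduces_to_power :: "(nat \<Rightarrow> 'a) \<Rightarrow> nat \<Rightarrow> 'a \<Rightarrow> (nat \<Rightarrow> nat) \<Rightarrow> nat \<Rightarrow> bool" where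
  "reduces_to_power \<xi> k f N t \<longleftrightarrow>
     (\<forall>J. ideal J R \<longrightarrow> residue_char \<in> J \<longrightarrow> (\<forall>i<k. \<xi> i \<ominus> \<xi> 0 [^] N i \<in> J) \<longrightarrow>
       (\<exists>u\<in>Units R. f \<ominus> u \<otimes> \<xi> 0 [^] t \<in> J))"

text \<open>\<open>N i \<ge> Suc 0\<close> keeps the substituted powers inside the maximal ideal,
  and \<open>N 0 = Suc 0\<close> makes the congruence for \<open>\<xi> 0\<close> trivial. At
  \<open>k = 0\<close> no variable is available yet; \<open>t = 0\<close> there allows the first
  extension step to set \<open>N 0\<close> to \<open>Suc 0\<close>.\<close>

definition regular_in :: "(nat \<Rightarrow> 'a) \<Rightarrow> nat \<Rightarrow> 'a \<Rightarrow> bool" where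
  "regular_in \<xi> k f \<longleftrightarrow> (\<exists>N t. (\<forall>i<k. N i \<ge> Suc 0) \<and> (k > 0 \<longrightarrow> N 0 = Suc 0) \<and>
     (k = 0 \<longrightarrow> t = 0) \<and> reduces_to_power \<xi> k f N t)"

text \<open>Let \<open>b s\<close> be the first coefficient not divisible by
  \<open>residue_char\<close>. Modulo \<open>J\<close> the earlier terms vanish, \<open>b s\<close>
  is a unit times \<open>z [^] t\<close> for \<open>z = \<xi> 0\<close>, and \<open>\<xi> k\<close>
  is \<open>z [^] Suc t\<close>. All terms after index \<open>s\<close> then carry a higher power of
  \<open>z\<close> than the term at \<open>s\<close>, which therefore dominates.\<close>

lemma regular_step:
  assumes \<xi>: "\<And>i. i \<le> k \<Longrightarrow> \<xi> i \<in> max_ideal R"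
    and reg: "\<And>f. \<lbrakk>f \<in> tower \<xi> k; \<nexists>g. g \<in> tower \<xi> k \<and> f = residue_char \<otimes> g\<rbrakk> \<Longrightarrow>
      regular_in \<xi> k f"
    and b: "\<And>n. b n \<in> tower \<xi> k" and n: "\<nexists>g. g \<in> tower \<xi> k \<and> b n = residue_char \<otimes> g"
  shows "regular_in \<xi> (Suc k) (series (\<xi> k) b)"
proof -
  let ?P = "\<lambda>n. \<nexists>g. g \<in> tower \<xi> k \<and> b n = residue_char \<otimes> g"
  define s where "s = (LEAST n. ?P n)"
  have s: "?P s" unfolding s_def using n by (rule LeastI)
  have less: "\<exists>g. g \<in> tower \<xi> k \<and> b n = residue_char \<otimes> g" if "n < s" for n
    using not_less_Least[of n ?P, folded s_def, OF that] by (rule notnotD)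
  have tw: "subring (tower \<xi> k) R" by (rule subring_tower) (simp add: \<xi>)
  have twc: "f \<in> carrier R" if "f \<in> tower \<xi> k" for f using subringE(1)[OF tw] that by blast
  have bc: "b n \<in> carrier R" for n using twc b by blast
  obtain N t where N: "\<forall>i<k. N i \<ge> Suc 0" "k > 0 \<longrightarrow> N 0 = Suc 0" "k = 0 \<longrightarrow> t = 0"
    and red: "reduces_to_power \<xi> k (b s) N t"
    using reg[OF b s] unfolding regular_in_def by blast
  define z where "z = \<xi> 0"
  define x where "x = \<xi> k"
  have z: "z \<in> max_ideal R" and x: "x \<in> max_ideal R" unfolding z_def x_def using \<xi> by simp_all
  note zc = max_ideal_carr[OF z] and xc = max_ideal_carr[OF x]
  \<comment> \<open>The new exponent only has to exceed \<open>t\<close>. For \<open>k = 0\<close>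
    it equals \<open>Suc 0\<close>, as \<open>regular_in\<close> demands, because then
    \<open>t = 0\<close>.\<close>
  let ?N = "N(k := Suc t)"
  define r where "r = series x (\<lambda>i. b (Suc (i + s)))"
  have rc: "r \<in> carrier R" unfolding r_def by (intro series_closed x bc)
  have main: "\<exists>u\<in>Units R. series x b \<ominus> u \<otimes> z [^] (Suc t * s + t) \<in> J"
    if id: "ideal J R" and pJ: "residue_char \<in> J" and NJ: "\<forall>i<Suc k. \<xi> i \<ominus> \<xi> 0 [^] (?N i) \<in> J" for J
  proof -
    interpret J: ideal J R by (rule id)
    have "\<forall>i<k. \<xi> i \<ominus> \<xi> 0 [^] N i \<in> J"
    proof (intro allI impI)
      fix i assume "i < k"
      then show "\<xi> i \<ominus> \<xi> 0 [^] N i \<in> J" using NJ[rule_format, of i] by simp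
    qed
    then obtain u where u: "u \<in> Units R" "b s \<ominus> u \<otimes> z [^] t \<in> J"
      using red[unfolded reduces_to_power_def] id pJ unfolding z_def by blast
    have uc: "u \<in> carrier R" using u(1) by (rule Units_closed)
    have xz: "x \<ominus> z [^] Suc t \<in> J" unfolding x_def z_def using NJ[rule_format, of k] by simp
    have "b n \<in> J" if ns: "n < s" for n
    proof -
      obtain g where g: "g \<in> tower \<xi> k" "b n = residue_char \<otimes> g" using less[OF ns] by blast
      show ?thesis unfolding g(2) by (rule J.I_r_closed[OF pJ twc[OF g(1)]])
    qed
    then obtain j where j: "j \<in> J" "series x b = j \<oplus> x [^] s \<otimes> series x (\<lambda>i. b (i + s))"
      using series_split[where b = b and J = J and s = s, OF x bc id] by blast
    have ser: "series x (\<lambda>i. b (i + s)) = b s \<oplus> x \<otimes> r"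
      unfolding r_def using series_shift[OF x, of "\<lambda>i. b (i + s)"] bc by simp
    have sc: "series x b \<in> carrier R" by (intro series_closed x bc)
    define w where "w = b s \<oplus> x \<otimes> r"
    have wc: "w \<in> carrier R" unfolding w_def using bc xc rc by simp
    have "j \<oplus> v \<ominus> v = j" if "v \<in> carrier R" for v
      using that J.Icarr[OF j(1)] by algebra
    then have 1: "series x b \<ominus> x [^] s \<otimes> w \<in> J"
      unfolding j(2) ser w_def[symmetric] using j(1) xc wc by simp
    have 2: "x [^] s \<otimes> w \<ominus> (z [^] Suc t) [^] s \<otimes> (u \<otimes> z [^] t \<oplus> z [^] Suc t \<otimes> r) \<in> J"
      unfolding w_def
      by (intro J.cong_mult J.cong_add J.cong_pow xz u(2) J.cong_refl rc nat_pow_closed m_closed a_closed bc xc uc zc)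
    \<comment> \<open>Taking out the common power of \<open>z\<close> leaves
      \<open>u \<oplus> z \<otimes> r\<close>, a unit changed by an element of the maximal
      ideal.\<close>
    have "q \<otimes> (u \<otimes> v \<oplus> (v \<otimes> z) \<otimes> r) = (u \<oplus> z \<otimes> r) \<otimes> (q \<otimes> v)"
      if "q \<in> carrier R" "v \<in> carrier R" for q v
      using that uc zc rc by algebra
    then have "(z [^] Suc t) [^] s \<otimes> (u \<otimes> z [^] t \<oplus> z [^] Suc t \<otimes> r) = (u \<oplus> z \<otimes> r) \<otimes> ((z [^] Suc t) [^] s \<otimes> z [^] t)"
      using zc by simp
    also have "\<dots> = (u \<oplus> z \<otimes> r) \<otimes> z [^] (Suc t * s + t)"
      using zc by (simp only: nat_pow_pow nat_pow_mult)
    finally have "series x b \<ominus> (u \<oplus> z \<otimes> r) \<otimes> z [^] (Suc t * s + t) \<in> J"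
      using J.cong_trans[OF sc _ _ 1 2] xc zc wc uc rc by simp
    moreover have "u \<oplus> z \<otimes> r \<in> Units R"
      by (intro unit_add_max_ideal u ideal.I_r_closed[OF ideal_max_ideal] z rc)
    ultimately show ?thesis by blast
  qed
  then have "reduces_to_power \<xi> (Suc k) (series (\<xi> k) b) ?N (Suc t * s + t)"
    unfolding reduces_to_power_def x_def z_def by blast
  moreover have "\<forall>i<Suc k. ?N i \<ge> Suc 0" "?N 0 = Suc 0" using N by (auto simp: less_Suc_eq)
  ultimately show ?thesis unfolding regular_in_def by blast
qed

text \<open>If \<open>residue_char\<close> divided every coefficient, it would divide the whole
  series with quotient in the same subring; so \<open>regular_step\<close> finds a coefficient to
  start from. At stage zero the elements not divisible by it are units, and exponent zero
  works.\<close>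

lemma tower_regular:
  assumes p: "Factorial_Ring.prime p" and \<xi>: "\<And>i. i < k \<Longrightarrow> \<xi> i \<in> max_ideal R"
    and f: "f \<in> tower \<xi> k" "\<nexists>g. g \<in> tower \<xi> k \<and> f = residue_char \<otimes> g"
  shows "regular_in \<xi> k f"
  using \<xi> f
proof (induction k arbitrary: f)
  case 0
  then have u: "f \<in> Units R" using tower_0_cases[OF p, of f \<xi>] by blast
  have "f \<ominus> f \<otimes> \<xi> 0 [^] (0::nat) = \<zero>" using Units_closed[OF u] by (simp add: a_minus_def r_neg)
  then have "reduces_to_power \<xi> 0 f N 0" for N
    unfolding reduces_to_power_def using u additive_subgroup.zero_closed[OF ideal.axioms(1)] by metis
  then show ?case unfolding regular_in_def by blast
next
  case (Suc k)
  have s: "subring (tower \<xi> k) R" by (rule subring_tower) (simp add: Suc.prems(1))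
  have sc: "tower \<xi> k \<subseteq> carrier R" using subringE(1)[OF s] .
  have x: "\<xi> k \<in> max_ideal R" by (simp add: Suc.prems(1))
  obtain b where b: "\<And>n. b n \<in> tower \<xi> k" "f = series (\<xi> k) b"
    using Suc.prems(2) unfolding tower.simps adjoin_def by blast
  have "\<exists>n. \<nexists>g. g \<in> tower \<xi> k \<and> b n = residue_char \<otimes> g"
  proof (rule ccontr)
    assume "\<not> ?thesis"
    then obtain c where c: "\<And>n. c n \<in> tower \<xi> k \<and> b n = residue_char \<otimes> c n" by metis
    then have cc: "c n \<in> carrier R" for n using sc by blast
    have "b = (\<lambda>n. residue_char \<otimes> c n)" using c by blast
    then have "f = residue_char \<otimes> series (\<xi> k) c"
      unfolding b(2) using series_smult[OF x cc residue_char_carr] by simp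
    moreover have "series (\<xi> k) c \<in> tower \<xi> (Suc k)" using c by (auto intro: adjoinI)
    ultimately show False using Suc.prems(3) by blast
  qed
  then obtain n where n: "\<nexists>g. g \<in> tower \<xi> k \<and> b n = residue_char \<otimes> g" by blast
  have "regular_in \<xi> (Suc k) (series (\<xi> k) b)"
    by (rule regular_step[where b = b, OF _ _ b(1) n]) (simp add: Suc.prems(1), rule Suc.IH, simp_all add: Suc.prems(1))
  then show ?case unfolding b(2) .
qed

text \<open>The first \<open>d\<close> values generate, modulo \<open>p\<close>, an ideal containing
  a power of the maximal ideal. The least possible \<open>d\<close> is thus the dimension of
  \<open>R\<close> modulo \<open>p\<close>.\<close>

definition parameters :: "(nat \<Rightarrow> 'a) \<Rightarrow> nat \<Rightarrow> bool" where
  "parameters \<xi> d \<longleftrightarrow> (\<forall>i<d. \<xi> i \<in> max_ideal R) \<and>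
     (\<exists>s. mpow s \<subseteq> Idl (insert residue_char (\<xi> ` {..<d})))"

lemma ex_minimal_parameters:
  "\<exists>\<xi> d. parameters \<xi> d \<and> (\<forall>\<xi>' d'. parameters \<xi>' d' \<longrightarrow> d \<le> d')"
proof -
  obtain A where A: "A \<subseteq> carrier R" "finite A" "max_ideal R = Idl A"
    using finetely_gen[OF ideal_max_ideal] by blast
  obtain n :: nat and f where f: "A = f ` {i. i < n}"
    using A(2)[unfolded finite_conv_nat_seg_image] by blast
  have "Idl A \<subseteq> Idl (insert residue_char A)"
    by (rule subset_Idl_subset) (use A residue_char_carr in auto)
  then have "mpow (Suc 0) \<subseteq> Idl (insert residue_char (f ` {..<n}))"
    using A(3) f mpow_1 by (simp add: lessThan_def)
  moreover have "f i \<in> max_ideal R" if "i < n" for i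
    using genideal_self[OF A(1)] A(3) f that by blast
  ultimately have "parameters f n" unfolding parameters_def by blast
  then have "\<exists>d. \<exists>\<xi>. parameters \<xi> d" by blast
  then obtain \<xi> where "parameters \<xi> (LEAST d. \<exists>\<xi>. parameters \<xi> d)" using LeastI_ex[of "\<lambda>d. \<exists>\<xi>. parameters \<xi> d"] by blast
  moreover have "(LEAST d. \<exists>\<xi>. parameters \<xi> d) \<le> d'" if "parameters \<xi>' d'" for \<xi>' d'
    by (rule Least_le) (use that in blast)
  ultimately show ?thesis by blast
qed

text \<open>Modulo \<open>J\<close> each element of \<open>mpow s\<close> is a multiple of
  \<open>z\<close>, so a product of \<open>M\<close> such elements is a multiple of
  \<open>z [^] M\<close>.\<close>

lemma mpow_power_subset:
  assumes J: "ideal J R" and z: "z \<in> carrier R" and s: "mpow s \<subseteq> J <+>\<^bsub>R\<^esub> PIdl z"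
  shows "mpow (s * M) \<subseteq> J <+>\<^bsub>R\<^esub> PIdl (z [^] M)"
proof (induction M)
  case 0
  have "\<zero> \<oplus> r \<otimes> \<one> \<in> J <+>\<^bsub>R\<^esub> PIdl \<one>" if "r \<in> carrier R" for r
    using that additive_subgroup.zero_closed[OF ideal.axioms(1)[OF J]] by (intro mem_add_cgenideal)
  then show ?case by auto
next
  case (Suc M)
  interpret J: ideal J R by (rule J)
  let ?K = "J <+>\<^bsub>R\<^esub> PIdl (z [^] Suc M)"
  interpret K: ideal ?K R by (intro add_ideals J cgenideal_ideal nat_pow_closed z)
  have mem: "a \<oplus> r \<otimes> z [^] Suc M \<in> ?K" if "a \<in> J" "r \<in> carrier R" for a r
    using that by (rule mem_add_cgenideal)
  have "a \<in> ?K" if "a \<in> ideal_prod R (mpow (s * M)) (mpow s)" for a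
    using that
  proof induction
    case (prod i j)
    have "i \<in> J <+>\<^bsub>R\<^esub> PIdl (z [^] M)" "j \<in> J <+>\<^bsub>R\<^esub> PIdl z" using prod Suc.IH s by blast+
    then obtain a r b q where a: "a \<in> J" "r \<in> carrier R" "i = a \<oplus> r \<otimes> z [^] M"
      and b: "b \<in> J" "q \<in> carrier R" "j = b \<oplus> q \<otimes> z"
      by (elim mem_add_cgenidealE)
    have ac: "a \<in> carrier R" "b \<in> carrier R" using a b by auto
    have "(a \<oplus> r \<otimes> y) \<otimes> (b \<oplus> q \<otimes> z) = (a \<otimes> (b \<oplus> q \<otimes> z) \<oplus> (r \<otimes> y) \<otimes> b) \<oplus> (r \<otimes> q) \<otimes> (y \<otimes> z)"
      if "y \<in> carrier R" for y
      using that ac a(2) b(2) z by algebra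
    then have "i \<otimes> j = (a \<otimes> (b \<oplus> q \<otimes> z) \<oplus> (r \<otimes> z [^] M) \<otimes> b) \<oplus> (r \<otimes> q) \<otimes> z [^] Suc M"
      unfolding a(3) b(3) using z by simp
    moreover have "a \<otimes> (b \<oplus> q \<otimes> z) \<oplus> (r \<otimes> z [^] M) \<otimes> b \<in> J"
      by (intro J.a_closed J.I_r_closed J.I_l_closed a b) (use ac a b z in simp_all)
    ultimately show ?case using mem a(2) b(2) by simp
  next
    case (sum s1 s2)
    then show ?case using K.a_closed by blast
  qed
  moreover have "mpow (s * Suc M) = ideal_prod R (mpow (s * M)) (mpow s)"
    unfolding mpow_add[symmetric] by (simp add: add.commute)
  ultimately show ?case by blast
qed

text \<open>Regularity of zero puts a power of \<open>z = \<xi> 0\<close> into the ideal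
  \<open>J\<close> generated by \<open>residue_char\<close> and \<open>d - 1\<close> modified
  parameters. As \<open>J\<close> and \<open>z\<close> together contain a power of the maximal
  ideal, so does \<open>J\<close> alone, against the minimality of \<open>d\<close>.\<close>

lemma no_regular_relation:
  assumes par: "parameters \<xi> d" and min: "\<And>\<xi>' d'. parameters \<xi>' d' \<Longrightarrow> d \<le> d'" and k: "k < d"
    and reg: "regular_in \<xi> (Suc k) \<zero>"
  shows False
proof -
  obtain N t where N: "\<forall>i<Suc k. N i \<ge> Suc 0" "N 0 = Suc 0"
    and red: "reduces_to_power \<xi> (Suc k) \<zero> N t"
    using reg unfolding regular_in_def by blast
  have \<xi>: "\<xi> i \<in> max_ideal R" if "i < d" for i using par that unfolding parameters_def by blast
  define z where "z = \<xi> 0"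
  have z: "z \<in> max_ideal R" unfolding z_def using \<xi> k by simp
  note zc = max_ideal_carr[OF z]
  \<comment> \<open>The shift of the index drops \<open>\<xi> 0\<close>. The first \<open>k\<close>
    entries are the differences that \<open>reduces_to_power\<close> wants in \<open>J\<close>; the
    parameters beyond \<open>\<xi> k\<close> are kept.\<close>
  define \<xi>' where "\<xi>' j = (if j < k then \<xi> (Suc j) \<ominus> z [^] N (Suc j) else \<xi> (Suc j))" for j
  have \<xi>': "\<xi>' j \<in> max_ideal R" if "j < d - 1" for j
  proof -
    have 1: "\<xi> (Suc j) \<in> max_ideal R" using \<xi> that by simp
    have "z [^] N (Suc j) \<in> max_ideal R" if "j < k"
    proof -
      have "Suc 0 \<le> N (Suc j)" using N(1) that by simp
      then show ?thesis using mpow_mono[of "Suc 0" "N (Suc j)"] pow_mem_mpow[OF z, of "N (Suc j)"] mpow_1 by blast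
    qed
    then show ?thesis unfolding \<xi>'_def using 1 ideal.minus_closed[OF ideal_max_ideal] by simp
  qed
  define G where "G = insert residue_char (\<xi>' ` {..<d - 1})"
  have Gc: "G \<subseteq> carrier R" unfolding G_def using \<xi>' residue_char_carr max_ideal_carr by auto
  define J where "J = Idl G"
  have id: "ideal J R" unfolding J_def using Gc by (rule genideal_ideal)
  interpret J: ideal J R by (rule id)
  have gen: "g \<in> J" if "g \<in> G" for g using genideal_self[OF Gc] that unfolding J_def by blast
  have pJ: "residue_char \<in> J" by (rule gen) (simp add: G_def)
  have \<xi>J: "\<xi>' j \<in> J" if "j < d - 1" for j by (rule gen) (use that in \<open>simp add: G_def\<close>)
  have congJ: "\<xi> i \<ominus> z [^] N i \<in> J" if "i \<le> k" for i
  proof (cases i)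
    case 0
    then show ?thesis using N(2) zc J.cong_refl by (simp add: z_def)
  next
    case (Suc j)
    then show ?thesis using \<xi>J[of j] that k unfolding \<xi>'_def by simp
  qed
  obtain u where u: "u \<in> Units R" "\<zero> \<ominus> u \<otimes> z [^] t \<in> J"
    using red[unfolded reduces_to_power_def] id pJ congJ unfolding z_def less_Suc_eq_le by blast
  have zt: "z [^] t \<in> J"
  proof -
    define y where "y = z [^] t"
    have yc: "y \<in> carrier R" unfolding y_def using zc by simp
    have uc: "u \<in> carrier R" "inv u \<in> carrier R" using Units_closed[OF u(1)] u(1) by simp_all
    have "inv u \<otimes> (\<zero> \<ominus> (\<zero> \<ominus> u \<otimes> y)) \<in> J"
      by (rule J.I_l_closed[OF J.minus_closed[OF J.zero_closed u(2)[folded y_def]] uc(2)])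
    moreover have "inv u \<otimes> (\<zero> \<ominus> (\<zero> \<ominus> u \<otimes> y)) = (inv u \<otimes> u) \<otimes> y"
    proof -
      have "v \<otimes> (\<zero> \<ominus> (\<zero> \<ominus> u \<otimes> y)) = (v \<otimes> u) \<otimes> y" if "v \<in> carrier R" for v
        using that uc(1) yc by algebra
      then show ?thesis using uc(2) by blast
    qed
    ultimately show ?thesis using u(1) yc by (simp add: y_def)
  qed
  let ?K = "J <+>\<^bsub>R\<^esub> PIdl z"
  interpret K: ideal ?K R by (intro add_ideals id cgenideal_ideal zc)
  have mem: "a \<oplus> r \<otimes> z \<in> ?K" if "a \<in> J" "r \<in> carrier R" for a r
    using that by (rule mem_add_cgenideal)
  have JK: "a \<in> ?K" if "a \<in> J" for a
    using mem[OF that zero_closed] J.Icarr[OF that] zc by simp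
  \<comment> \<open>For \<open>i \<le> k\<close> the parameter differs by an element of
    \<open>J\<close> from a power of \<open>z\<close>, and this power is a multiple of
    \<open>z\<close> because \<open>N i\<close> is positive.\<close>
  have "\<xi> i \<in> ?K" if "i < d" for i
  proof (cases "i \<le> k")
    case True
    have "Suc 0 \<le> N i" using N(1) True by simp
    then obtain m where m: "N i = Suc m" by (cases "N i") simp_all
    have "\<xi> i = (\<xi> i \<ominus> z [^] N i) \<oplus> z [^] m \<otimes> z"
    proof -
      have "x = (x \<ominus> y \<otimes> z) \<oplus> y \<otimes> z" if "x \<in> carrier R" "y \<in> carrier R" for x y
        using that zc by algebra
      then show ?thesis unfolding m using max_ideal_carr[OF \<xi>[OF that]] zc by simp
    qed
    then show ?thesis using mem[OF congJ[OF True], of "z [^] m"] zc by simp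
  next
    case False
    then have "\<xi> i = \<xi>' (i - 1)" "i - 1 < d - 1" using that unfolding \<xi>'_def by auto
    then show ?thesis using JK \<xi>J by simp
  qed
  then have "Idl (insert residue_char (\<xi> ` {..<d})) \<subseteq> ?K"
    by (intro genideal_minimal K.is_ideal) (use JK[OF pJ] in blast)
  then obtain s where "mpow s \<subseteq> ?K" using par unfolding parameters_def by blast
  \<comment> \<open>The exponent is chosen as \<open>t\<close> so that the principal summand is
    absorbed by \<open>J\<close>.\<close>
  then have "mpow (s * t) \<subseteq> J <+>\<^bsub>R\<^esub> PIdl (z [^] t)" by (rule mpow_power_subset[OF id zc])
  also have "\<dots> \<subseteq> J"
  proof
    fix x assume "x \<in> J <+>\<^bsub>R\<^esub> PIdl (z [^] t)"
    then obtain a r where a: "a \<in> J" "r \<in> carrier R" "x = a \<oplus> r \<otimes> z [^] t" by (rule mem_add_cgenidealE)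
    show "x \<in> J" unfolding a(3) by (intro J.a_closed J.I_l_closed a(1,2) zt)
  qed
  finally have "parameters \<xi>' (d - 1)" unfolding parameters_def J_def G_def using \<xi>' by blast
  then show False using min k by fastforce
qed

text \<open>A coefficient not divisible by \<open>residue_char\<close> would make the series
  regular, which a series with value zero cannot be. So all coefficients are divisible by it. In
  characteristic \<open>p\<close> this says that they vanish; otherwise the division is repeated
  without end.\<close>

lemma analytic_independence:
  assumes p: "Factorial_Ring.prime p"
    and par: "parameters \<xi> d" and min: "\<And>\<xi>' d'. parameters \<xi>' d' \<Longrightarrow> d \<le> d'" and k: "k < d"
    and b: "\<And>n. b n \<in> tower \<xi> k" and zero: "series (\<xi> k) b = \<zero>"
  shows "b n = \<zero>"
proof -
  have \<xi>: "\<xi> i \<in> max_ideal R" if "i < d" for i using par that unfolding parameters_def by blast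
  have x: "\<xi> k \<in> max_ideal R" using \<xi> k by simp
  have s: "subring (tower \<xi> k) R" by (rule subring_tower) (use \<xi> k in simp)
  have sc: "f \<in> tower \<xi> k \<Longrightarrow> f \<in> carrier R" for f using subringE(1)[OF s] by blast
  have div: "\<exists>g. g \<in> tower \<xi> k \<and> b n = residue_char \<otimes> g"
    if b: "\<And>n. b n \<in> tower \<xi> k" and zero: "series (\<xi> k) b = \<zero>" for b n
  proof (rule ccontr)
    assume n: "\<not> ?thesis"
    have "regular_in \<xi> (Suc k) (series (\<xi> k) b)"
      by (rule regular_step[where b = b, OF _ _ b n]) (use \<xi> k in simp, rule tower_regular[OF p], use \<xi> k in simp_all)
    then show False using no_regular_relation[OF par min k] zero by simp
  qed
  show ?thesis
  proof (cases "residue_char = \<zero>")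
    case True
    obtain g where g: "g \<in> tower \<xi> k" "b n = residue_char \<otimes> g" using div b zero by blast
    show ?thesis unfolding g(2) True using sc[OF g(1)] by simp
  next
    case False
    \<comment> \<open>The quotients of the coefficients by \<open>residue_char\<close> again form a
      series with value zero, because \<open>R\<close> is a domain. Each division gains one power of
      the maximal ideal.\<close>
    have "b n \<in> mpow j" if "\<And>n. b n \<in> tower \<xi> k" "series (\<xi> k) b = \<zero>" for b n j
      using that
    proof (induction j arbitrary: b n)
      case 0
      then show ?case using sc by simp
    next
      case (Suc j)
      have "\<forall>n. \<exists>g. g \<in> tower \<xi> k \<and> b n = residue_char \<otimes> g" using div[of b] Suc.prems by blast
      then obtain c where c: "\<And>n. c n \<in> tower \<xi> k" "\<And>n. b n = residue_char \<otimes> c n" by metis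
      have cc: "c n \<in> carrier R" for n using c sc by blast
      have "b = (\<lambda>n. residue_char \<otimes> c n)" using c by blast
      then have "residue_char \<otimes> series (\<xi> k) c = \<zero>"
        using series_smult[OF x cc residue_char_carr] Suc.prems(2) by simp
      then have "series (\<xi> k) c = \<zero>"
        using integral[of residue_char "series (\<xi> k) c"] False residue_char_carr series_closed[where b = c, OF x cc] by blast
      then have "c n \<in> mpow j" using Suc.IH c by blast
      then show ?case unfolding c(2) using mpow_SucI residue_char_mem by blast
    qed
    then show ?thesis using eq_zero_if_mem_all b zero by blast
  qed
qed

end

section \<open>Monomializing endomorphisms\<close>

definition (in ring) subring_endo :: "'a set \<Rightarrow> ('a \<Rightarrow> 'a) \<Rightarrow> bool" where
  "subring_endo B \<phi> \<longleftrightarrow> (\<forall>a\<in>B. \<phi> a \<in> B) \<and> (\<forall>a\<in>B. \<forall>b\<in>B. \<phi> (a \<oplus> b) = \<phi> a \<oplus> \<phi> b) \<and>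
     (\<forall>a\<in>B. \<forall>b\<in>B. \<phi> (a \<otimes> b) = \<phi> a \<otimes> \<phi> b) \<and> \<phi> \<one> = \<one> \<and> (\<forall>a\<in>B. \<phi> a = \<zero> \<longrightarrow> a = \<zero>)"

lemma (in ring) subring_endoD:
  assumes "subring_endo B \<phi>"
  shows "a \<in> B \<Longrightarrow> \<phi> a \<in> B" "\<lbrakk>a \<in> B; b \<in> B\<rbrakk> \<Longrightarrow> \<phi> (a \<oplus> b) = \<phi> a \<oplus> \<phi> b"
    "\<lbrakk>a \<in> B; b \<in> B\<rbrakk> \<Longrightarrow> \<phi> (a \<otimes> b) = \<phi> a \<otimes> \<phi> b" "\<phi> \<one> = \<one>" "\<lbrakk>a \<in> B; \<phi> a = \<zero>\<rbrakk> \<Longrightarrow> a = \<zero>"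
  using assms unfolding subring_endo_def by simp_all

lemma (in ring) subring_endo_zero:
  assumes "subring B R" "subring_endo B \<phi>"
  shows "\<phi> \<zero> = \<zero>"
proof -
  note B = subringE[OF assms(1)]
  have c: "\<phi> \<zero> \<in> carrier R" using subring_endoD(1)[OF assms(2) B(2)] B(1) by blast
  have "\<phi> \<zero> \<oplus> \<phi> \<zero> = \<phi> \<zero>" using subring_endoD(2)[OF assms(2) B(2) B(2)] by simp
  then show ?thesis using add.l_cancel_one[OF c c] by simp
qed

lemma (in cring) divides_unit_mult:
  assumes "a \<in> carrier R" "b \<in> carrier R" "u \<in> Units R" "v \<in> carrier R" "a divides b"
  shows "a \<otimes> u divides b \<otimes> v"
proof -
  obtain c where c: "c \<in> carrier R" "b = a \<otimes> c" using assms(5) by (auto elim: dividesE)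
  have uc: "u \<in> carrier R" "inv u \<in> carrier R" using assms(3) Units_closed by auto
  have "b \<otimes> v = (a \<otimes> u) \<otimes> (inv u \<otimes> (c \<otimes> v))"
  proof -
    have "(a \<otimes> u) \<otimes> (w \<otimes> (c \<otimes> v)) = (u \<otimes> w) \<otimes> ((a \<otimes> c) \<otimes> v)" if "w \<in> carrier R" for w
      using that assms(1,4) c(1) uc(1) by algebra
    then show ?thesis using uc assms c by simp
  qed
  then show ?thesis using uc c assms by (intro dividesI[of "inv u \<otimes> (c \<otimes> v)"]) simp_all
qed

section \<open>Substitutions in power series\<close>

context noetherian_local_pro_p_domain
begin

text \<open>Otherwise \<open>residue_char\<close> could be divided out indefinitely, and
  \<open>f\<close> would lie in every power of the maximal ideal.\<close>

lemma tower_0_factor: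
  assumes p: "Factorial_Ring.prime p" and f: "f \<in> tower \<xi> 0" "f \<noteq> \<zero>"
  shows "\<exists>n::nat. \<exists>u\<in>Units R. f = residue_char [^] n \<otimes> u"
proof (rule ccontr)
  assume no: "\<not> ?thesis"
  have s: "subring (tower \<xi> 0) R" by (rule subring_tower) simp
  have sc: "g \<in> tower \<xi> 0 \<Longrightarrow> g \<in> carrier R" for g using subringE(1)[OF s] by blast
  have ex: "\<exists>g\<in>tower \<xi> 0. f = residue_char [^] n \<otimes> g" for n :: nat
  proof (induction n)
    case 0
    then show ?case using f sc by simp
  next
    case (Suc n)
    then obtain g where g: "g \<in> tower \<xi> 0" "f = residue_char [^] n \<otimes> g" by blast
    then have "g \<notin> Units R" using no by blast
    then obtain h where h: "h \<in> tower \<xi> 0" "g = residue_char \<otimes> h" using tower_0_cases[OF p g(1)] by blast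
    have "f = residue_char [^] Suc n \<otimes> h" unfolding g(2) h(2) using sc[OF h(1)] residue_char_carr
      by (simp add: m_assoc)
    then show ?case using h(1) by blast
  qed
  have "f \<in> mpow n" for n
  proof -
    obtain g where g: "g \<in> tower \<xi> 0" "f = residue_char [^] n \<otimes> g" using ex by blast
    show ?thesis unfolding g(2)
      by (rule ideal.I_r_closed[OF ideal_mpow pow_mem_mpow[OF residue_char_mem] sc[OF g(1)]])
  qed
  then show False using eq_zero_if_mem_all f(2) by blast
qed

lemma series_diff:
  assumes x: "x \<in> max_ideal R" and b: "\<And>n. b n \<in> carrier R" and c: "\<And>n. c n \<in> carrier R"
  shows "series x b \<ominus> series x c = series x (\<lambda>n. b n \<ominus> c n)"
proof -
  have d: "\<And>n. \<ominus> \<one> \<otimes> c n \<in> carrier R" using c by simp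
  have sc: "series x c \<in> carrier R" by (intro series_closed x c)
  have "series x b \<oplus> (\<ominus> \<one> \<otimes> series x c) = series x (\<lambda>n. b n \<oplus> (\<ominus> \<one> \<otimes> c n))"
    using series_smult[OF x c, of "\<ominus> \<one>"] series_add[OF x b d] by simp
  then show ?thesis using c sc by (simp add: a_minus_def l_minus)
qed

text \<open>Scaling the variable by \<open>t\<close> multiplies the \<open>n\<close>-th coefficient
  by \<open>t [^] n\<close>, which respects Cauchy products. The factor \<open>r\<close> strengthens
  the statement for the induction: passing to the tail of \<open>b\<close> leaves a factor
  \<open>t\<close>.\<close>

lemma conv_scale:
  assumes "\<And>n. b n \<in> carrier R" "\<And>n. c n \<in> carrier R" "t \<in> carrier R" "r \<in> carrier R"
  shows "conv (\<lambda>i. r \<otimes> (b i \<otimes> t [^] i)) (\<lambda>i. c i \<otimes> t [^] i) n = r \<otimes> (conv b c n \<otimes> t [^] n)"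
  using assms(1,4)
proof (induction n arbitrary: b r)
  case 0
  then show ?case using assms(2,3) by (simp add: m_assoc)
next
  case (Suc n)
  have "r \<otimes> (b (Suc i) \<otimes> t [^] Suc i) = (r \<otimes> t) \<otimes> (b (Suc i) \<otimes> t [^] i)" for i
  proof -
    have "r \<otimes> (u \<otimes> (v \<otimes> t)) = (r \<otimes> t) \<otimes> (u \<otimes> v)" if "u \<in> carrier R" "v \<in> carrier R" for u v
      using that assms(3) Suc.prems(2) by algebra
    then show ?thesis using Suc.prems(1) assms(3) by simp
  qed
  then have "conv (\<lambda>i. r \<otimes> (b (Suc i) \<otimes> t [^] Suc i)) (\<lambda>i. c i \<otimes> t [^] i) n =
      (r \<otimes> t) \<otimes> (conv (\<lambda>i. b (Suc i)) c n \<otimes> t [^] n)"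
    using Suc.IH[of "\<lambda>i. b (Suc i)" "r \<otimes> t"] Suc.prems assms(3) by simp
  moreover have "(r \<otimes> (u \<otimes> \<one>)) \<otimes> (v \<otimes> w) \<oplus> (r \<otimes> t) \<otimes> (q \<otimes> w') = r \<otimes> ((u \<otimes> v \<oplus> q) \<otimes> w)"
    if "u \<in> carrier R" "v \<in> carrier R" "w' \<in> carrier R" "q \<in> carrier R" "w = w' \<otimes> t" for u v w q w'
    unfolding that(5) using that(1-4) assms(3) Suc.prems(2) by algebra
  moreover have "conv (\<lambda>i. b (Suc i)) c n \<in> carrier R" by (intro conv_carr Suc.prems assms)
  ultimately show ?case using Suc.prems assms by simp
qed

lemma conv_endo:
  assumes "subring B R" "subring_endo B \<phi>" "\<And>n. b n \<in> B" "\<And>n. c n \<in> B"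
  shows "\<phi> (conv b c n) = conv (\<lambda>i. \<phi> (b i)) (\<lambda>i. \<phi> (c i)) n"
  using assms(3)
proof (induction n arbitrary: b)
  case 0
  then show ?case using subring_endoD(3)[OF assms(2)] assms(4) by simp
next
  case (Suc n)
  have "conv (\<lambda>i. b (Suc i)) c n \<in> B" by (rule conv_closed[OF assms(1)]) (use Suc.prems assms(4) in simp_all)
  moreover have "b 0 \<otimes> c (Suc n) \<in> B" using subringE(6)[OF assms(1)] Suc.prems assms(4) by simp
  ultimately show ?case
    using Suc.IH[of "\<lambda>i. b (Suc i)"] Suc.prems assms(4) subring_endoD(2,3)[OF assms(2)] by simp
qed

definition analytically_independent :: "'a set \<Rightarrow> 'a \<Rightarrow> bool" where
  "analytically_independent B x \<longleftrightarrow> (\<forall>b. (\<forall>n. b n \<in> B) \<longrightarrow> series x b = \<zero> \<longrightarrow> (\<forall>n. b n = \<zero>))"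

text \<open>The map applies \<open>\<phi>\<close> to the coefficients and replaces the variable by
  \<open>t\<close> times itself. Independence makes it well defined; it also gives injectivity,
  since multiplication by a power of the nonzero \<open>t\<close> kills no coefficient.\<close>

lemma adjoin_endo:
  assumes B: "subring B R" and x: "x \<in> max_ideal R" and ind: "analytically_independent B x"
    and \<phi>: "subring_endo B \<phi>" and t: "t \<in> B" "t \<noteq> \<zero>"
  shows "\<exists>\<psi>. subring_endo (adjoin B x) \<psi> \<and> (\<forall>a\<in>B. \<psi> a = \<phi> a) \<and>
    (\<forall>b. (\<forall>n. b n \<in> B) \<longrightarrow> \<psi> (series x b) = series x (\<lambda>n. \<phi> (b n) \<otimes> t [^] n))"
proof -
  note BE = subringE[OF B]
  note \<phi>D = subring_endoD[OF \<phi>]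
  have Bc: "\<And>b. b \<in> B \<Longrightarrow> b \<in> carrier R" using BE(1) by blast
  have tn: "t [^] n \<in> B" for n :: nat
    by (induction n) (use BE(3,6) t in simp_all)
  have tn0: "t [^] n \<noteq> \<zero>" for n :: nat
    by (induction n) (use tn Bc t integral[of "t [^] _" t] in auto)
  define coeffs where "coeffs f = (SOME b. (\<forall>n. b n \<in> B) \<and> f = series x b)" for f
  define \<psi> where "\<psi> f = series x (\<lambda>n. \<phi> (coeffs f n) \<otimes> t [^] n)" for f
  have inj: "b = c" if b: "\<And>n. b n \<in> B" and c: "\<And>n. c n \<in> B" and eq: "series x b = series x c" for b c
  proof
    fix n
    have bc: "\<And>n. b n \<in> carrier R" "\<And>n. c n \<in> carrier R" using b c Bc by auto
    have "series x (\<lambda>n. b n \<ominus> c n) = \<zero>"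
      using series_diff[where b = b and c = c, OF x bc] eq series_closed[where b = c, OF x bc(2)]
      by (simp add: a_minus_def r_neg)
    moreover have "b n \<ominus> c n \<in> B" for n unfolding a_minus_def using BE b c by simp
    ultimately have "b n \<ominus> c n = \<zero>"
      using ind[unfolded analytically_independent_def, rule_format, of "\<lambda>n. b n \<ominus> c n" n] by blast
    then show "b n = c n" using bc by simp
  qed
  have \<psi>: "\<psi> (series x b) = series x (\<lambda>n. \<phi> (b n) \<otimes> t [^] n)" if b: "\<And>n. b n \<in> B" for b
  proof -
    have "\<exists>c. (\<forall>n. c n \<in> B) \<and> series x b = series x c" using b by blast
    from someI_ex[OF this] have "\<And>n. coeffs (series x b) n \<in> B" "series x b = series x (coeffs (series x b))"
      unfolding coeffs_def by blast+
    then have "coeffs (series x b) = b" using inj[of "coeffs (series x b)" b] b by simp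
    then show ?thesis unfolding \<psi>_def by simp
  qed
  have co: "\<phi> (b n) \<otimes> t [^] n \<in> B" if "\<And>n. b n \<in> B" for b and n :: nat
    using BE(6) \<phi>D(1) tn that by simp
  have Bext: "\<psi> a = \<phi> a" if "a \<in> B" for a
  proof -
    define b where "b = case_nat a (\<lambda>_. \<zero>)"
    have b: "b n \<in> B" for n unfolding b_def using that BE(2) by (cases n) auto
    have "series x b = a" using series_zero_tail[OF x, of b] that Bc by (simp add: b_def)
    then have "\<psi> a = series x (\<lambda>n. \<phi> (b n) \<otimes> t [^] n)" using \<psi>[of b] b by simp
    also have "\<dots> = \<phi> (b 0) \<otimes> t [^] (0::nat)"
    proof (rule series_zero_tail[OF x])
      show "\<phi> (b 0) \<otimes> t [^] (0::nat) \<in> carrier R" using \<phi>D(1)[OF b[of 0]] Bc by simp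
      have "t [^] Suc n \<in> carrier R" for n using tn Bc by blast
      then show "\<phi> (b (Suc n)) \<otimes> t [^] Suc n = \<zero>" for n
        using subring_endo_zero[OF B \<phi>] by (simp add: b_def)
    qed
    also have "\<dots> = \<phi> a" using \<phi>D(1)[OF that] Bc by (simp add: b_def)
    finally show ?thesis .
  qed
  have "subring_endo (adjoin B x) \<psi>"
    unfolding subring_endo_def
  proof (intro conjI ballI impI)
    show "\<psi> a \<in> adjoin B x" if a: "a \<in> adjoin B x" for a
    proof -
      obtain b where b: "\<And>n. b n \<in> B" "a = series x b" using a unfolding adjoin_def by blast
      show ?thesis unfolding b(2) \<psi>[OF b(1)] by (intro adjoinI co b)
    qed
    show "\<psi> (f \<oplus> g) = \<psi> f \<oplus> \<psi> g" if f: "f \<in> adjoin B x" and g: "g \<in> adjoin B x" for f g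
    proof -
      obtain b where b: "\<And>n. b n \<in> B" "f = series x b" using f unfolding adjoin_def by blast
      obtain c where c: "\<And>n. c n \<in> B" "g = series x c" using g unfolding adjoin_def by blast
      have cc: "\<And>n. b n \<in> carrier R" "\<And>n. c n \<in> carrier R" using b c Bc by auto
      have "f \<oplus> g = series x (\<lambda>n. b n \<oplus> c n)" unfolding b(2) c(2) by (rule series_add[OF x cc])
      moreover have "b n \<oplus> c n \<in> B" for n using BE(7) b c by simp
      ultimately have "\<psi> (f \<oplus> g) = series x (\<lambda>n. \<phi> (b n \<oplus> c n) \<otimes> t [^] n)" using \<psi> by simp
      also have "\<dots> = series x (\<lambda>n. \<phi> (b n) \<otimes> t [^] n \<oplus> \<phi> (c n) \<otimes> t [^] n)"
      proof -
        have "\<phi> (b n \<oplus> c n) \<otimes> t [^] n = \<phi> (b n) \<otimes> t [^] n \<oplus> \<phi> (c n) \<otimes> t [^] n" for n :: nat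
          using \<phi>D(1,2) b c Bc tn by (simp add: l_distr)
        then show ?thesis by simp
      qed
      also have "\<dots> = \<psi> f \<oplus> \<psi> g"
        unfolding b(2) c(2) \<psi>[OF b(1)] \<psi>[OF c(1)]
        by (rule series_add[OF x, symmetric]) (use co[of b] co[of c] b c Bc in auto)
      finally show ?thesis .
    qed
    show "\<psi> (f \<otimes> g) = \<psi> f \<otimes> \<psi> g" if f: "f \<in> adjoin B x" and g: "g \<in> adjoin B x" for f g
    proof -
      obtain b where b: "\<And>n. b n \<in> B" "f = series x b" using f unfolding adjoin_def by blast
      obtain c where c: "\<And>n. c n \<in> B" "g = series x c" using g unfolding adjoin_def by blast
      have cc: "\<And>n. b n \<in> carrier R" "\<And>n. c n \<in> carrier R" using b c Bc by auto
      have pc: "\<And>n. \<phi> (b n) \<in> carrier R" "\<And>n. \<phi> (c n) \<in> carrier R" using b c Bc \<phi>D(1) by auto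
      have fg: "f \<otimes> g = series x (conv b c)" unfolding b(2) c(2) by (rule series_mult[OF x cc])
      have "conv b c n \<in> B" for n by (rule conv_closed[OF B b(1) c(1)])
      then have "\<psi> (f \<otimes> g) = series x (\<lambda>n. \<phi> (conv b c n) \<otimes> t [^] n)" unfolding fg by (rule \<psi>)
      also have "(\<lambda>n. \<phi> (conv b c n) \<otimes> t [^] n) = conv (\<lambda>n. \<phi> (b n) \<otimes> t [^] n) (\<lambda>n. \<phi> (c n) \<otimes> t [^] n)"
      proof
        fix n :: nat
        have c1: "conv (\<lambda>n. \<phi> (b n)) (\<lambda>n. \<phi> (c n)) n \<in> carrier R" by (intro conv_carr pc)
        have "conv (\<lambda>i. \<one> \<otimes> (\<phi> (b i) \<otimes> t [^] i)) (\<lambda>i. \<phi> (c i) \<otimes> t [^] i) n =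
            \<one> \<otimes> (conv (\<lambda>n. \<phi> (b n)) (\<lambda>n. \<phi> (c n)) n \<otimes> t [^] n)"
          by (rule conv_scale) (use pc t Bc in auto)
        then show "\<phi> (conv b c n) \<otimes> t [^] n = conv (\<lambda>n. \<phi> (b n) \<otimes> t [^] n) (\<lambda>n. \<phi> (c n) \<otimes> t [^] n) n"
          using conv_endo[where b = b and c = c and n = n, OF B \<phi> b(1) c(1)] c1 pc tn[THEN Bc] by simp
      qed
      also have "series x \<dots> = \<psi> f \<otimes> \<psi> g"
        unfolding b(2) c(2) \<psi>[OF b(1)] \<psi>[OF c(1)]
        by (rule series_mult[OF x, symmetric]) (use co[of b] co[of c] b c Bc in auto)
      finally show ?thesis .
    qed
    show "\<psi> \<one> = \<one>" using Bext[OF BE(3)] \<phi>D(4) by simp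
    show "f = \<zero>" if f: "f \<in> adjoin B x" and z: "\<psi> f = \<zero>" for f
    proof -
      obtain b where b: "\<And>n. b n \<in> B" "f = series x b" using f unfolding adjoin_def by blast
      have "\<forall>n. \<phi> (b n) \<otimes> t [^] n \<in> B" using co[of b] b(1) by blast
      moreover have "series x (\<lambda>n. \<phi> (b n) \<otimes> t [^] n) = \<zero>" using z b \<psi> by simp
      ultimately have "\<phi> (b n) \<otimes> t [^] n = \<zero>" for n :: nat
        using ind[unfolded analytically_independent_def, rule_format, of "\<lambda>n. \<phi> (b n) \<otimes> t [^] n" n] by blast
      then have "\<phi> (b n) = \<zero>" for n
        using integral[of "\<phi> (b n)" "t [^] n"] tn0[of n] tn[THEN Bc] \<phi>D(1)[THEN Bc] b(1) by blast
      then have "b n = \<zero>" for n using \<phi>D(5) b(1) by blast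
      then show ?thesis unfolding b(2) using series_zero_tail[OF x, of b] by simp
    qed
  qed
  then show ?thesis using Bext \<psi> by blast
qed

text \<open>After index \<open>k\<close> each term contains one more factor \<open>t\<close>, hence
  a factor \<open>b k\<close>, and one more factor \<open>x\<close>. Taking out the leading term
  therefore leaves one plus an element of the maximal ideal.\<close>

lemma series_leading_term:
  assumes x: "x \<in> max_ideal R" and b: "\<And>n. b n \<in> carrier R" and t: "t \<in> carrier R"
    and zero: "\<And>n. n < k \<Longrightarrow> b n = \<zero>" and l: "b k divides t"
  shows "\<exists>u\<in>Units R. series x (\<lambda>n. b n \<otimes> t [^] n) = ((x \<otimes> t) [^] k \<otimes> b k) \<otimes> u"
proof -
  note xc = max_ideal_carr[OF x]
  define c where "c = (\<lambda>n. b n \<otimes> t [^] n)"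
  have cc: "c n \<in> carrier R" for n unfolding c_def using b t by simp
  obtain t' where t': "t' \<in> carrier R" "t = b k \<otimes> t'" using l by (auto elim: dividesE)
  obtain j where j: "j \<in> {\<zero>}" "series x c = j \<oplus> x [^] k \<otimes> series x (\<lambda>i. c (i + k))"
    using series_split[where b = c and J = "{\<zero>}" and s = k, OF x cc zeroideal] zero t by (auto simp: c_def)
  have s1: "series x (\<lambda>i. c (i + k)) = c k \<oplus> x \<otimes> series x (\<lambda>i. c (i + Suc k))"
    using series_shift[where b = "\<lambda>i. c (i + k)", OF x cc] by simp
  define q where "q = series x (\<lambda>i. b (i + Suc k) \<otimes> t [^] i)"
  have qc: "q \<in> carrier R" unfolding q_def by (intro series_closed x m_closed b nat_pow_closed t)
  have "(\<lambda>i. c (i + Suc k)) = (\<lambda>i. t [^] Suc k \<otimes> (b (i + Suc k) \<otimes> t [^] i))"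
  proof
    fix i
    have "t [^] (i + Suc k) = t [^] Suc k \<otimes> t [^] i" using nat_pow_mult[OF t, of "Suc k" i] by (simp add: add.commute)
    then show "c (i + Suc k) = t [^] Suc k \<otimes> (b (i + Suc k) \<otimes> t [^] i)"
      unfolding c_def using b t m_lcomm[of "b (i + Suc k)" "t [^] Suc k" "t [^] i"] by simp
  qed
  then have s2: "series x (\<lambda>i. c (i + Suc k)) = t [^] Suc k \<otimes> q"
    unfolding q_def using series_smult[where b = "\<lambda>i. b (i + Suc k) \<otimes> t [^] i" and a = "t [^] Suc k", OF x] b t by simp
  have eq: "Y \<otimes> (l \<otimes> T \<oplus> x \<otimes> ((T \<otimes> (l \<otimes> t')) \<otimes> q)) = ((Y \<otimes> T) \<otimes> l) \<otimes> (\<one> \<oplus> x \<otimes> (t' \<otimes> q))"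
    if "Y \<in> carrier R" "T \<in> carrier R" "l \<in> carrier R" for Y T l
    using that xc t' qc by algebra
  have "series x c = x [^] k \<otimes> (b k \<otimes> t [^] k \<oplus> x \<otimes> ((t [^] k \<otimes> (b k \<otimes> t')) \<otimes> q))"
  proof -
    have "t [^] Suc k = t [^] k \<otimes> (b k \<otimes> t')" using t'(2) by simp
    then have "series x (\<lambda>i. c (i + k)) = b k \<otimes> t [^] k \<oplus> x \<otimes> ((t [^] k \<otimes> (b k \<otimes> t')) \<otimes> q)"
      using s1 s2 by (simp add: c_def)
    moreover have "series x (\<lambda>i. c (i + k)) \<in> carrier R" by (intro series_closed x cc)
    ultimately show ?thesis using j xc by simp
  qed
  also have "\<dots> = ((x [^] k \<otimes> t [^] k) \<otimes> b k) \<otimes> (\<one> \<oplus> x \<otimes> (t' \<otimes> q))"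
    by (rule eq) (use xc t b in simp_all)
  finally have "series x c = ((x \<otimes> t) [^] k \<otimes> b k) \<otimes> (\<one> \<oplus> x \<otimes> (t' \<otimes> q))"
    using xc t by (simp add: pow_mult_distrib m_comm)
  moreover have "\<one> \<oplus> x \<otimes> (t' \<otimes> q) \<in> Units R"
    by (intro unit_add_max_ideal ideal.I_r_closed[OF ideal_max_ideal] x) (use t' qc in simp_all)
  ultimately show ?thesis unfolding c_def by blast
qed

text \<open>The product works: it is nonzero in a domain.\<close>

lemma ex_common_multiple:
  assumes "subring B R" "finite F" "F \<subseteq> B" "\<zero> \<notin> F"
  shows "\<exists>t\<in>B. t \<noteq> \<zero> \<and> (\<forall>f\<in>F. f divides t)"
  using assms(2-4)
proof (induction F rule: finite_induct)
  case empty
  then show ?case using subringE(3)[OF assms(1)] one_not_zero by (intro bexI[of _ \<one>]) simp_all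
next
  case (insert f F)
  then obtain t where t: "t \<in> B" "t \<noteq> \<zero>" "\<forall>f\<in>F. f divides t" by auto
  have c: "g \<in> carrier R" if "g \<in> B" for g using that subringE(1)[OF assms(1)] by blast
  have tc: "t \<in> carrier R" "f \<in> carrier R" using c t insert.prems by auto
  have "f \<otimes> t \<in> B" using subringE(6)[OF assms(1)] t insert.prems by simp
  moreover have "f \<otimes> t \<noteq> \<zero>" using integral[of f t] tc t(2) insert.prems by auto
  moreover have "g divides f \<otimes> t" if "g \<in> insert f F" for g
  proof (cases "g = f")
    case True
    then show ?thesis using tc by (intro dividesI[of t]) simp_all
  next
    case False
    then have "g divides t" using that t(3) by blast
    then obtain s where s: "s \<in> carrier R" "t = g \<otimes> s" by (rule dividesE)
    have "g \<in> carrier R" using False that insert.prems c by blast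
    then have "f \<otimes> t = g \<otimes> (f \<otimes> s)" unfolding s(2) using tc s(1) by (simp add: m_lcomm)
    then show ?thesis using tc s by (intro dividesI[of "f \<otimes> s"]) simp_all
  qed
  ultimately show ?case by blast
qed

text \<open>Divisibility is taken in \<open>R\<close>, not in a subring: the quotients will serve as
  coefficients over \<open>R\<close>.\<close>

definition divisibility_chain :: "'a set \<Rightarrow> bool" where
  "divisibility_chain F \<longleftrightarrow> (\<forall>f\<in>F. \<forall>g\<in>F. f divides g \<or> g divides f)"

text \<open>With a suitable scaling factor \<open>t\<close>, the image of each \<open>f\<close> is a
  unit times \<open>(x \<otimes> t) [^] k f\<close> times the image of its leading coefficient. Such
  products are compared lexicographically, first by the order \<open>k f\<close> and then by the
  leading coefficients. \<open>Y\<close> collects the elements that must remain in the maximal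
  ideal.\<close>

lemma adjoin_endo_chain:
  assumes B: "subring B R" and x: "x \<in> max_ideal R" and ind: "analytically_independent B x"
    and IH: "\<And>F. \<lbrakk>finite F; F \<subseteq> B; \<zero> \<notin> F\<rbrakk> \<Longrightarrow> \<exists>\<phi>. subring_endo B \<phi> \<and> \<phi> ` Y \<subseteq> max_ideal R \<and> divisibility_chain (\<phi> ` F)"
    and Y: "Y \<subseteq> B" and F: "finite F" "F \<subseteq> adjoin B x" "\<zero> \<notin> F"
  shows "\<exists>\<phi>. subring_endo (adjoin B x) \<phi> \<and> \<phi> ` insert x Y \<subseteq> max_ideal R \<and> divisibility_chain (\<phi> ` F)"
proof -
  note BE = subringE[OF B]
  have Bc: "\<And>b. b \<in> B \<Longrightarrow> b \<in> carrier R" using BE(1) by blast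
  note xc = max_ideal_carr[OF x]
  have "\<exists>b k. (\<forall>n. b n \<in> B) \<and> f = series x b \<and> b k \<noteq> \<zero> \<and> (\<forall>n<k. b n = \<zero>)" if f: "f \<in> F" for f
  proof -
    obtain b where b: "\<And>n. b n \<in> B" "f = series x b" using f F(2) unfolding adjoin_def by blast
    have "\<exists>k. b k \<noteq> \<zero>"
    proof (rule ccontr)
      assume "\<not> ?thesis"
      then have "series x b = \<zero>" using series_zero_tail[OF x, of b] by simp
      then show False using b(2) f F(3) by simp
    qed
    then obtain k where "b k \<noteq> \<zero>" "\<forall>n<k. b n = \<zero>" using exists_least_iff[of "\<lambda>k. b k \<noteq> \<zero>"] by blast
    then show ?thesis using b by blast
  qed
  then obtain b k where b: "\<And>f n. f \<in> F \<Longrightarrow> b f n \<in> B" "\<And>f. f \<in> F \<Longrightarrow> f = series x (b f)"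
    "\<And>f. f \<in> F \<Longrightarrow> b f (k f) \<noteq> \<zero>" "\<And>f n. \<lbrakk>f \<in> F; n < k f\<rbrakk> \<Longrightarrow> b f n = \<zero>"
    by metis
  \<comment> \<open>The induction hypothesis is applied to the leading coefficients, which live in
    \<open>B\<close>.\<close>
  define l where "l f = b f (k f)" for f
  obtain \<phi> where \<phi>: "subring_endo B \<phi>" "\<phi> ` Y \<subseteq> max_ideal R" "divisibility_chain (\<phi> ` (l ` F))"
    using IH[of "l ` F"] F(1) b unfolding l_def by fastforce
  note \<phi>D = subring_endoD[OF \<phi>(1)]
  have lB: "l f \<in> B" "\<phi> (l f) \<in> B" "\<phi> (l f) \<in> carrier R" if "f \<in> F" for f
    using b(1)[OF that] \<phi>D(1) Bc unfolding l_def by auto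
  have "\<phi> (l f) \<noteq> \<zero>" if "f \<in> F" for f
    using \<phi>D(5)[OF lB(1)[OF that]] b(3)[OF that] unfolding l_def by blast
  then have "\<zero> \<notin> \<phi> ` l ` F" by (metis imageE)
  \<comment> \<open>Divisibility of one \<open>t\<close> by all the transformed leading coefficients
    serves two purposes: it makes \<open>series_leading_term\<close> apply to every element of
    \<open>F\<close>, and it lets a difference in order outweigh any leading coefficient.\<close>
  then have "\<exists>t\<in>B. t \<noteq> \<zero> \<and> (\<forall>f\<in>\<phi> ` l ` F. f divides t)"
    by (intro ex_common_multiple[OF B]) (use F(1) lB in auto)
  then obtain t where t: "t \<in> B" "t \<noteq> \<zero>" "\<And>f. f \<in> F \<Longrightarrow> \<phi> (l f) divides t" by auto
  note tc = Bc[OF t(1)]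
  obtain \<psi> where \<psi>: "subring_endo (adjoin B x) \<psi>" "\<And>a. a \<in> B \<Longrightarrow> \<psi> a = \<phi> a"
    "\<And>b. (\<And>n. b n \<in> B) \<Longrightarrow> \<psi> (series x b) = series x (\<lambda>n. \<phi> (b n) \<otimes> t [^] n)"
    using adjoin_endo[OF B x ind \<phi>(1) t(1,2)] by blast
  \<comment> \<open>The coefficients of \<open>x\<close> are those of one shifted by one place. The
    constant coefficient is zero, so the image is a multiple of \<open>x\<close>.\<close>
  have "\<psi> x \<in> max_ideal R"
  proof -
    obtain c where c: "\<And>n. c n \<in> B" "\<one> = series x c"
      using subset_adjoin[OF B x] BE(3) unfolding adjoin_def by blast
    have c': "case_nat \<zero> c n \<in> B" for n using c(1) BE(2) by (cases n) auto
    have d: "\<phi> (case_nat \<zero> c n) \<otimes> t [^] n \<in> carrier R" for n using c' \<phi>D(1) Bc tc by simp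
    have "x = series x (case_nat \<zero> c)" using series_Cons[where a = \<zero> and b = c, OF x BE(1,2) c(1), folded c(2)] xc by simp
    then have "\<psi> x = series x (\<lambda>n. \<phi> (case_nat \<zero> c n) \<otimes> t [^] n)" using \<psi>(3) c' by metis
    also have "\<dots> = \<phi> \<zero> \<otimes> \<one> \<oplus> x \<otimes> series x (\<lambda>n. \<phi> (case_nat \<zero> c (Suc n)) \<otimes> t [^] Suc n)"
      using series_shift[where b = "\<lambda>n. \<phi> (case_nat \<zero> c n) \<otimes> t [^] n", OF x d] by simp
    also have "\<dots> = x \<otimes> series x (\<lambda>n. \<phi> (case_nat \<zero> c (Suc n)) \<otimes> t [^] Suc n)"
      using subring_endo_zero[OF B \<phi>(1)] xc series_closed[OF x] d[of "Suc _"] by simp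
    also have "\<dots> \<in> max_ideal R"
      by (intro ideal.I_r_closed[OF ideal_max_ideal] x series_closed d)
    finally show ?thesis .
  qed
  moreover have "\<psi> ` Y \<subseteq> max_ideal R" using \<phi>(2) \<psi>(2) Y by auto
  moreover have "divisibility_chain (\<psi> ` F)"
  proof -
    define y where "y = x \<otimes> t"
    have yc: "y \<in> carrier R" unfolding y_def using xc tc by simp
    have lead: "\<exists>u\<in>Units R. \<psi> f = (y [^] k f \<otimes> \<phi> (l f)) \<otimes> u" if f: "f \<in> F" for f
    proof -
      have "\<psi> f = \<psi> (series x (b f))" using b(2)[OF f] by simp
      also have "\<dots> = series x (\<lambda>n. \<phi> (b f n) \<otimes> t [^] n)" using \<psi>(3) b(1)[OF f] by blast
      finally have "\<psi> f = series x (\<lambda>n. \<phi> (b f n) \<otimes> t [^] n)" .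
      moreover have "\<exists>u\<in>Units R. series x (\<lambda>n. \<phi> (b f n) \<otimes> t [^] n) = ((x \<otimes> t) [^] k f \<otimes> \<phi> (b f (k f))) \<otimes> u"
        by (rule series_leading_term[OF x _ tc])
          (use b(1)[OF f] \<phi>D(1) Bc b(4)[OF f] subring_endo_zero[OF B \<phi>(1)] t(3)[OF f] in \<open>auto simp: l_def\<close>)
      ultimately show ?thesis unfolding y_def l_def by simp
    qed
    \<comment> \<open>If the orders differ, the surplus power of \<open>y\<close> contains the
      factor \<open>t\<close>, which is divisible by \<open>\<phi> (l f)\<close>; if they agree, the
      leading coefficients decide.\<close>
    have main: "y [^] k f \<otimes> \<phi> (l f) divides y [^] k g \<otimes> \<phi> (l g)"
      if f: "f \<in> F" and g: "g \<in> F" and less: "k f < k g \<or> k f = k g \<and> \<phi> (l f) divides \<phi> (l g)" for f g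
    proof -
      have "\<phi> (l f) divides y [^] (k g - k f) \<otimes> \<phi> (l g)"
      proof (cases "k f = k g")
        case True
        then show ?thesis using less lB[OF g] by simp
      next
        case False
        then obtain m where m: "k g - k f = Suc m" using less by (metis Suc_diff_Suc)
        obtain t' where t': "t' \<in> carrier R" "t = \<phi> (l f) \<otimes> t'" using t(3)[OF f] by (auto elim: dividesE)
        have "y [^] (k g - k f) \<otimes> \<phi> (l g) = (y [^] m \<otimes> (x \<otimes> (\<phi> (l f) \<otimes> t'))) \<otimes> \<phi> (l g)"
          unfolding m using t'(2) by (simp add: y_def)
        also have "\<dots> = \<phi> (l f) \<otimes> (y [^] m \<otimes> (x \<otimes> t') \<otimes> \<phi> (l g))"
        proof -
          have "(v \<otimes> (x \<otimes> (u \<otimes> t'))) \<otimes> w = u \<otimes> (v \<otimes> (x \<otimes> t') \<otimes> w)"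
            if "u \<in> carrier R" "v \<in> carrier R" "w \<in> carrier R" for u v w
            using that xc t'(1) by algebra
          then show ?thesis using lB[OF f] lB[OF g] yc by simp
        qed
        finally show ?thesis
          by (rule dividesI[rotated]) (use lB[OF g] yc xc t' in simp)
      qed
      then obtain r where r: "r \<in> carrier R" "y [^] (k g - k f) \<otimes> \<phi> (l g) = \<phi> (l f) \<otimes> r" by (auto elim: dividesE)
      have "y [^] k g = y [^] k f \<otimes> y [^] (k g - k f)" using nat_pow_mult[OF yc, of "k f" "k g - k f"] less by auto
      then have "y [^] k g \<otimes> \<phi> (l g) = y [^] k f \<otimes> (\<phi> (l f) \<otimes> r)"
        using lB[OF g] yc by (simp add: m_assoc r(2)[symmetric])
      also have "\<dots> = (y [^] k f \<otimes> \<phi> (l f)) \<otimes> r" using lB[OF f] yc r(1) by (simp add: m_assoc)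
      finally show ?thesis by (rule dividesI[OF r(1)])
    qed
    have div: "\<psi> f divides \<psi> g"
      if f: "f \<in> F" and g: "g \<in> F" and less: "k f < k g \<or> k f = k g \<and> \<phi> (l f) divides \<phi> (l g)" for f g
    proof -
      obtain u v where u: "u \<in> Units R" "\<psi> f = (y [^] k f \<otimes> \<phi> (l f)) \<otimes> u"
        and v: "v \<in> Units R" "\<psi> g = (y [^] k g \<otimes> \<phi> (l g)) \<otimes> v" using lead f g by blast
      show ?thesis unfolding u(2) v(2)
        by (rule divides_unit_mult) (use lB[OF f] lB[OF g] yc u(1) v(1) Units_closed main[OF that] in simp_all)
    qed
    have "\<psi> f divides \<psi> g \<or> \<psi> g divides \<psi> f" if f: "f \<in> F" and g: "g \<in> F" for f g
    proof -
      have "\<phi> (l f) divides \<phi> (l g) \<or> \<phi> (l g) divides \<phi> (l f)"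
        using \<phi>(3) f g unfolding divisibility_chain_def by blast
      then show ?thesis using div[OF f g] div[OF g f] by (meson nat_neq_iff)
    qed
    then show ?thesis unfolding divisibility_chain_def by blast
  qed
  ultimately show ?thesis using \<psi>(1) by blast
qed

text \<open>At stage zero nonzero elements are units times powers of \<open>residue_char\<close>, so
  the identity already works. Each further parameter is scaled by \<open>adjoin_endo_chain\<close>,
  whose independence hypothesis comes from the minimality of \<open>d\<close>.\<close>

lemma tower_endo_chain:
  assumes p: "Factorial_Ring.prime p" and par: "parameters \<xi> d"
    and min: "\<And>\<xi>' d'. parameters \<xi>' d' \<Longrightarrow> d \<le> d'" and k: "k \<le> d"
    and F: "finite F" "F \<subseteq> tower \<xi> k" "\<zero> \<notin> F"
  shows "\<exists>\<phi>. subring_endo (tower \<xi> k) \<phi> \<and> \<phi> ` insert residue_char (\<xi> ` {..<k}) \<subseteq> max_ideal R \<and>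
    divisibility_chain (\<phi> ` F)"
  using k F
proof (induction k arbitrary: F)
  case 0
  have s: "subring (tower \<xi> 0) R" by (rule subring_tower) simp
  have div: "f divides g \<or> g divides f" if f: "f \<in> F" and g: "g \<in> F" for f g
  proof -
    have main: "residue_char [^] n \<otimes> u divides residue_char [^] m \<otimes> v"
      if "n \<le> m" "u \<in> Units R" "v \<in> Units R" for n m :: nat and u v
    proof (rule divides_unit_mult)
      have "residue_char [^] m = residue_char [^] n \<otimes> residue_char [^] (m - n)"
        using nat_pow_mult[OF residue_char_carr, of n "m - n"] that(1) by simp
      then show "residue_char [^] n divides residue_char [^] m"
        by (rule dividesI[rotated]) (simp add: residue_char_carr)
    qed (use that Units_closed residue_char_carr in simp_all)
    obtain n u m v where "u \<in> Units R" "f = residue_char [^] (n::nat) \<otimes> u"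
      "v \<in> Units R" "g = residue_char [^] (m::nat) \<otimes> v"
      using tower_0_factor[OF p, of f \<xi>] tower_0_factor[OF p, of g \<xi>] f g 0(3,4) by blast
    then show ?thesis using main by (meson nat_le_linear)
  qed
  have "subring_endo (tower \<xi> 0) (\<lambda>a. a)" unfolding subring_endo_def by simp
  moreover have "divisibility_chain ((\<lambda>a. a) ` F)" unfolding divisibility_chain_def using div by simp
  ultimately show ?case using residue_char_mem by (intro exI[of _ "\<lambda>a. a"]) simp
next
  case (Suc k)
  have \<xi>: "\<xi> i \<in> max_ideal R" if "i < d" for i using par that unfolding parameters_def by blast
  have "analytically_independent (tower \<xi> k) (\<xi> k)"
    unfolding analytically_independent_def using analytic_independence[where k = k, OF p par min] Suc.prems(1) by auto
  then have "\<exists>\<phi>. subring_endo (adjoin (tower \<xi> k) (\<xi> k)) \<phi> \<and>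
      \<phi> ` insert (\<xi> k) (insert residue_char (\<xi> ` {..<k})) \<subseteq> max_ideal R \<and> divisibility_chain (\<phi> ` F)"
    by (intro adjoin_endo_chain subring_tower Suc.IH)
      (use Suc.prems \<xi> residue_char_mem_tower[of k \<xi>] generator_mem_tower[of k \<xi>] in auto)
  then show ?case by (simp add: lessThan_Suc insert_commute)
qed

section \<open>Finiteness of \<open>R\<close> over the coefficient ring\<close>

lemma Idl_insertE:
  assumes "a \<in> carrier R" "A \<subseteq> carrier R" "x \<in> Idl (insert a A)"
  obtains j r where "j \<in> Idl A" "r \<in> carrier R" "x = j \<oplus> r \<otimes> a"
proof -
  let ?K = "Idl A <+>\<^bsub>R\<^esub> PIdl a"
  interpret J: ideal "Idl A" R by (rule genideal_ideal[OF assms(2)])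
  have id: "ideal ?K R" by (intro add_ideals J.is_ideal cgenideal_ideal assms)
  have "b \<in> ?K" if "b \<in> A" for b
    using mem_add_cgenideal[of b "Idl A" \<zero> a] genideal_self[OF assms(2)] that assms(1,2) by auto
  moreover have "a \<in> ?K" using mem_add_cgenideal[of \<zero> "Idl A" \<one> a] assms(1) J.zero_closed by simp
  ultimately have "Idl (insert a A) \<subseteq> ?K" by (intro genideal_minimal id) blast
  then have "x \<in> ?K" using assms(3) by blast
  then show ?thesis using that by (elim mem_add_cgenidealE)
qed

lemma Idl_empty: "Idl {} = {\<zero>}"
  using genideal_minimal[OF zeroideal, of "{}"] additive_subgroup.zero_closed[OF ideal.axioms(1)[OF genideal_ideal[of "{}"]]]
  by auto

text \<open>Modulo \<open>K\<close> only the residue classes of the coefficients at the elements of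
  \<open>Y\<close> matter, and \<open>T\<close> represents these finitely many classes.\<close>

lemma finite_Idl_mod:
  assumes "finite Y" "Y \<subseteq> carrier R" "ideal K R"
    and T: "finite T" "T \<subseteq> carrier R" "\<And>r. r \<in> carrier R \<Longrightarrow> \<exists>\<tau>\<in>T. r \<ominus> \<tau> \<in> max_ideal R"
    and K: "\<And>m y. \<lbrakk>m \<in> max_ideal R; y \<in> Y\<rbrakk> \<Longrightarrow> m \<otimes> y \<in> K"
  shows "\<exists>E. finite E \<and> E \<subseteq> carrier R \<and> (\<forall>a\<in>Idl Y. \<exists>e\<in>E. a \<ominus> e \<in> K)"
  using assms(1,2) K
proof (induction Y rule: finite_induct)
  case empty
  interpret K: ideal K R by (rule assms(3))
  show ?case unfolding Idl_empty by (rule exI[of _ "{\<zero>}"]) (simp add: K.cong_refl)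
next
  case (insert y Y)
  interpret K: ideal K R by (rule assms(3))
  have yc: "y \<in> carrier R" "Y \<subseteq> carrier R" using insert.prems by auto
  obtain E where E: "finite E" "E \<subseteq> carrier R" "\<And>a. a \<in> Idl Y \<Longrightarrow> \<exists>e\<in>E. a \<ominus> e \<in> K"
    using insert.IH insert.prems by auto
  let ?E = "(\<lambda>(e, \<tau>). e \<oplus> \<tau> \<otimes> y) ` (E \<times> T)"
  have "\<exists>e\<in>?E. a \<ominus> e \<in> K" if a: "a \<in> Idl (insert y Y)" for a
  proof -
    obtain j r where j: "j \<in> Idl Y" "r \<in> carrier R" "a = j \<oplus> r \<otimes> y"
      using Idl_insertE[OF yc a] by blast
    obtain e \<tau> where e: "e \<in> E" "j \<ominus> e \<in> K" and \<tau>: "\<tau> \<in> T" "r \<ominus> \<tau> \<in> max_ideal R"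
      using E(3)[OF j(1)] T(3)[OF j(2)] by blast
    have c: "e \<in> carrier R" "\<tau> \<in> carrier R" "j \<in> carrier R"
      using e(1) \<tau>(1) E(2) T(2) ideal.Icarr[OF genideal_ideal[OF yc(2)] j(1)] by auto
    have "a \<ominus> (e \<oplus> \<tau> \<otimes> y) = (j \<ominus> e) \<oplus> (r \<ominus> \<tau>) \<otimes> y"
      unfolding j(3) using c j(2) yc(1) by algebra
    then have "a \<ominus> (e \<oplus> \<tau> \<otimes> y) \<in> K" using K.a_closed e(2) insert.prems(2)[OF \<tau>(2)] by simp
    then show ?thesis using e(1) \<tau>(1) by force
  qed
  moreover have "finite ?E" "?E \<subseteq> carrier R" using E(1,2) T(1,2) yc(1) by (auto simp: subset_iff)
  ultimately show ?case by blast
qed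

text \<open>The residue field is finite and each power of the maximal ideal is finitely generated,
  so each power has finitely many classes modulo the next; sums of representatives of the successive
  quotients suffice.\<close>

lemma finite_residues: "\<exists>E. finite E \<and> E \<subseteq> carrier R \<and> (\<forall>r\<in>carrier R. \<exists>e\<in>E. r \<ominus> e \<in> mpow i)"
proof -
  have "\<exists>T. finite T \<and> T \<subseteq> carrier R \<and> (\<forall>r\<in>carrier R. \<exists>\<tau>\<in>T. r \<ominus> \<tau> \<in> max_ideal R)"
  proof -
    interpret I: ideal "max_ideal R" R by (rule ideal_max_ideal)
    let ?Q = "carrier (R Quot max_ideal R)"
    define rep where "rep C = (SOME a. a \<in> carrier R \<and> C = max_ideal R +> a)" for C
    have Q: "?Q = {max_ideal R +> a | a. a \<in> carrier R}" by (auto simp: FactRing_def A_RCOSETS_def')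
    have rep: "rep C \<in> carrier R" "C = max_ideal R +> rep C" if "C \<in> ?Q" for C
    proof -
      have "\<exists>a. a \<in> carrier R \<and> C = max_ideal R +> a" using that Q by blast
      from someI_ex[OF this] show "rep C \<in> carrier R" "C = max_ideal R +> rep C" unfolding rep_def by blast+
    qed
    have "r \<ominus> rep (max_ideal R +> r) \<in> max_ideal R" if "r \<in> carrier R" for r
    proof -
      have "max_ideal R +> r \<in> ?Q" using that Q by blast
      from rep[OF this] show ?thesis using quotient_eq_iff_same_a_r_cos[OF ideal_max_ideal that] by simp
    qed
    then show ?thesis using finite_residue_field rep(1) Q by (intro exI[of _ "rep ` ?Q"]) fastforce
  qed
  then obtain T where T: "finite T" "T \<subseteq> carrier R" "\<And>r. r \<in> carrier R \<Longrightarrow> \<exists>\<tau>\<in>T. r \<ominus> \<tau> \<in> max_ideal R" by blast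
  show ?thesis
  proof (induction i)
    case 0
    show ?case by (rule exI[of _ "{\<zero>}"]) simp
  next
    case (Suc i)
    then obtain E where E: "finite E" "E \<subseteq> carrier R" "\<And>r. r \<in> carrier R \<Longrightarrow> \<exists>e\<in>E. r \<ominus> e \<in> mpow i" by blast
    obtain Y where Y: "Y \<subseteq> carrier R" "finite Y" "mpow i = Idl Y" using finetely_gen[OF ideal_mpow] by blast
    have "\<exists>E. finite E \<and> E \<subseteq> carrier R \<and> (\<forall>a\<in>Idl Y. \<exists>e\<in>E. a \<ominus> e \<in> mpow (Suc i))"
    proof (rule finite_Idl_mod[OF Y(2,1) ideal_mpow T])
      show "m \<otimes> y \<in> mpow (Suc i)" if "m \<in> max_ideal R" "y \<in> Y" for m y
        using mpow_SucI[OF that(1), of y i] genideal_self[OF Y(1)] that(2) Y(3) by blast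
    qed
    then obtain E' where E': "finite E'" "E' \<subseteq> carrier R" "\<And>a. a \<in> mpow i \<Longrightarrow> \<exists>e\<in>E'. a \<ominus> e \<in> mpow (Suc i)"
      unfolding Y(3) by blast
    let ?E = "(\<lambda>(e, e'). e \<oplus> e') ` (E \<times> E')"
    have "\<exists>e\<in>?E. r \<ominus> e \<in> mpow (Suc i)" if r: "r \<in> carrier R" for r
    proof -
      obtain e where e: "e \<in> E" "r \<ominus> e \<in> mpow i" using E(3)[OF r] by blast
      obtain e' where e': "e' \<in> E'" "(r \<ominus> e) \<ominus> e' \<in> mpow (Suc i)" using E'(3)[OF e(2)] by blast
      have c: "e \<in> carrier R" "e' \<in> carrier R" using e(1) e'(1) E(2) E'(2) by auto
      have "(r \<ominus> e) \<ominus> e' = r \<ominus> (e \<oplus> e')" using c r by algebra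
      then show ?thesis using e(1) e' by force
    qed
    moreover have "finite ?E" "?E \<subseteq> carrier R" using E E' by auto
    ultimately show ?case by blast
  qed
qed

lemma series_finsum:
  assumes x: "x \<in> max_ideal R" and "finite E" and "\<And>n e. e \<in> E \<Longrightarrow> a n e \<in> carrier R" "E \<subseteq> carrier R"
  shows "series x (\<lambda>n. \<Oplus>e\<in>E. a n e \<otimes> e) = (\<Oplus>e\<in>E. series x (\<lambda>n. a n e) \<otimes> e)"
  using assms(2-4)
proof (induction E rule: finite_induct)
  case empty
  then show ?case using series_zero_tail[OF x, of "\<lambda>_. \<zero>"] by simp
next
  case (insert f E)
  have c: "(\<Oplus>e\<in>E. a n e \<otimes> e) \<in> carrier R" for n
    by (intro finsum_closed) (use insert.prems in auto)
  have fc: "f \<in> carrier R" "\<And>n. a n f \<in> carrier R" using insert.prems by auto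
  have "series x (\<lambda>n. \<Oplus>e\<in>insert f E. a n e \<otimes> e) = series x (\<lambda>n. a n f \<otimes> f \<oplus> (\<Oplus>e\<in>E. a n e \<otimes> e))"
  proof -
    have "(\<Oplus>e\<in>insert f E. a n e \<otimes> e) = a n f \<otimes> f \<oplus> (\<Oplus>e\<in>E. a n e \<otimes> e)" for n
      by (rule finsum_insert) (use insert in auto)
    then show ?thesis by simp
  qed
  also have "\<dots> = series x (\<lambda>n. a n f \<otimes> f) \<oplus> series x (\<lambda>n. \<Oplus>e\<in>E. a n e \<otimes> e)"
    by (rule series_add[OF x, symmetric]) (use fc c in auto)
  also have "series x (\<lambda>n. a n f \<otimes> f) = series x (\<lambda>n. a n f) \<otimes> f"
    using series_smult[where b = "\<lambda>n. a n f" and a = f, OF x fc(2,1)] fc series_closed[OF x fc(2)] by (simp add: m_comm)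
  also have "series x (\<lambda>n. \<Oplus>e\<in>E. a n e \<otimes> e) = (\<Oplus>e\<in>E. series x (\<lambda>n. a n e) \<otimes> e)"
    using insert by simp
  also have "series x (\<lambda>n. a n f) \<otimes> f \<oplus> \<dots> = (\<Oplus>e\<in>insert f E. series x (\<lambda>n. a n e) \<otimes> e)"
    by (rule finsum_insert[symmetric]) (use insert in \<open>auto intro!: series_closed x\<close>)
  finally show ?case .
qed

text \<open>Finitely generated ideals are closed under these limits, because the coefficients can be
  decomposed along the generators and the components summed separately.\<close>

lemma series_mem_Idl:
  assumes x: "x \<in> max_ideal R" and "finite Y" "Y \<subseteq> carrier R" "\<And>n. c n \<in> Idl Y"
  shows "series x c \<in> Idl Y"
  using assms(2-4)
proof (induction Y arbitrary: c rule: finite_induct)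
  case empty
  have c0: "c n = \<zero>" for n using empty unfolding Idl_empty by blast
  have "series x c = c 0" by (rule series_zero_tail[OF x]) (simp_all add: c0)
  then show ?case unfolding Idl_empty c0[of 0] by simp
next
  case (insert y Y)
  have yc: "y \<in> carrier R" "Y \<subseteq> carrier R" using insert.prems by auto
  have "\<exists>j r. j \<in> Idl Y \<and> r \<in> carrier R \<and> c n = j \<oplus> r \<otimes> y" for n
    by (rule Idl_insertE[OF yc insert.prems(2)[of n]]) blast
  then have "\<forall>n. \<exists>j r. j \<in> Idl Y \<and> r \<in> carrier R \<and> c n = j \<oplus> r \<otimes> y" by blast
  then obtain j r where "\<forall>n. j n \<in> Idl Y \<and> r n \<in> carrier R \<and> c n = j n \<oplus> r n \<otimes> y"
    unfolding choice_iff by blast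
  then have j: "\<And>n. j n \<in> Idl Y" "\<And>n. r n \<in> carrier R" "\<And>n. c n = j n \<oplus> r n \<otimes> y" by blast+
  have jc: "j n \<in> carrier R" for n using ideal.Icarr[OF genideal_ideal[OF yc(2)] j(1)] .
  interpret J: ideal "Idl (insert y Y)" R by (rule genideal_ideal) (rule insert.prems)
  have sub: "Idl Y \<subseteq> Idl (insert y Y)" by (rule subset_Idl_subset) (use insert.prems in auto)
  have "c = (\<lambda>n. j n \<oplus> y \<otimes> r n)" using j yc by (auto simp: m_comm)
  then have "series x c = series x j \<oplus> y \<otimes> series x r"
    using series_add[where b = j and c = "\<lambda>n. y \<otimes> r n", OF x jc] series_smult[where b = r and a = y, OF x j(2) yc(1)] j(2) yc
    by simp
  moreover have "series x j \<in> Idl Y" using insert.IH[of j] j(1) yc by blast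
  moreover have "y \<in> Idl (insert y Y)" using genideal_self[OF insert.prems(1)] by blast
  moreover have "series x r \<in> carrier R" by (rule series_closed[OF x j(2)])
  ultimately show ?case using J.a_closed J.I_r_closed sub by auto
qed

text \<open>By hypothesis \<open>r\<close> is a combination over \<open>B\<close>, plus an element
  of \<open>Idl Y\<close>, plus \<open>x \<otimes> q\<close>. Expanding \<open>q\<close> in the same
  way, and so on, turns the coefficients into power series in \<open>x\<close> and removes
  \<open>x\<close> from the error ideal.\<close>

lemma generation_step:
  assumes x: "x \<in> max_ideal R" and B: "B \<subseteq> carrier R" and E: "finite E" "E \<subseteq> carrier R"
    and Y: "finite Y" "Y \<subseteq> carrier R"
    and gen: "\<And>r. r \<in> carrier R \<Longrightarrow> \<exists>a \<kappa>. (\<forall>e. a e \<in> B) \<and> \<kappa> \<in> Idl (insert x Y) \<and> r = (\<Oplus>e\<in>E. a e \<otimes> e) \<oplus> \<kappa>"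
    and r: "r \<in> carrier R"
  shows "\<exists>a \<kappa>. (\<forall>e. a e \<in> adjoin B x) \<and> \<kappa> \<in> Idl Y \<and> r = (\<Oplus>e\<in>E. a e \<otimes> e) \<oplus> \<kappa>"
proof -
  note xc = max_ideal_carr[OF x]
  have "\<exists>a \<kappa> q. (\<forall>e. a e \<in> B) \<and> \<kappa> \<in> Idl Y \<and> q \<in> carrier R \<and> r = (\<Oplus>e\<in>E. a e \<otimes> e) \<oplus> \<kappa> \<oplus> x \<otimes> q"
    if r: "r \<in> carrier R" for r
  proof -
    obtain a \<kappa> where a: "\<forall>e. a e \<in> B" "\<kappa> \<in> Idl (insert x Y)" "r = (\<Oplus>e\<in>E. a e \<otimes> e) \<oplus> \<kappa>" using gen[OF r] by blast
    obtain j q where j: "j \<in> Idl Y" "q \<in> carrier R" "\<kappa> = j \<oplus> q \<otimes> x" using Idl_insertE[OF xc Y(2) a(2)] by blast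
    have "(\<Oplus>e\<in>E. a e \<otimes> e) \<in> carrier R" by (intro finsum_closed) (use a(1) B E in auto)
    moreover have "j \<in> carrier R" using ideal.Icarr[OF genideal_ideal[OF Y(2)] j(1)] .
    ultimately have "r = (\<Oplus>e\<in>E. a e \<otimes> e) \<oplus> j \<oplus> x \<otimes> q"
      unfolding a(3) j(3) using j(2) xc by (simp add: a_assoc m_comm)
    then show ?thesis using a(1) j(1,2) by blast
  qed
  then have "\<forall>r\<in>carrier R. \<exists>a \<kappa> q. (\<forall>e. a e \<in> B) \<and> \<kappa> \<in> Idl Y \<and> q \<in> carrier R \<and> r = (\<Oplus>e\<in>E. a e \<otimes> e) \<oplus> \<kappa> \<oplus> x \<otimes> q"
    by blast
  then obtain \<alpha> \<kappa> Q where "\<forall>r\<in>carrier R. (\<forall>e. \<alpha> r e \<in> B) \<and> \<kappa> r \<in> Idl Y \<and> Q r \<in> carrier R \<and>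
      r = (\<Oplus>e\<in>E. \<alpha> r e \<otimes> e) \<oplus> \<kappa> r \<oplus> x \<otimes> Q r"
    unfolding bchoice_iff by blast
  then have g: "\<And>r e. r \<in> carrier R \<Longrightarrow> \<alpha> r e \<in> B" "\<And>r. r \<in> carrier R \<Longrightarrow> \<kappa> r \<in> Idl Y"
    "\<And>r. r \<in> carrier R \<Longrightarrow> Q r \<in> carrier R"
    "\<And>r. r \<in> carrier R \<Longrightarrow> r = (\<Oplus>e\<in>E. \<alpha> r e \<otimes> e) \<oplus> \<kappa> r \<oplus> x \<otimes> Q r"
    by blast+
  \<comment> \<open>The successive quotients by \<open>x\<close>, starting with \<open>r\<close>
    itself.\<close>
  define \<rho> where "\<rho> n = (Q ^^ n) r" for n
  have \<rho>: "\<rho> n \<in> carrier R" for n unfolding \<rho>_def by (induction n) (use r g(3) in auto)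
  have ac: "\<alpha> (\<rho> n) e \<in> carrier R" for n e using g(1) \<rho> B by blast
  have sc: "(\<Oplus>e\<in>E. \<alpha> (\<rho> n) e \<otimes> e) \<in> carrier R" for n by (intro finsum_closed) (use ac E in auto)
  have kc: "\<kappa> (\<rho> n) \<in> carrier R" for n using ideal.Icarr[OF genideal_ideal[OF Y(2)] g(2)[OF \<rho>]] .
  have "\<rho> 0 = series x (\<lambda>n. (\<Oplus>e\<in>E. \<alpha> (\<rho> n) e \<otimes> e) \<oplus> \<kappa> (\<rho> n))"
  proof (rule series_eqI[OF x])
    show "\<rho> n = (\<Oplus>e\<in>E. \<alpha> (\<rho> n) e \<otimes> e) \<oplus> \<kappa> (\<rho> n) \<oplus> x \<otimes> \<rho> (Suc n)" for n
      using g(4)[OF \<rho>, of n] unfolding \<rho>_def by simp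
  qed (use sc kc \<rho> in simp_all)
  also have "\<dots> = series x (\<lambda>n. \<Oplus>e\<in>E. \<alpha> (\<rho> n) e \<otimes> e) \<oplus> series x (\<lambda>n. \<kappa> (\<rho> n))"
    by (rule series_add[OF x sc kc, symmetric])
  also have "series x (\<lambda>n. \<Oplus>e\<in>E. \<alpha> (\<rho> n) e \<otimes> e) = (\<Oplus>e\<in>E. series x (\<lambda>n. \<alpha> (\<rho> n) e) \<otimes> e)"
    by (rule series_finsum[OF x E(1) ac E(2)])
  finally have "r = (\<Oplus>e\<in>E. series x (\<lambda>n. \<alpha> (\<rho> n) e) \<otimes> e) \<oplus> series x (\<lambda>n. \<kappa> (\<rho> n))"
    by (simp add: \<rho>_def)
  moreover have "series x (\<lambda>n. \<alpha> (\<rho> n) e) \<in> adjoin B x" for e by (intro adjoinI g \<rho>)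
  moreover have "series x (\<lambda>n. \<kappa> (\<rho> n)) \<in> Idl Y" by (rule series_mem_Idl[OF x Y g(2)[OF \<rho>]])
  ultimately show ?thesis
    by (intro exI[of _ "\<lambda>e. series x (\<lambda>n. \<alpha> (\<rho> n) e)"] exI[of _ "series x (\<lambda>n. \<kappa> (\<rho> n))"]) blast
qed

text \<open>Representatives modulo \<open>mpow s\<close> generate \<open>R\<close> up to an error in
  the parameter ideal, with coefficients zero and one. Each stage of the tower absorbs one generator
  of this ideal, until no error is left.\<close>

lemma tower_generation:
  assumes par: "parameters \<xi> d"
  shows "\<exists>E. finite E \<and> E \<subseteq> carrier R \<and>
    (\<forall>r\<in>carrier R. \<exists>a. (\<forall>e. a e \<in> tower \<xi> d) \<and> r = (\<Oplus>e\<in>E. a e \<otimes> e))"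
proof -
  have \<xi>: "\<xi> i \<in> max_ideal R" if "i < d" for i using par that unfolding parameters_def by blast
  obtain s where s: "mpow s \<subseteq> Idl (insert residue_char (\<xi> ` {..<d}))" using par unfolding parameters_def by blast
  obtain E where E: "finite E" "E \<subseteq> carrier R" "\<And>r. r \<in> carrier R \<Longrightarrow> \<exists>e\<in>E. r \<ominus> e \<in> mpow s"
    using finite_residues[of s] by blast
  have Y: "finite (\<xi> ` {k..<d})" "\<xi> ` {k..<d} \<subseteq> carrier R" for k using \<xi> max_ideal_carr by auto
  have gen: "\<exists>a \<kappa>. (\<forall>e. a e \<in> tower \<xi> k) \<and> \<kappa> \<in> Idl (\<xi> ` {k..<d}) \<and> r = (\<Oplus>e\<in>E. a e \<otimes> e) \<oplus> \<kappa>"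
    if "k \<le> d" "r \<in> carrier R" for k r
    using that
  proof (induction k arbitrary: r)
    case 0
    show ?case unfolding tower.simps
    proof (rule generation_step[OF residue_char_mem subringE(1)[OF subring_integers] E(1,2) Y])
      show "\<exists>a \<kappa>. (\<forall>e. a e \<in> integers) \<and> \<kappa> \<in> Idl (insert residue_char (\<xi> ` {0..<d})) \<and> r = (\<Oplus>e\<in>E. a e \<otimes> e) \<oplus> \<kappa>"
        if r: "r \<in> carrier R" for r
      proof -
        obtain f where f: "f \<in> E" "r \<ominus> f \<in> mpow s" using E(3)[OF r] by blast
        have fc: "f \<in> carrier R" using f(1) E(2) by blast
        have "(\<Oplus>e\<in>E. (if e = f then \<one> else \<zero>) \<otimes> e) = (\<Oplus>e\<in>E. (if f = e then e else \<zero>))"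
          by (rule finsum_cong') (use E(2) in auto)
        also have "\<dots> = f" by (rule finsum_singleton[OF f(1) E(1)]) (use E(2) in auto)
        finally have "(\<Oplus>e\<in>E. (if e = f then \<one> else \<zero>) \<otimes> e) \<oplus> (r \<ominus> f) = f \<oplus> (r \<ominus> f)" by simp
        also have "\<dots> = r" using fc r by algebra
        finally have "r = (\<Oplus>e\<in>E. (if e = f then \<one> else \<zero>) \<otimes> e) \<oplus> (r \<ominus> f)" by simp
        moreover have "r \<ominus> f \<in> Idl (insert residue_char (\<xi> ` {0..<d}))"
          using f(2) s by (auto simp: lessThan_atLeast0)
        ultimately show ?thesis using subringE(2,3)[OF subring_integers]
          by (intro exI[of _ "\<lambda>e. if e = f then \<one> else \<zero>"] exI[of _ "r \<ominus> f"]) simp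
      qed
    qed (use 0 in simp)
  next
    case (Suc k)
    have eq: "\<xi> ` {k..<d} = insert (\<xi> k) (\<xi> ` {Suc k..<d})"
    proof -
      have "{k..<d} = insert k {Suc k..<d}" using Suc.prems(1) by auto
      then show ?thesis by simp
    qed
    show ?case unfolding tower.simps
    proof (rule generation_step[OF _ _ E(1,2) Y])
      show "\<xi> k \<in> max_ideal R" using \<xi> Suc.prems by simp
      show "tower \<xi> k \<subseteq> carrier R" by (rule subringE(1)[OF subring_tower]) (use \<xi> Suc.prems in simp)
    qed (use Suc.prems Suc.IH eq in auto)
  qed
  have "\<exists>a. (\<forall>e. a e \<in> tower \<xi> d) \<and> r = (\<Oplus>e\<in>E. a e \<otimes> e)" if r: "r \<in> carrier R" for r
  proof -
    have "\<xi> ` {d..<d} = {}" by simp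
    then have "\<exists>a \<kappa>. (\<forall>e. a e \<in> tower \<xi> d) \<and> \<kappa> \<in> {\<zero>} \<and> r = (\<Oplus>e\<in>E. a e \<otimes> e) \<oplus> \<kappa>"
      using gen[OF order_refl r] unfolding Idl_empty[symmetric] by (simp only:)
    then obtain a where a: "\<forall>e. a e \<in> tower \<xi> d" "r = (\<Oplus>e\<in>E. a e \<otimes> e) \<oplus> \<zero>" by blast
    have "tower \<xi> d \<subseteq> carrier R" by (rule subringE(1)[OF subring_tower]) (rule \<xi>)
    then have "(\<Oplus>e\<in>E. a e \<otimes> e) \<in> carrier R" by (intro finsum_closed) (use a(1) E in auto)
    then show ?thesis using a by auto
  qed
  then show ?thesis using E by blast
qed

text \<open>Collects what the module theory needs from \<open>R\<close>. \<open>Y\<close> consists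
  of \<open>residue_char\<close> and the parameters: that \<open>\<phi>\<close> maps them into the
  maximal ideal will give continuity.\<close>

theorem coefficient_ring:
  assumes p: "Factorial_Ring.prime p"
  obtains A Y s E where "subring A R" "finite Y" "Y \<subseteq> A" "mpow s \<subseteq> Idl Y" "finite E" "E \<subseteq> carrier R"
    "\<And>r. r \<in> carrier R \<Longrightarrow> \<exists>a. (\<forall>e. a e \<in> A) \<and> r = (\<Oplus>e\<in>E. a e \<otimes> e)"
    "\<And>F. \<lbrakk>finite F; F \<subseteq> A; \<zero> \<notin> F\<rbrakk> \<Longrightarrow>
       \<exists>\<phi>. subring_endo A \<phi> \<and> \<phi> ` Y \<subseteq> max_ideal R \<and> divisibility_chain (\<phi> ` F)"
proof -
  obtain \<xi> d where par: "parameters \<xi> d" and min: "\<And>\<xi>' d'. parameters \<xi>' d' \<Longrightarrow> d \<le> d'"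
    using ex_minimal_parameters by blast
  have \<xi>: "\<xi> i \<in> max_ideal R" if "i < d" for i using par that unfolding parameters_def by blast
  obtain s where s: "mpow s \<subseteq> Idl (insert residue_char (\<xi> ` {..<d}))" using par unfolding parameters_def by blast
  obtain E where E: "finite E" "E \<subseteq> carrier R"
    "\<And>r. r \<in> carrier R \<Longrightarrow> \<exists>a. (\<forall>e. a e \<in> tower \<xi> d) \<and> r = (\<Oplus>e\<in>E. a e \<otimes> e)"
    using tower_generation[OF par] by blast
  show ?thesis
  proof (rule that[OF _ _ _ s E])
    show "subring (tower \<xi> d) R" by (rule subring_tower) (rule \<xi>)
    show "insert residue_char (\<xi> ` {..<d}) \<subseteq> tower \<xi> d"
      using residue_char_mem_tower[of d \<xi>] generator_mem_tower[of d \<xi>] \<xi> by auto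
  qed (use tower_endo_chain[OF p par min order_refl] in auto)
qed

end

section \<open>Base change of a torsion-free module\<close>

locale fg_torsion_free_module = module R W + noetherian_local_pro_p_domain p R
  for p :: nat and R (structure) and W +
  assumes fg: "finitely_generated_module R W" and torsion_free: "torsion_free_module R W"

section \<open>Linear combinations over a subring\<close>

context module
begin

definition lincomb :: "('c \<Rightarrow> 'a) \<Rightarrow> 'c set \<Rightarrow> 'c" where
  "lincomb a V = (\<Oplus>\<^bsub>M\<^esub>v\<in>V. a v \<odot>\<^bsub>M\<^esub> v)"

lemma lincomb_closed [intro, simp]:
  "\<lbrakk>V \<subseteq> carrier M; \<And>v. v \<in> V \<Longrightarrow> a v \<in> carrier R\<rbrakk> \<Longrightarrow> lincomb a V \<in> carrier M"
  unfolding lincomb_def by (intro M.finsum_closed) auto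

lemma lincomb_empty [simp]: "lincomb a {} = \<zero>\<^bsub>M\<^esub>"
  by (simp add: lincomb_def)

lemma lincomb_cong:
  "\<lbrakk>V \<subseteq> carrier M; \<And>v. v \<in> V \<Longrightarrow> b v \<in> carrier R; \<And>v. v \<in> V \<Longrightarrow> a v = b v\<rbrakk> \<Longrightarrow> lincomb a V = lincomb b V"
  unfolding lincomb_def by (rule M.finsum_cong') auto

lemma lincomb_insert:
  assumes "finite V" "v \<notin> V" "insert v V \<subseteq> carrier M" "\<And>w. w \<in> insert v V \<Longrightarrow> a w \<in> carrier R"
  shows "lincomb a (insert v V) = a v \<odot>\<^bsub>M\<^esub> v \<oplus>\<^bsub>M\<^esub> lincomb a V"
  unfolding lincomb_def by (rule M.finsum_insert) (use assms in auto)

lemma lincomb_add: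
  assumes "V \<subseteq> carrier M" "\<And>v. v \<in> V \<Longrightarrow> a v \<in> carrier R" "\<And>v. v \<in> V \<Longrightarrow> b v \<in> carrier R"
  shows "lincomb (\<lambda>v. a v \<oplus> b v) V = lincomb a V \<oplus>\<^bsub>M\<^esub> lincomb b V"
proof -
  have "lincomb (\<lambda>v. a v \<oplus> b v) V = (\<Oplus>\<^bsub>M\<^esub>v\<in>V. a v \<odot>\<^bsub>M\<^esub> v \<oplus>\<^bsub>M\<^esub> b v \<odot>\<^bsub>M\<^esub> v)"
    unfolding lincomb_def by (rule M.finsum_cong') (use assms in \<open>auto simp: smult_l_distr subset_iff\<close>)
  also have "\<dots> = lincomb a V \<oplus>\<^bsub>M\<^esub> lincomb b V"
    unfolding lincomb_def by (rule M.finsum_addf) (use assms in auto)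
  finally show ?thesis .
qed

lemma lincomb_smult:
  assumes "finite V" "V \<subseteq> carrier M" "\<And>v. v \<in> V \<Longrightarrow> a v \<in> carrier R" "r \<in> carrier R"
  shows "lincomb (\<lambda>v. r \<otimes> a v) V = r \<odot>\<^bsub>M\<^esub> lincomb a V"
proof -
  have "r \<odot>\<^bsub>M\<^esub> lincomb a V = (\<Oplus>\<^bsub>M\<^esub>v\<in>V. r \<odot>\<^bsub>M\<^esub> (a v \<odot>\<^bsub>M\<^esub> v))"
    unfolding lincomb_def by (rule finsum_smult_ldistr) (use assms in auto)
  also have "\<dots> = lincomb (\<lambda>v. r \<otimes> a v) V"
    unfolding lincomb_def by (rule M.finsum_cong') (use assms in \<open>auto simp: smult_assoc1 subset_iff\<close>)
  finally show ?thesis by simp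
qed

lemma lincomb_single:
  assumes "finite V" "V \<subseteq> carrier M" "w \<in> V" "r \<in> carrier R"
  shows "lincomb (\<lambda>v. if v = w then r else \<zero>) V = r \<odot>\<^bsub>M\<^esub> w"
proof -
  have "lincomb (\<lambda>v. if v = w then r else \<zero>) V = (\<Oplus>\<^bsub>M\<^esub>v\<in>V. if w = v then r \<odot>\<^bsub>M\<^esub> v else \<zero>\<^bsub>M\<^esub>)"
    unfolding lincomb_def by (rule M.finsum_cong') (use assms in \<open>auto simp: subset_iff\<close>)
  also have "\<dots> = r \<odot>\<^bsub>M\<^esub> w" by (rule M.finsum_singleton) (use assms in auto)
  finally show ?thesis .
qed

lemma lincomb_mono:
  assumes "finite V" "U \<subseteq> V" "V \<subseteq> carrier M" "\<And>v. v \<in> V \<Longrightarrow> a v \<in> carrier R" "\<And>v. v \<in> V - U \<Longrightarrow> a v = \<zero>"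
  shows "lincomb a U = lincomb a V"
  unfolding lincomb_def
  by (rule M.add.finprod_mono_neutral_cong_left) (use assms in \<open>auto simp: subset_iff\<close>)

text \<open>Coefficient functions take values in \<open>A\<close> everywhere, also outside
  \<open>V\<close>, so that they can be reused for other sets of vectors without side
  conditions.\<close>

definition span_over :: "'a set \<Rightarrow> 'c set \<Rightarrow> 'c set" where
  "span_over A V = {lincomb a V | a. \<forall>v. a v \<in> A}"

lemma span_overI: "(\<And>v. a v \<in> A) \<Longrightarrow> lincomb a V \<in> span_over A V"
  unfolding span_over_def by blast

context
  fixes A V
  assumes A: "subring A R" and V: "finite V" "V \<subseteq> carrier M"
begin

lemma span_over_carr: "u \<in> span_over A V \<Longrightarrow> u \<in> carrier M"
  using subringE(1)[OF A] V unfolding span_over_def by auto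

lemma span_over_add:
  assumes "u \<in> span_over A V" "w \<in> span_over A V"
  shows "u \<oplus>\<^bsub>M\<^esub> w \<in> span_over A V"
proof -
  obtain a where a: "\<And>v. a v \<in> A" "u = lincomb a V" using assms(1) unfolding span_over_def by blast
  obtain b where b: "\<And>v. b v \<in> A" "w = lincomb b V" using assms(2) unfolding span_over_def by blast
  have "u \<oplus>\<^bsub>M\<^esub> w = lincomb (\<lambda>v. a v \<oplus> b v) V"
    unfolding a(2) b(2) by (rule lincomb_add[symmetric]) (use a b V subringE(1)[OF A] in auto)
  then show ?thesis using span_overI[of "\<lambda>v. a v \<oplus> b v" A V] subringE(7)[OF A] a(1) b(1) by simp
qed

lemma span_over_smult:
  assumes "r \<in> A" "w \<in> span_over A V"
  shows "r \<odot>\<^bsub>M\<^esub> w \<in> span_over A V"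
proof -
  obtain b where b: "\<And>v. b v \<in> A" "w = lincomb b V" using assms(2) unfolding span_over_def by blast
  have "r \<odot>\<^bsub>M\<^esub> w = lincomb (\<lambda>v. r \<otimes> b v) V"
    unfolding b(2) by (rule lincomb_smult[symmetric]) (use assms b V subringE(1)[OF A] in auto)
  then show ?thesis using span_overI[of "\<lambda>v. r \<otimes> b v" A V] subringE(6)[OF A] assms(1) b(1) by simp
qed

lemma span_over_mem:
  assumes "w \<in> V"
  shows "w \<in> span_over A V"
proof -
  have "w = lincomb (\<lambda>v. if v = w then \<one> else \<zero>) V" using lincomb_single[OF V assms, of \<one>] V assms by auto
  then show ?thesis using span_overI[of "\<lambda>v. if v = w then \<one> else \<zero>" A V] subringE(2,3)[OF A] by simp
qed

lemma span_over_zero: "\<zero>\<^bsub>M\<^esub> \<in> span_over A V"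
proof -
  have "\<zero>\<^bsub>M\<^esub> = lincomb (\<lambda>v. \<zero>) V" unfolding lincomb_def using V
    by (intro M.add.finprod_one_eqI[symmetric]) (auto simp: subset_iff)
  then show ?thesis using span_overI[of "\<lambda>v. \<zero>" A V] subringE(2)[OF A] by simp
qed

lemma span_over_finsum:
  assumes "finite I" "\<And>i. i \<in> I \<Longrightarrow> f i \<in> span_over A V"
  shows "(\<Oplus>\<^bsub>M\<^esub>i\<in>I. f i) \<in> span_over A V"
  using assms
proof (induction I rule: finite_induct)
  case empty
  then show ?case by (simp add: span_over_zero)
next
  case (insert i I)
  have "(\<Oplus>\<^bsub>M\<^esub>i\<in>insert i I. f i) = f i \<oplus>\<^bsub>M\<^esub> (\<Oplus>\<^bsub>M\<^esub>i\<in>I. f i)"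
    by (rule M.finsum_insert) (use insert span_over_carr in auto)
  then show ?case using insert span_over_add by simp
qed

end

lemma finitely_generated_span:
  assumes "finitely_generated_module R M"
  obtains V where "finite V" "V \<subseteq> carrier M" "span_over (carrier R) V = carrier M"
proof -
  obtain V where V: "V \<subseteq> carrier M" "finite V" "submodule_span R M V = carrier M"
    using assms unfolding finitely_generated_module_def by blast
  note cr = R.carrier_is_subring
  have "submodule (span_over (carrier R) V) R M"
  proof (rule submoduleI)
    show "\<ominus>\<^bsub>M\<^esub> u \<in> span_over (carrier R) V" if "u \<in> span_over (carrier R) V" for u
      using span_over_smult[OF cr V(2,1) _ that, of "\<ominus> \<one>"] span_over_carr[OF cr V(2,1) that]
      by (simp add: smult_l_minus)
  qed (use span_over_carr span_over_add span_over_smult span_over_zero cr V in auto)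
  moreover have "V \<subseteq> span_over (carrier R) V" using span_over_mem[OF cr V(2,1)] by blast
  ultimately have "carrier M \<subseteq> span_over (carrier R) V" using V(3) unfolding submodule_span_def by blast
  then show ?thesis using that[OF V(2,1)] span_over_carr[OF cr V(2,1)] by blast
qed

text \<open>Generators over \<open>R\<close> are multiplied by the finitely many generators
  \<open>E\<close> of \<open>R\<close> over \<open>A\<close>.\<close>

lemma subring_generation:
  assumes A: "subring A R" and E: "finite E" "E \<subseteq> carrier R"
    "\<And>r. r \<in> carrier R \<Longrightarrow> \<exists>a. (\<forall>e. a e \<in> A) \<and> r = (\<Oplus>e\<in>E. a e \<otimes> e)"
    and fg: "finitely_generated_module R M"
  obtains V where "finite V" "V \<subseteq> carrier M" "span_over A V = carrier M"
proof -
  obtain G where G: "finite G" "G \<subseteq> carrier M" "span_over (carrier R) G = carrier M"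
    using finitely_generated_span[OF fg] by blast
  let ?V = "(\<lambda>(e, x). e \<odot>\<^bsub>M\<^esub> x) ` (E \<times> G)"
  have V: "finite ?V" "?V \<subseteq> carrier M" using E G by (auto simp: subset_iff)
  have Ac: "a \<in> A \<Longrightarrow> a \<in> carrier R" for a using subringE(1)[OF A] by blast
  have mem: "r \<odot>\<^bsub>M\<^esub> x \<in> span_over A ?V" if r: "r \<in> carrier R" and x: "x \<in> G" for r x
  proof -
    obtain a where a: "\<And>e. a e \<in> A" "r = (\<Oplus>e\<in>E. a e \<otimes> e)" using E(3)[OF r] by blast
    have xc: "x \<in> carrier M" using x G by blast
    have "(\<Oplus>e\<in>F. a e \<otimes> e) \<odot>\<^bsub>M\<^esub> x = (\<Oplus>\<^bsub>M\<^esub>e\<in>F. a e \<odot>\<^bsub>M\<^esub> (e \<odot>\<^bsub>M\<^esub> x))" if "finite F" "F \<subseteq> E" for F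
      using that
    proof (induction F rule: finite_induct)
      case (insert f F)
      have fc: "f \<in> carrier R" "F \<subseteq> carrier R" using insert.prems E by auto
      have "(\<Oplus>e\<in>insert f F. a e \<otimes> e) = a f \<otimes> f \<oplus> (\<Oplus>e\<in>F. a e \<otimes> e)"
        by (rule R.finsum_insert) (use insert fc a Ac in auto)
      moreover have "(\<Oplus>\<^bsub>M\<^esub>e\<in>insert f F. a e \<odot>\<^bsub>M\<^esub> (e \<odot>\<^bsub>M\<^esub> x)) = a f \<odot>\<^bsub>M\<^esub> (f \<odot>\<^bsub>M\<^esub> x) \<oplus>\<^bsub>M\<^esub> (\<Oplus>\<^bsub>M\<^esub>e\<in>F. a e \<odot>\<^bsub>M\<^esub> (e \<odot>\<^bsub>M\<^esub> x))"
        by (rule M.finsum_insert) (use insert fc a Ac xc in auto)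
      moreover have "(\<Oplus>e\<in>F. a e \<otimes> e) \<in> carrier R" by (rule R.finsum_closed) (use fc a Ac in auto)
      ultimately show ?case using insert fc a Ac xc by (simp add: smult_l_distr smult_assoc1)
    qed (use xc in simp)
    then have "r \<odot>\<^bsub>M\<^esub> x = (\<Oplus>\<^bsub>M\<^esub>e\<in>E. a e \<odot>\<^bsub>M\<^esub> (e \<odot>\<^bsub>M\<^esub> x))" unfolding a(2) using E(1) by blast
    also have "\<dots> \<in> span_over A ?V"
      by (rule span_over_finsum[OF A V E(1)], rule span_over_smult[OF A V a(1)], rule span_over_mem[OF A V])
        (use x in auto)
    finally show ?thesis .
  qed
  have "lincomb c G \<in> span_over A ?V" if "\<And>x. c x \<in> carrier R" for c
    unfolding lincomb_def by (rule span_over_finsum[OF A V G(1)], rule mem) (use that in simp_all)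
  then have "span_over (carrier R) G \<subseteq> span_over A ?V" unfolding span_over_def by blast
  then show ?thesis using that[OF V] G(3) span_over_carr[OF A V] by blast
qed

definition independent_over :: "'a set \<Rightarrow> 'c set \<Rightarrow> bool" where
  "independent_over A J \<longleftrightarrow> (\<forall>a. (\<forall>v. a v \<in> A) \<longrightarrow> lincomb a J = \<zero>\<^bsub>M\<^esub> \<longrightarrow> (\<forall>v\<in>J. a v = \<zero>))"

text \<open>The prescribed subset \<open>J\<close> will be the evaluation basis, which the family of
  dual maps has to extend.\<close>

lemma ex_maximal_independent:
  assumes "finite V" "J \<subseteq> V" "independent_over A J"
  shows "\<exists>Y. J \<subseteq> Y \<and> Y \<subseteq> V \<and> independent_over A Y \<and> (\<forall>x\<in>V - Y. \<not> independent_over A (insert x Y))"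
proof -
  let ?S = "{Y. J \<subseteq> Y \<and> Y \<subseteq> V \<and> independent_over A Y}"
  have "finite ?S" using assms(1) by (auto intro: finite_subset[of _ "Pow V"])
  moreover have "?S \<noteq> {}" using assms by blast
  ultimately have "\<exists>Y\<in>?S. \<forall>Z\<in>?S. Y \<subseteq> Z \<longrightarrow> Y = Z" by (rule finite_has_maximal)
  then obtain Y where Y: "Y \<in> ?S" "\<forall>Z\<in>?S. Y \<subseteq> Z \<longrightarrow> Y = Z" by (rule bexE)
  have "\<not> independent_over A (insert x Y)" if "x \<in> V - Y" for x
  proof
    assume "independent_over A (insert x Y)"
    then have "Y = insert x Y" using Y(1) that by (intro Y(2)[rule_format]) auto
    then show False using that by blast
  qed
  then show ?thesis using Y(1) by blast
qed

end

section \<open>Denominators, semilinear maps and dual maps\<close>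

context fg_torsion_free_module
begin

lemma torsion_freeD: "\<lbrakk>a \<in> carrier R; w \<in> carrier W; a \<odot>\<^bsub>W\<^esub> w = \<zero>\<^bsub>W\<^esub>; a \<noteq> \<zero>\<rbrakk> \<Longrightarrow> w = \<zero>\<^bsub>W\<^esub>"
  using torsion_free unfolding torsion_free_module_def by blast

text \<open>By maximality of \<open>Y\<close> each generator has a nonzero multiple in the span of
  \<open>Y\<close>; the product of the finitely many multipliers serves all of
  \<open>W\<close>.\<close>

lemma ex_common_denominator:
  assumes A: "subring A R" and V: "finite V" "V \<subseteq> carrier W" "span_over A V = carrier W"
    and Y: "Y \<subseteq> V" "independent_over A Y" "\<And>x. x \<in> V - Y \<Longrightarrow> \<not> independent_over A (insert x Y)"
  shows "\<exists>c\<in>A. c \<noteq> \<zero> \<and> (\<forall>w\<in>carrier W. c \<odot>\<^bsub>W\<^esub> w \<in> span_over A Y)"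
proof -
  have Ac: "a \<in> A \<Longrightarrow> a \<in> carrier R" for a using subringE(1)[OF A] by blast
  have Yf: "finite Y" "Y \<subseteq> carrier W" using Y(1) V finite_subset by auto
  have one: "\<exists>c\<in>A. c \<noteq> \<zero> \<and> c \<odot>\<^bsub>W\<^esub> x \<in> span_over A Y" if x: "x \<in> V" for x
  proof (cases "x \<in> Y")
    case True
    then show ?thesis using span_over_mem[OF A Yf] Yf subringE(3)[OF A] one_not_zero
      by (intro bexI[of _ \<one>]) auto
  next
    case False
    then obtain a where a: "\<And>v. a v \<in> A" "lincomb a (insert x Y) = \<zero>\<^bsub>W\<^esub>" "\<exists>v\<in>insert x Y. a v \<noteq> \<zero>"
      using Y(3)[of x] x unfolding independent_over_def by blast
    have xc: "x \<in> carrier W" using x V by blast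
    have eq: "a x \<odot>\<^bsub>W\<^esub> x \<oplus>\<^bsub>W\<^esub> lincomb a Y = \<zero>\<^bsub>W\<^esub>"
      using a(2) lincomb_insert[OF Yf(1) False, of a] Yf xc a(1) Ac by auto
    have lc: "lincomb a Y \<in> carrier W" using a(1) Ac Yf by auto
    \<comment> \<open>The relation must involve \<open>x\<close>, since \<open>Y\<close> alone is
      independent.\<close>
    have "a x \<noteq> \<zero>"
    proof
      assume ax: "a x = \<zero>"
      then have "lincomb a Y = \<zero>\<^bsub>W\<^esub>" using eq xc lc by simp
      then have "\<forall>v\<in>Y. a v = \<zero>" using Y(2) a(1) unfolding independent_over_def by blast
      then show False using ax a(3) by blast
    qed
    moreover have "a x \<odot>\<^bsub>W\<^esub> x = (\<ominus> \<one>) \<odot>\<^bsub>W\<^esub> lincomb a Y"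
      using eq lc xc a(1) Ac M.minus_equality[of "a x \<odot>\<^bsub>W\<^esub> x" "lincomb a Y"] by (simp add: smult_l_minus)
    moreover have "(\<ominus> \<one>) \<odot>\<^bsub>W\<^esub> lincomb a Y \<in> span_over A Y"
      by (intro span_over_smult[OF A Yf] subringE(5)[OF A] subringE(3)[OF A] span_overI a)
    ultimately show ?thesis using a(1) by metis
  qed
  have "\<exists>c\<in>A. c \<noteq> \<zero> \<and> (\<forall>x\<in>G. c \<odot>\<^bsub>W\<^esub> x \<in> span_over A Y)" if "finite G" "G \<subseteq> V" for G
    using that
  proof (induction G rule: finite_induct)
    case empty
    then show ?case using subringE(3)[OF A] one_not_zero by (intro bexI[of _ \<one>]) auto
  next
    case (insert x G)
    obtain c where c: "c \<in> A" "c \<noteq> \<zero>" "\<forall>x\<in>G. c \<odot>\<^bsub>W\<^esub> x \<in> span_over A Y" using insert by auto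
    obtain e where e: "e \<in> A" "e \<noteq> \<zero>" "e \<odot>\<^bsub>W\<^esub> x \<in> span_over A Y" using one[of x] insert.prems by auto
    have "c \<otimes> e \<noteq> \<zero>" using integral[OF _ Ac[OF c(1)] Ac[OF e(1)]] c(2) e(2) by blast
    moreover have "(c \<otimes> e) \<odot>\<^bsub>W\<^esub> z \<in> span_over A Y" if z: "z \<in> insert x G" for z
    proof -
      have zc: "z \<in> carrier W" using z insert.prems V by blast
      have "(c \<otimes> e) \<odot>\<^bsub>W\<^esub> z = c \<odot>\<^bsub>W\<^esub> (e \<odot>\<^bsub>W\<^esub> z)" using c e Ac zc by (simp add: smult_assoc1)
      moreover have "(c \<otimes> e) \<odot>\<^bsub>W\<^esub> z = e \<odot>\<^bsub>W\<^esub> (c \<odot>\<^bsub>W\<^esub> z)" using c e Ac zc R.m_comm[OF Ac[OF c(1)] Ac[OF e(1)]] by (simp add: smult_assoc1)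
      moreover have "z = x \<or> z \<in> G" using z by blast
      ultimately show ?thesis
        using c(3) span_over_smult[OF A Yf c(1) e(3)] span_over_smult[OF A Yf e(1), of "c \<odot>\<^bsub>W\<^esub> z"] by auto
    qed
    moreover have "c \<otimes> e \<in> A" using subringE(6)[OF A] c e by blast
    ultimately show ?case by blast
  qed
  from this[OF V(1) order_refl] obtain c
    where c: "c \<in> A" "c \<noteq> \<zero>" "\<And>x. x \<in> V \<Longrightarrow> c \<odot>\<^bsub>W\<^esub> x \<in> span_over A Y" by blast
  have "c \<odot>\<^bsub>W\<^esub> w \<in> span_over A Y" if w: "w \<in> carrier W" for w
  proof -
    obtain a where a: "\<And>v. a v \<in> A" "w = lincomb a V" using w V(3) unfolding span_over_def by blast
    have "c \<odot>\<^bsub>W\<^esub> w = (\<Oplus>\<^bsub>W\<^esub>v\<in>V. c \<odot>\<^bsub>W\<^esub> (a v \<odot>\<^bsub>W\<^esub> v))"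
      unfolding a(2) lincomb_def by (rule finsum_smult_ldistr) (use V a c Ac in auto)
    also have "\<dots> = (\<Oplus>\<^bsub>W\<^esub>v\<in>V. a v \<odot>\<^bsub>W\<^esub> (c \<odot>\<^bsub>W\<^esub> v))"
    proof (rule M.finsum_cong')
      fix v assume v: "v \<in> V"
      then have "v \<in> carrier W" "c \<in> carrier R" "a v \<in> carrier R" using V a c Ac by auto
      then show "c \<odot>\<^bsub>W\<^esub> (a v \<odot>\<^bsub>W\<^esub> v) = a v \<odot>\<^bsub>W\<^esub> (c \<odot>\<^bsub>W\<^esub> v)" by (metis R.m_comm smult_assoc1)
    qed (use V a c Ac in auto)
    also have "\<dots> \<in> span_over A Y"
      by (rule span_over_finsum[OF A Yf V(1)], rule span_over_smult[OF A Yf a(1)], rule c(3))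
    finally show ?thesis .
  qed
  then show ?thesis using c by blast
qed

text \<open>The base change of \<open>W\<close> to \<open>R\<close> along \<open>\<phi>\<close>, modulo torsion, is represented by the \<open>R\<close>-span of the
  evaluations \<open>\<theta> \<mapsto> \<theta> u\<close> on the semilinear maps \<open>\<theta>\<close>: on these the endomorphisms of \<open>W\<close> act by
  composition, and no quotient is needed.\<close>

definition semilinear_maps :: "'a set \<Rightarrow> ('a \<Rightarrow> 'a) \<Rightarrow> ('c \<Rightarrow> 'a) set" where
  "semilinear_maps A \<phi> = {\<theta>. (\<forall>u\<in>carrier W. \<theta> u \<in> carrier R) \<and>
     (\<forall>u\<in>carrier W. \<forall>w\<in>carrier W. \<theta> (u \<oplus>\<^bsub>W\<^esub> w) = \<theta> u \<oplus> \<theta> w) \<and>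
     (\<forall>a\<in>A. \<forall>u\<in>carrier W. \<theta> (a \<odot>\<^bsub>W\<^esub> u) = \<phi> a \<otimes> \<theta> u)}"

lemma semilinearD:
  assumes "\<theta> \<in> semilinear_maps A \<phi>"
  shows "u \<in> carrier W \<Longrightarrow> \<theta> u \<in> carrier R"
    "\<lbrakk>u \<in> carrier W; w \<in> carrier W\<rbrakk> \<Longrightarrow> \<theta> (u \<oplus>\<^bsub>W\<^esub> w) = \<theta> u \<oplus> \<theta> w"
    "\<lbrakk>a \<in> A; u \<in> carrier W\<rbrakk> \<Longrightarrow> \<theta> (a \<odot>\<^bsub>W\<^esub> u) = \<phi> a \<otimes> \<theta> u"
  using assms unfolding semilinear_maps_def by simp_all

lemma semilinear_zero:
  assumes "\<theta> \<in> semilinear_maps A \<phi>"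
  shows "\<theta> \<zero>\<^bsub>W\<^esub> = \<zero>"
proof -
  have c: "\<theta> \<zero>\<^bsub>W\<^esub> \<in> carrier R" using semilinearD(1)[OF assms] by simp
  have "\<theta> \<zero>\<^bsub>W\<^esub> \<oplus> \<theta> \<zero>\<^bsub>W\<^esub> = \<theta> \<zero>\<^bsub>W\<^esub>" using semilinearD(2)[OF assms, of "\<zero>\<^bsub>W\<^esub>" "\<zero>\<^bsub>W\<^esub>"] by simp
  then show ?thesis using R.add.l_cancel_one[OF c c] by simp
qed

lemma semilinear_lincomb:
  assumes \<theta>: "\<theta> \<in> semilinear_maps A \<phi>" and A: "subring A R" and \<phi>: "subring_endo A \<phi>"
    and J: "finite J" "J \<subseteq> carrier W" and a: "\<And>v. a v \<in> A"
  shows "\<theta> (lincomb a J) = (\<Oplus>v\<in>J. \<phi> (a v) \<otimes> \<theta> v)"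
  using J
proof (induction J rule: finite_induct)
  case empty
  then show ?case using semilinear_zero[OF \<theta>] by simp
next
  case (insert v J)
  have ac: "a v \<in> carrier R" "\<phi> (a v) \<in> carrier R" for v
    using a subring_endoD(1)[OF \<phi>] subringE(1)[OF A] by auto
  have "\<theta> (lincomb a (insert v J)) = \<phi> (a v) \<otimes> \<theta> v \<oplus> \<theta> (lincomb a J)"
    using lincomb_insert[of J v a] insert ac a semilinearD[OF \<theta>] by simp
  moreover have "(\<Oplus>v\<in>insert v J. \<phi> (a v) \<otimes> \<theta> v) = \<phi> (a v) \<otimes> \<theta> v \<oplus> (\<Oplus>v\<in>J. \<phi> (a v) \<otimes> \<theta> v)"
    by (rule R.finsum_insert) (use insert ac semilinearD(1)[OF \<theta>] in auto)
  ultimately show ?case using insert by simp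
qed

text \<open>After multiplication by a common denominator \<open>c\<close>, elements of
  \<open>W\<close> have coordinates with respect to a maximal independent set, and
  \<open>\<phi>\<close> of a coordinate is semilinear. The value at the map's own basis vector is
  \<open>\<phi> c\<close> instead of one, which is still nonzero. Points are separated because
  \<open>\<phi>\<close> is injective and \<open>W\<close> is torsion-free.\<close>

lemma ex_dual_maps:
  assumes A: "subring A R" and \<phi>: "subring_endo A \<phi>"
    and V: "finite V" "V \<subseteq> carrier W" "span_over A V = carrier W"
    and J: "J \<subseteq> V" "independent_over A J"
  shows "\<exists>Y \<eta>. J \<subseteq> Y \<and> (\<forall>y\<in>Y. \<eta> y \<in> semilinear_maps A \<phi> \<and> \<eta> y y \<noteq> \<zero> \<and> (\<forall>v\<in>Y. v \<noteq> y \<longrightarrow> \<eta> y v = \<zero>)) \<and>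
    (\<forall>u\<in>carrier W. (\<forall>y\<in>Y. \<eta> y u = \<zero>) \<longrightarrow> u = \<zero>\<^bsub>W\<^esub>)"
proof -
  note AE = subringE[OF A]
  have Ac: "a \<in> A \<Longrightarrow> a \<in> carrier R" for a using AE(1) by blast
  note \<phi>D = subring_endoD[OF \<phi>]
  obtain Y where Y: "J \<subseteq> Y" "Y \<subseteq> V" "independent_over A Y" "\<And>x. x \<in> V - Y \<Longrightarrow> \<not> independent_over A (insert x Y)"
    using ex_maximal_independent[OF V(1) J] by blast
  have Yf: "finite Y" "Y \<subseteq> carrier W" using Y(2) V finite_subset by auto
  obtain c where c: "c \<in> A" "c \<noteq> \<zero>" "\<And>w. w \<in> carrier W \<Longrightarrow> c \<odot>\<^bsub>W\<^esub> w \<in> span_over A Y"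
    using ex_common_denominator[OF A V Y(2,3,4)] by blast
  define \<kappa> where "\<kappa> w = (SOME b. (\<forall>v. b v \<in> A) \<and> c \<odot>\<^bsub>W\<^esub> w = lincomb b Y)" for w
  have \<kappa>: "\<kappa> w v \<in> A" "c \<odot>\<^bsub>W\<^esub> w = lincomb (\<kappa> w) Y" if "w \<in> carrier W" for w v
  proof -
    have "\<exists>b. (\<forall>v. b v \<in> A) \<and> c \<odot>\<^bsub>W\<^esub> w = lincomb b Y" using c(3)[OF that] unfolding span_over_def by blast
    from someI_ex[OF this] show "\<kappa> w v \<in> A" "c \<odot>\<^bsub>W\<^esub> w = lincomb (\<kappa> w) Y" unfolding \<kappa>_def by blast+
  qed
  have uniq: "a v = b v" if a: "\<And>v. a v \<in> A" and b: "\<And>v. b v \<in> A" and eq: "lincomb a Y = lincomb b Y" and v: "v \<in> Y" for a b v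
  proof -
    have ac: "a v \<in> carrier R" "b v \<in> carrier R" for v using a b Ac by auto
    have lc: "lincomb a Y \<in> carrier W" "lincomb b Y \<in> carrier W" using ac Yf by auto
    have "lincomb (\<lambda>v. a v \<oplus> \<ominus> \<one> \<otimes> b v) Y = lincomb a Y \<oplus>\<^bsub>W\<^esub> (\<ominus> \<one>) \<odot>\<^bsub>W\<^esub> lincomb b Y"
      using lincomb_add[OF Yf(2), of a "\<lambda>v. \<ominus> \<one> \<otimes> b v"] lincomb_smult[OF Yf, of b "\<ominus> \<one>"] ac by simp
    also have "\<dots> = \<zero>\<^bsub>W\<^esub>" using eq lc by (simp add: smult_l_minus M.r_neg)
    finally have "lincomb (\<lambda>v. a v \<oplus> \<ominus> \<one> \<otimes> b v) Y = \<zero>\<^bsub>W\<^esub>" .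
    moreover have "a v \<oplus> \<ominus> \<one> \<otimes> b v \<in> A" for v using AE a b by simp
    ultimately have "a v \<oplus> \<ominus> \<one> \<otimes> b v = \<zero>"
      using Y(3)[unfolded independent_over_def, rule_format, of "\<lambda>v. a v \<oplus> \<ominus> \<one> \<otimes> b v" v] v by blast
    then have "a v \<ominus> b v = \<zero>" using ac by (simp add: R.l_minus a_minus_def)
    then show ?thesis using ac by simp
  qed
  define \<eta> where "\<eta> y w = \<phi> (\<kappa> w y)" for y w
  have \<eta>: "\<eta> y \<in> semilinear_maps A \<phi>" if y: "y \<in> Y" for y
    unfolding semilinear_maps_def
  proof (intro CollectI conjI ballI)
    show "\<eta> y u \<in> carrier R" if "u \<in> carrier W" for u unfolding \<eta>_def using \<kappa>(1)[OF that] \<phi>D(1) Ac by blast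
    show "\<eta> y (u \<oplus>\<^bsub>W\<^esub> w) = \<eta> y u \<oplus> \<eta> y w" if u: "u \<in> carrier W" and w: "w \<in> carrier W" for u w
    proof -
      have "lincomb (\<kappa> (u \<oplus>\<^bsub>W\<^esub> w)) Y = lincomb (\<lambda>v. \<kappa> u v \<oplus> \<kappa> w v) Y"
      proof -
        have "lincomb (\<kappa> (u \<oplus>\<^bsub>W\<^esub> w)) Y = c \<odot>\<^bsub>W\<^esub> (u \<oplus>\<^bsub>W\<^esub> w)"
          by (rule \<kappa>(2)[symmetric]) (use u w in simp)
        also have "\<dots> = lincomb (\<kappa> u) Y \<oplus>\<^bsub>W\<^esub> lincomb (\<kappa> w) Y"
          unfolding \<kappa>(2)[OF u, symmetric] \<kappa>(2)[OF w, symmetric] using u w Ac[OF c(1)] by (simp add: smult_r_distr)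
        also have "\<dots> = lincomb (\<lambda>v. \<kappa> u v \<oplus> \<kappa> w v) Y"
          by (rule lincomb_add[OF Yf(2), symmetric]) (use \<kappa>(1)[OF u] \<kappa>(1)[OF w] Ac in auto)
        finally show ?thesis .
      qed
      then have "\<kappa> (u \<oplus>\<^bsub>W\<^esub> w) y = \<kappa> u y \<oplus> \<kappa> w y"
        by (intro uniq[OF _ _ _ y]) (use \<kappa>(1) u w AE(7) in auto)
      then show ?thesis unfolding \<eta>_def using \<phi>D(2) \<kappa>(1) u w by simp
    qed
    show "\<eta> y (a \<odot>\<^bsub>W\<^esub> u) = \<phi> a \<otimes> \<eta> y u" if a: "a \<in> A" and u: "u \<in> carrier W" for a u
    proof -
      have ca: "c \<in> carrier R" "a \<in> carrier R" using a c Ac by auto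
      have "lincomb (\<kappa> (a \<odot>\<^bsub>W\<^esub> u)) Y = c \<odot>\<^bsub>W\<^esub> (a \<odot>\<^bsub>W\<^esub> u)" using \<kappa>(2) u ca by simp
      also have "\<dots> = a \<odot>\<^bsub>W\<^esub> (c \<odot>\<^bsub>W\<^esub> u)" using u ca by (metis R.m_comm smult_assoc1)
      also have "\<dots> = lincomb (\<lambda>v. a \<otimes> \<kappa> u v) Y"
        unfolding \<kappa>(2)[OF u] by (rule lincomb_smult[OF Yf, symmetric]) (use \<kappa>(1)[OF u] Ac ca in auto)
      finally have "\<kappa> (a \<odot>\<^bsub>W\<^esub> u) y = a \<otimes> \<kappa> u y"
        by (intro uniq[OF _ _ _ y]) (use \<kappa>(1) u a ca AE(6) in auto)
      then show ?thesis unfolding \<eta>_def using \<phi>D(3) \<kappa>(1) u a by simp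
    qed
  qed
  have \<kappa>Y: "\<kappa> v y = (if y = v then c else \<zero>)" if v: "v \<in> Y" and y: "y \<in> Y" for v y
  proof (rule uniq[OF _ _ _ y])
    have "v \<in> carrier W" using v Yf by blast
    then show "\<kappa> v w \<in> A" for w by (rule \<kappa>)
    show "lincomb (\<kappa> v) Y = lincomb (\<lambda>y. if y = v then c else \<zero>) Y"
      using \<kappa>(2)[OF \<open>v \<in> carrier W\<close>] lincomb_single[OF Yf v, of c] c(1) Ac by simp
  qed (use c(1) AE(2) in auto)
  have "\<eta> y y \<noteq> \<zero>" if "y \<in> Y" for y unfolding \<eta>_def using \<kappa>Y[OF that that] c \<phi>D(5) by auto
  moreover have "\<eta> y v = \<zero>" if "y \<in> Y" "v \<in> Y" "v \<noteq> y" for y v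
    unfolding \<eta>_def using \<kappa>Y[OF that(2,1)] that(3) subring_endo_zero[OF A \<phi>] by auto
  moreover have "u = \<zero>\<^bsub>W\<^esub>" if u: "u \<in> carrier W" and z: "\<And>y. y \<in> Y \<Longrightarrow> \<eta> y u = \<zero>" for u
  proof -
    have "\<kappa> u y = \<zero>" if "y \<in> Y" for y using z[OF that] \<kappa>(1)[OF u] \<phi>D(5) unfolding \<eta>_def by blast
    then have "lincomb (\<kappa> u) Y = lincomb (\<kappa> u) {}" by (intro lincomb_mono[symmetric]) (use Yf \<kappa>(1)[OF u] Ac in auto)
    then have "c \<odot>\<^bsub>W\<^esub> u = \<zero>\<^bsub>W\<^esub>" using \<kappa>(2)[OF u] by simp
    then show ?thesis by (rule torsion_freeD[OF Ac[OF c(1)] u _ c(2)])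
  qed
  ultimately show ?thesis using Y(1) \<eta> by (intro exI[of _ Y] exI[of _ \<eta>]) blast
qed

section \<open>Elimination of generators by divisibility\<close>

lemma divisibility_chain_least:
  assumes "finite F" "F \<noteq> {}" "F \<subseteq> carrier R" "divisibility_chain F"
  shows "\<exists>m\<in>F. \<forall>f\<in>F. m divides f"
  using assms
proof (induction F rule: finite_ne_induct)
  case (singleton x)
  then show ?case by (auto intro: dividesI[of \<one>])
next
  case (insert x F)
  then obtain m where m: "m \<in> F" "\<And>f. f \<in> F \<Longrightarrow> m divides f" unfolding divisibility_chain_def by auto
  have mc: "m \<in> carrier R" "x \<in> carrier R" using m insert.prems by auto
  have rx: "x divides x" using mc by (auto intro: dividesI[of \<one>])
  consider "x divides m" | "m divides x" using insert.prems m unfolding divisibility_chain_def by blast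
  then show ?case
  proof cases
    case 1
    have "x divides f" if "f \<in> F" for f using R.divides_trans[OF 1 m(2)[OF that] mc(2)] .
    then show ?thesis using rx by blast
  next
    case 2
    then show ?thesis using m by blast
  qed
qed

text \<open>In terms of the base change modulo torsion, \<open>J\<close> generates it over
  \<open>R\<close>. The point is that the coefficients may depend on \<open>u\<close> but are the
  same for all \<open>\<theta>\<close>.\<close>

definition evaluation_spanning :: "'a set \<Rightarrow> ('a \<Rightarrow> 'a) \<Rightarrow> 'c set \<Rightarrow> bool" where
  "evaluation_spanning A \<phi> J \<longleftrightarrow> (\<forall>u\<in>carrier W. \<exists>c. (\<forall>v. c v \<in> carrier R) \<and>
     (\<forall>\<theta>\<in>semilinear_maps A \<phi>. \<theta> u = (\<Oplus>v\<in>J. c v \<otimes> \<theta> v)))"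

text \<open>A semilinear map turns the relation into one with coefficients
  \<open>\<phi> (a v)\<close>. Dividing by the one that divides all others expresses the evaluation
  at some \<open>i\<close> by the remaining evaluations, uniformly in the map. The division is
  legitimate because this coefficient is nonzero in a domain.\<close>

lemma evaluation_spanning_remove:
  assumes A: "subring A R" and \<phi>: "subring_endo A \<phi>" and J: "finite J" "J \<subseteq> carrier W"
    and sp: "evaluation_spanning A \<phi> J"
    and a: "\<And>v. a v \<in> A" "lincomb a J = \<zero>\<^bsub>W\<^esub>" "\<exists>v\<in>J. a v \<noteq> \<zero>"
    and chain: "divisibility_chain (\<phi> ` (a ` J - {\<zero>}))"
  shows "\<exists>i\<in>J. evaluation_spanning A \<phi> (J - {i})"
proof -
  have Ac: "a \<in> A \<Longrightarrow> a \<in> carrier R" for a using subringE(1)[OF A] by blast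
  note \<phi>D = subring_endoD[OF \<phi>]
  have pc: "\<phi> (a v) \<in> carrier R" for v using a(1) \<phi>D(1) Ac by blast
  have "\<exists>m\<in>\<phi> ` (a ` J - {\<zero>}). \<forall>f\<in>\<phi> ` (a ` J - {\<zero>}). m divides f"
    by (rule divisibility_chain_least) (use J a chain pc in auto)
  then obtain i where i: "i \<in> J" "a i \<noteq> \<zero>" "\<And>v. \<lbrakk>v \<in> J; a v \<noteq> \<zero>\<rbrakk> \<Longrightarrow> \<phi> (a i) divides \<phi> (a v)" by auto
  have nz: "\<phi> (a i) \<noteq> \<zero>" using i(2) \<phi>D(5) a(1) by blast
  have "\<exists>q. q \<in> carrier R \<and> (v \<in> J \<longrightarrow> \<phi> (a v) = \<phi> (a i) \<otimes> q)" for v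
  proof (cases "v \<in> J \<and> a v \<noteq> \<zero>")
    case True
    then show ?thesis using i(3)[of v] by (auto elim: dividesE)
  next
    case False
    then show ?thesis using subring_endo_zero[OF A \<phi>] pc by (intro exI[of _ \<zero>]) auto
  qed
  then have "\<forall>v. \<exists>q. q \<in> carrier R \<and> (v \<in> J \<longrightarrow> \<phi> (a v) = \<phi> (a i) \<otimes> q)" by blast
  then obtain q where q: "\<And>v. q v \<in> carrier R" "\<And>v. v \<in> J \<Longrightarrow> \<phi> (a v) = \<phi> (a i) \<otimes> q v"
    unfolding choice_iff by blast
  have qi: "q i = \<one>"
  proof -
    have "\<phi> (a i) \<otimes> q i = \<phi> (a i) \<otimes> \<one>" using q(2)[OF i(1)] pc by simp
    then show ?thesis using m_lcancel[OF nz pc q(1) R.one_closed] by simp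
  qed
  let ?J = "J - {i}"
  have J': "J = insert i ?J" "finite ?J" "i \<notin> ?J" using i J by auto
  have rel: "\<theta> i \<oplus> (\<Oplus>v\<in>?J. q v \<otimes> \<theta> v) = \<zero>" if \<theta>: "\<theta> \<in> semilinear_maps A \<phi>" for \<theta>
  proof -
    have tc: "\<theta> v \<in> carrier R" if "v \<in> J" for v using semilinearD(1)[OF \<theta>] that J by blast
    have "\<zero> = \<theta> (lincomb a J)" unfolding a(2) using semilinear_zero[OF \<theta>] by simp
    also have "\<dots> = (\<Oplus>v\<in>J. \<phi> (a v) \<otimes> \<theta> v)" by (rule semilinear_lincomb[OF \<theta> A \<phi> J a(1)])
    also have "\<dots> = (\<Oplus>v\<in>J. \<phi> (a i) \<otimes> (q v \<otimes> \<theta> v))"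
      by (rule R.finsum_cong') (use q pc tc in \<open>auto simp: R.m_assoc\<close>)
    also have "\<dots> = \<phi> (a i) \<otimes> (\<Oplus>v\<in>J. q v \<otimes> \<theta> v)"
      by (rule R.finsum_rdistr[symmetric]) (use J q(1) pc tc in auto)
    finally have "\<phi> (a i) \<otimes> (\<Oplus>v\<in>J. q v \<otimes> \<theta> v) = \<zero>" by simp
    moreover have "(\<Oplus>v\<in>J. q v \<otimes> \<theta> v) \<in> carrier R" by (rule R.finsum_closed) (use q(1) tc in auto)
    ultimately have "(\<Oplus>v\<in>J. q v \<otimes> \<theta> v) = \<zero>" using integral_iff[OF pc[of i]] nz by simp
    moreover have "(\<Oplus>v\<in>insert i ?J. q v \<otimes> \<theta> v) = q i \<otimes> \<theta> i \<oplus> (\<Oplus>v\<in>?J. q v \<otimes> \<theta> v)"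
      by (rule R.finsum_insert) (use J'(2,3) q(1) tc i in auto)
    ultimately show ?thesis unfolding J'(1)[symmetric] using qi tc[OF i(1)] by simp
  qed
  have "evaluation_spanning A \<phi> ?J"
    unfolding evaluation_spanning_def
  proof
    fix u assume u: "u \<in> carrier W"
    obtain c where c: "\<And>v. c v \<in> carrier R" "\<And>\<theta>. \<theta> \<in> semilinear_maps A \<phi> \<Longrightarrow> \<theta> u = (\<Oplus>v\<in>J. c v \<otimes> \<theta> v)"
      using sp u unfolding evaluation_spanning_def by blast
    \<comment> \<open>Subtracting \<open>c i\<close> times the normalized relation, whose
      coefficient at \<open>i\<close> is one, removes \<open>i\<close>.\<close>
    let ?c = "\<lambda>v. c v \<oplus> \<ominus> c i \<otimes> q v"
    have "\<theta> u = (\<Oplus>v\<in>?J. ?c v \<otimes> \<theta> v)" if \<theta>: "\<theta> \<in> semilinear_maps A \<phi>" for \<theta>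
    proof -
      have tc: "\<theta> v \<in> carrier R" if "v \<in> J" for v using semilinearD(1)[OF \<theta>] that J by blast
      define S where "S = (\<Oplus>v\<in>?J. c v \<otimes> \<theta> v)"
      define Q where "Q = (\<Oplus>v\<in>?J. q v \<otimes> \<theta> v)"
      have Sc: "S \<in> carrier R" "Q \<in> carrier R" unfolding S_def Q_def
        by (rule R.finsum_closed, use c(1) q(1) tc in auto)+
      have "(\<Oplus>v\<in>?J. ?c v \<otimes> \<theta> v) = (\<Oplus>v\<in>?J. c v \<otimes> \<theta> v \<oplus> \<ominus> c i \<otimes> (q v \<otimes> \<theta> v))"
        by (rule R.finsum_cong') (use c(1) q(1) tc in \<open>auto simp: R.l_distr R.m_assoc\<close>)
      also have "\<dots> = S \<oplus> (\<Oplus>v\<in>?J. \<ominus> c i \<otimes> (q v \<otimes> \<theta> v))"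
        unfolding S_def by (rule R.finsum_addf) (use c(1) q(1) tc in auto)
      also have "(\<Oplus>v\<in>?J. \<ominus> c i \<otimes> (q v \<otimes> \<theta> v)) = \<ominus> c i \<otimes> Q"
        unfolding Q_def by (rule R.finsum_rdistr[symmetric]) (use J'(2,3) c(1) q(1) tc in auto)
      finally have 1: "(\<Oplus>v\<in>?J. ?c v \<otimes> \<theta> v) = S \<oplus> \<ominus> c i \<otimes> Q" .
      have "\<theta> u = (\<Oplus>v\<in>insert i ?J. c v \<otimes> \<theta> v)" using c(2)[OF \<theta>] unfolding J'(1)[symmetric] .
      also have "\<dots> = c i \<otimes> \<theta> i \<oplus> S" unfolding S_def by (rule R.finsum_insert) (use J'(2,3) c(1) tc i in auto)
      finally have 2: "\<theta> u = c i \<otimes> \<theta> i \<oplus> S" .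
      have "x \<otimes> t \<oplus> S = (S \<oplus> \<ominus> x \<otimes> Q) \<oplus> x \<otimes> (t \<oplus> Q)"
        if "x \<in> carrier R" "t \<in> carrier R" for x t
        using that Sc by algebra
      from this[OF c(1) tc[OF i(1)]] have "c i \<otimes> \<theta> i \<oplus> S = (S \<oplus> \<ominus> c i \<otimes> Q)"
        unfolding rel[OF \<theta>, folded Q_def] using c(1)[of i] Sc by simp
      then show ?thesis using 1 2 by simp
    qed
    then show "\<exists>c. (\<forall>v. c v \<in> carrier R) \<and> (\<forall>\<theta>\<in>semilinear_maps A \<phi>. \<theta> u = (\<Oplus>v\<in>?J. c v \<otimes> \<theta> v))"
      using c q by (intro exI[of _ ?c]) auto
  qed
  then show ?thesis using i(1) by blast
qed

text \<open>A minimal spanning subset of \<open>V\<close> is independent, since a dependent one can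
  be shrunk. The hypothesis covers every dependent subset because it is not known beforehand which
  of them the elimination meets.\<close>

lemma ex_evaluation_basis:
  assumes A: "subring A R" and \<phi>: "subring_endo A \<phi>"
    and V: "finite V" "V \<subseteq> carrier W" "span_over A V = carrier W"
    and chain: "\<And>J. \<lbrakk>J \<subseteq> V; \<not> independent_over A J\<rbrakk> \<Longrightarrow> \<exists>a. (\<forall>v. a v \<in> A) \<and> lincomb a J = \<zero>\<^bsub>W\<^esub> \<and>
      (\<exists>v\<in>J. a v \<noteq> \<zero>) \<and> divisibility_chain (\<phi> ` (a ` J - {\<zero>}))"
  shows "\<exists>J\<subseteq>V. independent_over A J \<and> evaluation_spanning A \<phi> J"
proof -
  have Ac: "a \<in> A \<Longrightarrow> a \<in> carrier R" for a using subringE(1)[OF A] by blast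
  have "evaluation_spanning A \<phi> V"
    unfolding evaluation_spanning_def
  proof
    fix u assume "u \<in> carrier W"
    then obtain a where a: "\<And>v. a v \<in> A" "u = lincomb a V" using V(3) unfolding span_over_def by blast
    show "\<exists>c. (\<forall>v. c v \<in> carrier R) \<and> (\<forall>\<theta>\<in>semilinear_maps A \<phi>. \<theta> u = (\<Oplus>v\<in>V. c v \<otimes> \<theta> v))"
      using semilinear_lincomb[OF _ A \<phi> V(1,2) a(1)] a subring_endoD(1)[OF \<phi>] Ac
      by (intro exI[of _ "\<lambda>v. \<phi> (a v)"]) auto
  qed
  then have ne: "{J. J \<subseteq> V \<and> evaluation_spanning A \<phi> J} \<noteq> {}" (is "?S \<noteq> {}") by blast
  have "finite ?S" using V(1) by (auto intro: finite_subset[of _ "Pow V"])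
  from finite_has_minimal[OF this ne] have "\<exists>J\<in>?S. \<forall>K\<in>?S. K \<subseteq> J \<longrightarrow> J = K" .
  then obtain J where J: "J \<in> ?S" "\<forall>K\<in>?S. K \<subseteq> J \<longrightarrow> J = K" by (rule bexE)
  have "independent_over A J"
  proof (rule ccontr)
    assume "\<not> independent_over A J"
    then obtain a where a: "\<And>v. a v \<in> A" "lincomb a J = \<zero>\<^bsub>W\<^esub>" "\<exists>v\<in>J. a v \<noteq> \<zero>"
      "divisibility_chain (\<phi> ` (a ` J - {\<zero>}))" using chain[of J] J(1) by blast
    have "\<exists>i\<in>J. evaluation_spanning A \<phi> (J - {i})"
      by (rule evaluation_spanning_remove[OF A \<phi> _ _ _ a]) (use J(1) V finite_subset in auto)
    then obtain i where i: "i \<in> J" "evaluation_spanning A \<phi> (J - {i})" by blast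
    then have "J = J - {i}" using J(1) by (intro J(2)[rule_format]) auto
    then show False using i(1) by blast
  qed
  then show ?thesis using J(1) by blast
qed

section \<open>Endomorphisms and the filtration by values of semilinear maps\<close>

definition linear_endo :: "('c \<Rightarrow> 'c) \<Rightarrow> bool" where
  "linear_endo g \<longleftrightarrow> (\<forall>u\<in>carrier W. g u \<in> carrier W) \<and>
     (\<forall>u\<in>carrier W. \<forall>w\<in>carrier W. g (u \<oplus>\<^bsub>W\<^esub> w) = g u \<oplus>\<^bsub>W\<^esub> g w) \<and>
     (\<forall>a\<in>carrier R. \<forall>u\<in>carrier W. g (a \<odot>\<^bsub>W\<^esub> u) = a \<odot>\<^bsub>W\<^esub> g u)"

lemma linear_endoD:
  assumes "linear_endo g"
  shows "u \<in> carrier W \<Longrightarrow> g u \<in> carrier W"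
    "\<lbrakk>u \<in> carrier W; w \<in> carrier W\<rbrakk> \<Longrightarrow> g (u \<oplus>\<^bsub>W\<^esub> w) = g u \<oplus>\<^bsub>W\<^esub> g w"
    "\<lbrakk>a \<in> carrier R; u \<in> carrier W\<rbrakk> \<Longrightarrow> g (a \<odot>\<^bsub>W\<^esub> u) = a \<odot>\<^bsub>W\<^esub> g u"
  using assms unfolding linear_endo_def by simp_all

lemma linear_endo_smult: "r \<in> carrier R \<Longrightarrow> linear_endo (\<lambda>w. r \<odot>\<^bsub>W\<^esub> w)"
  unfolding linear_endo_def
proof (intro conjI ballI)
  fix a u assume "r \<in> carrier R" "a \<in> carrier R" "u \<in> carrier W"
  then show "r \<odot>\<^bsub>W\<^esub> (a \<odot>\<^bsub>W\<^esub> u) = a \<odot>\<^bsub>W\<^esub> (r \<odot>\<^bsub>W\<^esub> u)"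
    using R.m_comm[of r a] by (simp add: smult_assoc1[symmetric])
qed (simp_all add: smult_r_distr)

text \<open>This stability is what lets endomorphisms act on evaluations. It applies in particular
  to multiplication by scalars of \<open>R\<close> outside \<open>A\<close>.\<close>

lemma semilinear_comp:
  assumes A: "subring A R" and \<theta>: "\<theta> \<in> semilinear_maps A \<phi>" and g: "linear_endo g"
  shows "(\<lambda>w. \<theta> (g w)) \<in> semilinear_maps A \<phi>"
  unfolding semilinear_maps_def using semilinearD[OF \<theta>] linear_endoD[OF g] subringE(1)[OF A]
  by (auto simp: subset_iff)

lemma semilinear_neg:
  assumes \<theta>: "\<theta> \<in> semilinear_maps A \<phi>" and u: "u \<in> carrier W"
  shows "\<theta> (\<ominus>\<^bsub>W\<^esub> u) = \<ominus> \<theta> u"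
proof -
  have "\<theta> (\<ominus>\<^bsub>W\<^esub> u) \<oplus> \<theta> u = \<theta> (\<ominus>\<^bsub>W\<^esub> u \<oplus>\<^bsub>W\<^esub> u)" using semilinearD(2)[OF \<theta>] u by simp
  also have "\<dots> = \<zero>" using u semilinear_zero[OF \<theta>] by (simp add: M.l_neg)
  finally show ?thesis using R.minus_equality semilinearD(1)[OF \<theta>] u by simp
qed

text \<open>The filtration of \<open>W\<close> induced from that of \<open>R\<close> by all
  semilinear maps. Its comparison with the adic filtration of \<open>W\<close> makes matrix entries
  continuous.\<close>

definition small_elements :: "'a set \<Rightarrow> ('a \<Rightarrow> 'a) \<Rightarrow> nat \<Rightarrow> 'c set" where
  "small_elements A \<phi> j = {u \<in> carrier W. \<forall>\<theta>\<in>semilinear_maps A \<phi>. \<theta> u \<in> mpow j}"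

text \<open>Closure under all scalars of \<open>R\<close>, although the maps are semilinear over
  \<open>A\<close> only, holds because multiplying the argument by a scalar yields another
  semilinear map.\<close>

lemma submodule_small_elements:
  assumes A: "subring A R"
  shows "submodule (small_elements A \<phi> j) R W"
proof (rule submoduleI)
  interpret J: ideal "mpow j" R by (rule ideal_mpow)
  show "small_elements A \<phi> j \<subseteq> carrier W" unfolding small_elements_def by blast
  have "\<theta> \<zero>\<^bsub>W\<^esub> \<in> mpow j" if "\<theta> \<in> semilinear_maps A \<phi>" for \<theta>
    unfolding semilinear_zero[OF that] by (rule J.zero_closed)
  then show "\<zero>\<^bsub>W\<^esub> \<in> small_elements A \<phi> j" unfolding small_elements_def by simp
  show "\<ominus>\<^bsub>W\<^esub> u \<in> small_elements A \<phi> j" if "u \<in> small_elements A \<phi> j" for u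
  proof -
    have u: "u \<in> carrier W" using that unfolding small_elements_def by blast
    have "\<theta> (\<ominus>\<^bsub>W\<^esub> u) \<in> mpow j" if \<theta>: "\<theta> \<in> semilinear_maps A \<phi>" for \<theta>
      unfolding semilinear_neg[OF \<theta> u]
      by (rule J.a_inv_closed) (use \<open>u \<in> small_elements A \<phi> j\<close> \<theta> in \<open>simp add: small_elements_def\<close>)
    then show ?thesis using u unfolding small_elements_def by simp
  qed
  show "u \<oplus>\<^bsub>W\<^esub> w \<in> small_elements A \<phi> j" if "u \<in> small_elements A \<phi> j" "w \<in> small_elements A \<phi> j" for u w
  proof -
    have c: "u \<in> carrier W" "w \<in> carrier W" using that unfolding small_elements_def by blast+
    have "\<theta> (u \<oplus>\<^bsub>W\<^esub> w) \<in> mpow j" if \<theta>: "\<theta> \<in> semilinear_maps A \<phi>" for \<theta>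
      unfolding semilinearD(2)[OF \<theta> c]
      by (rule J.a_closed)
        (use \<open>u \<in> small_elements A \<phi> j\<close> \<open>w \<in> small_elements A \<phi> j\<close> \<theta> in \<open>simp_all add: small_elements_def\<close>)
    then show ?thesis using c unfolding small_elements_def by simp
  qed
  show "r \<odot>\<^bsub>W\<^esub> u \<in> small_elements A \<phi> j" if r: "r \<in> carrier R" and u: "u \<in> small_elements A \<phi> j" for r u
  proof -
    have "\<theta> (r \<odot>\<^bsub>W\<^esub> u) \<in> mpow j" if \<theta>: "\<theta> \<in> semilinear_maps A \<phi>" for \<theta>
    proof -
      have "\<forall>\<theta>\<in>semilinear_maps A \<phi>. \<theta> u \<in> mpow j" using u unfolding small_elements_def by blast
      from bspec[OF this semilinear_comp[OF A \<theta> linear_endo_smult[OF r]]] show ?thesis .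
    qed
    then show ?thesis using u r unfolding small_elements_def by simp
  qed
qed

text \<open>The scalars that raise the filtration index by one form an ideal, because the filtration
  consists of submodules. It contains \<open>Y\<close>, since a factor \<open>y\<close> comes out of
  a semilinear map as \<open>\<phi> y\<close>, an element of the maximal ideal.\<close>

lemma small_elements_step:
  assumes A: "subring A R" and Y: "Y \<subseteq> A" "\<phi> ` Y \<subseteq> max_ideal R"
    and k: "k \<in> Idl Y" and u: "u \<in> small_elements A \<phi> j"
  shows "k \<odot>\<^bsub>W\<^esub> u \<in> small_elements A \<phi> (Suc j)"
proof -
  let ?U = "small_elements A \<phi>"
  note S = submoduleE[OF submodule_small_elements[OF A, of \<phi> "Suc j"]]
  have Uc: "u \<in> carrier W" if "u \<in> ?U j" for u using that unfolding small_elements_def by blast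
  define K where "K = {k \<in> carrier R. \<forall>u\<in>?U j. k \<odot>\<^bsub>W\<^esub> u \<in> ?U (Suc j)}"
  have "\<zero>\<^bsub>W\<^esub> \<in> ?U (Suc j)"
    using subgroup.one_closed[OF submodule.axioms(1)[OF submodule_small_elements[OF A]]] by simp
  then have "subgroup K (add_monoid R)"
    by (intro R.add.subgroupI)
      (use S Uc in \<open>auto simp: K_def smult_l_distr smult_l_minus a_inv_def[symmetric] intro!: exI[of _ \<zero>]\<close>)
  then have "ideal K R"
  proof (rule idealI[OF R.ring_axioms])
    fix a x assume a: "a \<in> K" and x: "x \<in> carrier R"
    have "(x \<otimes> a) \<odot>\<^bsub>W\<^esub> u \<in> ?U (Suc j)" if "u \<in> ?U j" for u
      using a x that Uc[OF that] S(4) by (simp add: K_def smult_assoc1)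
    then show "x \<otimes> a \<in> K" using a x by (simp add: K_def)
    then show "a \<otimes> x \<in> K" using a x by (simp add: K_def R.m_comm)
  qed
  moreover have "Y \<subseteq> K"
  proof
    fix y assume y: "y \<in> Y"
    have "y \<odot>\<^bsub>W\<^esub> u \<in> ?U (Suc j)" if u: "u \<in> ?U j" for u
    proof -
      have "\<theta> (y \<odot>\<^bsub>W\<^esub> u) \<in> mpow (Suc j)" if \<theta>: "\<theta> \<in> semilinear_maps A \<phi>" for \<theta>
      proof -
        have "\<theta> (y \<odot>\<^bsub>W\<^esub> u) = \<phi> y \<otimes> \<theta> u" using semilinearD(3)[OF \<theta>] y Y(1) Uc[OF u] by blast
        moreover have "\<theta> u \<in> mpow j" using u \<theta> unfolding small_elements_def by blast
        ultimately show ?thesis using mpow_SucI y Y(2) by auto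
      qed
      moreover have "y \<in> carrier R" using y Y(1) subringE(1)[OF A] by blast
      ultimately show ?thesis using Uc[OF u] unfolding small_elements_def by simp
    qed
    then show "y \<in> K" using y Y(1) subringE(1)[OF A] unfolding K_def by blast
  qed
  ultimately have "Idl Y \<subseteq> K" by (rule genideal_minimal)
  then show ?thesis using k u unfolding K_def by blast
qed

text \<open>\<open>mpow (s * j)\<close> is the \<open>j\<close>-th power of \<open>mpow s\<close>,
  and each factor, lying in \<open>Idl Y\<close>, raises the index by one.\<close>

lemma ideal_smult_small:
  assumes A: "subring A R" and Y: "Y \<subseteq> A" "\<phi> ` Y \<subseteq> max_ideal R" and s: "mpow s \<subseteq> Idl Y"
  shows "ideal_smult R W (mpow (s * j)) \<subseteq> small_elements A \<phi> j"
proof -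
  let ?U = "small_elements A \<phi>"
  have "r \<odot>\<^bsub>W\<^esub> w \<in> ?U j" if "r \<in> mpow (s * j)" "w \<in> carrier W" for r w
    using that
  proof (induction j arbitrary: r w)
    case 0
    then show ?case using semilinearD(1) by (simp add: small_elements_def)
  next
    case (Suc j)
    note S = submoduleE[OF submodule_small_elements[OF A, of \<phi> "Suc j"]]
    have "mpow (s * Suc j) = ideal_prod R (mpow (s * j)) (mpow s)"
      unfolding mpow_add[symmetric] by (simp add: add.commute)
    with Suc.prems(1) have "r \<in> ideal_prod R (mpow (s * j)) (mpow s)" by simp
    then show ?case
    proof induction
      case (prod i k)
      have c: "i \<in> carrier R" "k \<in> carrier R" using prod mpow_carr by auto
      have "(i \<otimes> k) \<odot>\<^bsub>W\<^esub> w = k \<odot>\<^bsub>W\<^esub> (i \<odot>\<^bsub>W\<^esub> w)"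
        using c Suc.prems(2) R.m_comm[OF c] by (simp add: smult_assoc1)
      then show ?case using small_elements_step[OF A Y _ Suc.IH[OF prod(1) Suc.prems(2)]] prod(2) s by auto
    next
      case (sum r1 r2)
      have "r1 \<in> carrier R" "r2 \<in> carrier R"
        using sum ideal_prod_in_carrier[OF ideal_mpow ideal_mpow] by blast+
      then show ?case using sum S(5) Suc.prems(2) by (simp add: smult_l_distr)
    qed
  qed
  then show ?thesis unfolding ideal_smult_def submodule_span_def
    using submodule_small_elements[OF A, of \<phi> j] by blast
qed

text \<open>The elements \<open>w k\<close> and the maps \<open>\<gamma> i\<close> act as basis and
  dual basis of the free base change, although \<open>W\<close> itself need not be free. Accordingly
  the values \<open>\<gamma> i (g (w k))\<close> form the matrix of \<open>g\<close>.\<close>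

theorem ex_linearization:
  assumes p: "Factorial_Ring.prime p"
  obtains n :: nat and w \<gamma> where "\<And>i. i < n \<Longrightarrow> w i \<in> carrier W"
    "\<And>i u. \<lbrakk>i < n; u \<in> carrier W\<rbrakk> \<Longrightarrow> \<gamma> i u \<in> carrier R"
    "\<And>i u v. \<lbrakk>i < n; u \<in> carrier W; v \<in> carrier W\<rbrakk> \<Longrightarrow> \<gamma> i (u \<oplus>\<^bsub>W\<^esub> v) = \<gamma> i u \<oplus> \<gamma> i v"
    "\<And>g i u. \<lbrakk>linear_endo g; i < n; u \<in> carrier W\<rbrakk> \<Longrightarrow> \<gamma> i (g u) = (\<Oplus>k\<in>{..<n}. \<gamma> i (g (w k)) \<otimes> \<gamma> k u)"
    "\<And>i j. \<lbrakk>i < n; j < n\<rbrakk> \<Longrightarrow> \<gamma> i (w j) = (if i = j then \<one> else \<zero>)"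
    "\<And>u. \<lbrakk>u \<in> carrier W; \<And>i. i < n \<Longrightarrow> \<gamma> i u = \<zero>\<rbrakk> \<Longrightarrow> u = \<zero>\<^bsub>W\<^esub>"
    "\<And>j. \<exists>m. \<forall>u\<in>ideal_smult R W (mpow m). \<forall>i<n. \<gamma> i u \<in> mpow j"
proof (rule coefficient_ring[OF p])
  fix A Y s E
  assume A: "subring A R" and Y: "finite Y" "Y \<subseteq> A" "mpow s \<subseteq> Idl Y" and E: "finite E" "E \<subseteq> carrier R"
    "\<And>r. r \<in> carrier R \<Longrightarrow> \<exists>a. (\<forall>e. a e \<in> A) \<and> r = (\<Oplus>e\<in>E. a e \<otimes> e)"
    and endo: "\<And>F. \<lbrakk>finite F; F \<subseteq> A; \<zero> \<notin> F\<rbrakk> \<Longrightarrow>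
       \<exists>\<phi>. subring_endo A \<phi> \<and> \<phi> ` Y \<subseteq> max_ideal R \<and> divisibility_chain (\<phi> ` F)"
  have Ac: "a \<in> A \<Longrightarrow> a \<in> carrier R" for a using subringE(1)[OF A] by blast
  obtain V where V: "finite V" "V \<subseteq> carrier W" "span_over A V = carrier W"
    using subring_generation[OF A E fg] by blast
  \<comment> \<open>One relation is fixed in advance for every dependent subset, because
    \<open>\<phi>\<close> has to be chosen once and must make the coefficients of all of them
    comparable.\<close>
  let ?D = "{J. J \<subseteq> V \<and> \<not> independent_over A J}"
  have "\<forall>J\<in>?D. \<exists>a. (\<forall>v. a v \<in> A) \<and> lincomb a J = \<zero>\<^bsub>W\<^esub> \<and> (\<exists>v\<in>J. a v \<noteq> \<zero>)"
    unfolding independent_over_def by blast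
  then obtain a where a: "\<forall>J\<in>?D. (\<forall>v. a J v \<in> A) \<and> lincomb (a J) J = \<zero>\<^bsub>W\<^esub> \<and> (\<exists>v\<in>J. a J v \<noteq> \<zero>)"
    unfolding bchoice_iff by blast
  define F where "F = (\<Union>J\<in>?D. a J ` J - {\<zero>})"
  have "finite ?D" using V(1) by (auto intro: finite_subset[of _ "Pow V"])
  moreover have "finite (a J ` J - {\<zero>})" if "J \<in> ?D" for J
    using that finite_subset[OF _ V(1), of J] by simp
  ultimately have "finite F" unfolding F_def by (rule finite_UN_I)
  moreover have "F \<subseteq> A" "\<zero> \<notin> F" using a unfolding F_def by auto
  ultimately obtain \<phi> where \<phi>: "subring_endo A \<phi>" "\<phi> ` Y \<subseteq> max_ideal R" "divisibility_chain (\<phi> ` F)"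
    using endo[of F] by blast
  let ?\<Theta> = "semilinear_maps A \<phi>"
  have "\<exists>J\<subseteq>V. independent_over A J \<and> evaluation_spanning A \<phi> J"
  proof (rule ex_evaluation_basis[OF A \<phi>(1) V])
    fix J assume J: "J \<subseteq> V" "\<not> independent_over A J"
    have "a J ` J - {\<zero>} \<subseteq> F" unfolding F_def using J by blast
    then have "divisibility_chain (\<phi> ` (a J ` J - {\<zero>}))"
      using \<phi>(3) unfolding divisibility_chain_def by blast
    moreover have "(\<forall>v. a J v \<in> A) \<and> lincomb (a J) J = \<zero>\<^bsub>W\<^esub> \<and> (\<exists>v\<in>J. a J v \<noteq> \<zero>)"
      by (rule bspec[OF a]) (use J in simp)
    ultimately show "\<exists>a. (\<forall>v. a v \<in> A) \<and> lincomb a J = \<zero>\<^bsub>W\<^esub> \<and> (\<exists>v\<in>J. a v \<noteq> \<zero>) \<and> divisibility_chain (\<phi> ` (a ` J - {\<zero>}))"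
      by (intro exI[of _ "a J"]) simp
  qed
  then obtain J where J: "J \<subseteq> V" "independent_over A J" "evaluation_spanning A \<phi> J" by blast
  have Jf: "finite J" "J \<subseteq> carrier W" using J(1) V finite_subset by auto
  have "\<forall>u\<in>carrier W. \<exists>c. (\<forall>v. c v \<in> carrier R) \<and> (\<forall>\<theta>\<in>?\<Theta>. \<theta> u = (\<Oplus>v\<in>J. c v \<otimes> \<theta> v))"
    using J(3) unfolding evaluation_spanning_def .
  then obtain \<kappa> where \<kappa>: "\<forall>u\<in>carrier W. (\<forall>v. \<kappa> u v \<in> carrier R) \<and> (\<forall>\<theta>\<in>?\<Theta>. \<theta> u = (\<Oplus>v\<in>J. \<kappa> u v \<otimes> \<theta> v))"
    unfolding bchoice_iff by blast
  have \<kappa>c: "\<kappa> u v \<in> carrier R" if "u \<in> carrier W" for u v using \<kappa> that by blast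
  have \<kappa>e: "\<theta> u = (\<Oplus>v\<in>J. \<kappa> u v \<otimes> \<theta> v)" if "u \<in> carrier W" "\<theta> \<in> ?\<Theta>" for u \<theta> using \<kappa> that by blast
  obtain Z \<eta> where dual: "J \<subseteq> Z \<and> (\<forall>y\<in>Z. \<eta> y \<in> ?\<Theta> \<and> \<eta> y y \<noteq> \<zero> \<and> (\<forall>v\<in>Z. v \<noteq> y \<longrightarrow> \<eta> y v = \<zero>)) \<and>
      (\<forall>u\<in>carrier W. (\<forall>y\<in>Z. \<eta> y u = \<zero>) \<longrightarrow> u = \<zero>\<^bsub>W\<^esub>)"
    using ex_dual_maps[OF A \<phi>(1) V J(1,2)] by (elim exE)
  then have Z: "J \<subseteq> Z" and \<eta>: "\<And>y. y \<in> Z \<Longrightarrow> \<eta> y \<in> ?\<Theta>" "\<And>y. y \<in> Z \<Longrightarrow> \<eta> y y \<noteq> \<zero>"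
    "\<And>y v. \<lbrakk>y \<in> Z; v \<in> Z; v \<noteq> y\<rbrakk> \<Longrightarrow> \<eta> y v = \<zero>"
    "\<And>u. \<lbrakk>u \<in> carrier W; \<forall>y\<in>Z. \<eta> y u = \<zero>\<rbrakk> \<Longrightarrow> u = \<zero>\<^bsub>W\<^esub>"
    by simp_all
  have \<theta>c: "\<theta> v \<in> carrier R" if "\<theta> \<in> ?\<Theta>" "v \<in> J" for \<theta> v using semilinearD(1)[OF that(1)] that(2) Jf by blast
  \<comment> \<open>Testing with the dual map at \<open>v\<close> isolates the coefficient at
    \<open>v\<close>, up to the nonzero factor \<open>\<eta> v v\<close>.\<close>
  have uniq: "c v = \<kappa> u v"
    if u: "u \<in> carrier W" and c: "\<And>v. v \<in> J \<Longrightarrow> c v \<in> carrier R"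
      and e: "\<And>\<theta>. \<theta> \<in> ?\<Theta> \<Longrightarrow> \<theta> u = (\<Oplus>v\<in>J. c v \<otimes> \<theta> v)" and v: "v \<in> J" for u c v
  proof -
    have pick: "(\<Oplus>x\<in>J. b x \<otimes> \<eta> v x) = b v \<otimes> \<eta> v v" if b: "\<And>x. x \<in> J \<Longrightarrow> b x \<in> carrier R" for b
    proof -
      have "(\<Oplus>x\<in>J. b x \<otimes> \<eta> v x) = (\<Oplus>x\<in>J. if v = x then b x \<otimes> \<eta> v x else \<zero>)"
      proof (rule R.finsum_cong')
        have vZ: "v \<in> Z" using v Z by blast
        have "\<eta> v x = \<zero>" if "x \<in> J" "x \<noteq> v" for x using \<eta>(3)[OF vZ _ that(2)] that(1) Z by blast
        then show "b x \<otimes> \<eta> v x = (if v = x then b x \<otimes> \<eta> v x else \<zero>)" if "x \<in> J" for x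
          using b[OF that] that by simp
        show "(\<lambda>x. if v = x then b x \<otimes> \<eta> v x else \<zero>) \<in> J \<rightarrow> carrier R"
          using b \<theta>c[OF \<eta>(1)[OF vZ]] by auto
      qed simp
      also have "\<dots> = b v \<otimes> \<eta> v v"
        by (rule R.finsum_singleton) (use b \<theta>c[OF \<eta>(1)] v Z Jf in auto)
      finally show ?thesis .
    qed
    have vZ: "v \<in> Z" using v Z by blast
    have "c v \<otimes> \<eta> v v = \<kappa> u v \<otimes> \<eta> v v"
      using e[OF \<eta>(1)[OF vZ]] \<kappa>e[OF u \<eta>(1)[OF vZ]] pick[of c] pick[of "\<kappa> u"] c \<kappa>c[OF u] by simp
    then show ?thesis using m_rcancel[OF \<eta>(2)[OF vZ] \<theta>c[OF \<eta>(1)[OF vZ] v] c[OF v] \<kappa>c[OF u]] by simp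
  qed
  \<comment> \<open>By uniqueness the coordinates are semilinear maps themselves. So a coordinate
    composed with an endomorphism can be expanded by \<open>\<kappa>e\<close>, and that expansion is
    the matrix formula.\<close>
  have \<kappa>\<Theta>: "(\<lambda>u. \<kappa> u v) \<in> ?\<Theta>" if v: "v \<in> J" for v
    unfolding semilinear_maps_def
  proof (intro CollectI conjI ballI)
    show "\<kappa> (u \<oplus>\<^bsub>W\<^esub> w) v = \<kappa> u v \<oplus> \<kappa> w v" if u: "u \<in> carrier W" and w: "w \<in> carrier W" for u w
    proof (rule uniq[symmetric, OF _ _ _ v])
      fix \<theta> assume \<theta>: "\<theta> \<in> ?\<Theta>"
      have "(\<Oplus>v\<in>J. (\<kappa> u v \<oplus> \<kappa> w v) \<otimes> \<theta> v) = (\<Oplus>v\<in>J. \<kappa> u v \<otimes> \<theta> v \<oplus> \<kappa> w v \<otimes> \<theta> v)"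
        by (rule R.finsum_cong') (use \<kappa>c u w \<theta>c[OF \<theta>] in \<open>auto simp: R.l_distr\<close>)
      also have "\<dots> = \<theta> u \<oplus> \<theta> w"
        unfolding \<kappa>e[OF u \<theta>] \<kappa>e[OF w \<theta>] by (rule R.finsum_addf) (use \<kappa>c u w \<theta>c[OF \<theta>] in auto)
      finally show "\<theta> (u \<oplus>\<^bsub>W\<^esub> w) = (\<Oplus>v\<in>J. (\<kappa> u v \<oplus> \<kappa> w v) \<otimes> \<theta> v)"
        using semilinearD(2)[OF \<theta> u w] by simp
    qed (use u w \<kappa>c in auto)
    show "\<kappa> (a \<odot>\<^bsub>W\<^esub> u) v = \<phi> a \<otimes> \<kappa> u v" if a: "a \<in> A" and u: "u \<in> carrier W" for a u
    proof (rule uniq[symmetric, OF _ _ _ v])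
      have ac: "\<phi> a \<in> carrier R" "a \<in> carrier R" using a Ac subring_endoD(1)[OF \<phi>(1)] by auto
      then show "a \<odot>\<^bsub>W\<^esub> u \<in> carrier W" "\<And>v. v \<in> J \<Longrightarrow> \<phi> a \<otimes> \<kappa> u v \<in> carrier R" using u \<kappa>c by auto
      fix \<theta> assume \<theta>: "\<theta> \<in> ?\<Theta>"
      have "(\<Oplus>v\<in>J. \<phi> a \<otimes> \<kappa> u v \<otimes> \<theta> v) = (\<Oplus>v\<in>J. \<phi> a \<otimes> (\<kappa> u v \<otimes> \<theta> v))"
        by (rule R.finsum_cong') (use \<kappa>c u ac \<theta>c[OF \<theta>] in \<open>auto simp: R.m_assoc\<close>)
      also have "\<dots> = \<phi> a \<otimes> \<theta> u"
        unfolding \<kappa>e[OF u \<theta>] by (rule R.finsum_rdistr[symmetric]) (use Jf \<kappa>c u ac \<theta>c[OF \<theta>] in auto)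
      finally show "\<theta> (a \<odot>\<^bsub>W\<^esub> u) = (\<Oplus>v\<in>J. \<phi> a \<otimes> \<kappa> u v \<otimes> \<theta> v)"
        using semilinearD(3)[OF \<theta> a u] by simp
    qed
  qed (use \<kappa>c in auto)
  obtain n w where w: "bij_betw w {..<n::nat} J"
    using ex_bij_betw_nat_finite[OF Jf(1)] by (auto simp: lessThan_atLeast0)
  have wJ: "w i \<in> J" if "i < n" for i using w that by (auto simp: bij_betw_def)
  have reindex: "(\<Oplus>v\<in>J. f v) = (\<Oplus>k\<in>{..<n}. f (w k))" if "\<And>v. v \<in> J \<Longrightarrow> f v \<in> carrier R" for f
  proof -
    have "(\<Oplus>v\<in>w ` {..<n}. f v) = (\<Oplus>k\<in>{..<n}. f (w k))"
      by (rule R.finsum_reindex) (use w that in \<open>auto simp: bij_betw_def\<close>)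
    then show ?thesis using w by (simp add: bij_betw_def)
  qed
  define \<gamma> where "\<gamma> i u = \<kappa> u (w i)" for i u
  have \<gamma>: "(\<lambda>u. \<gamma> i u) \<in> ?\<Theta>" if "i < n" for i unfolding \<gamma>_def by (rule \<kappa>\<Theta>[OF wJ[OF that]])
  show thesis
  proof (rule that[of n w \<gamma>])
    show "w i \<in> carrier W" if "i < n" for i using wJ[OF that] Jf by blast
    show "\<gamma> i u \<in> carrier R" if "i < n" "u \<in> carrier W" for i u using semilinearD(1)[OF \<gamma>] that by blast
    show "\<gamma> i (u \<oplus>\<^bsub>W\<^esub> v) = \<gamma> i u \<oplus> \<gamma> i v" if "i < n" "u \<in> carrier W" "v \<in> carrier W" for i u v
      using semilinearD(2)[OF \<gamma>] that by blast
    show "\<gamma> i (g u) = (\<Oplus>k\<in>{..<n}. \<gamma> i (g (w k)) \<otimes> \<gamma> k u)" if g: "linear_endo g" and i: "i < n" and u: "u \<in> carrier W" for g i u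
    proof -
      have gv: "\<gamma> i (g v) \<in> carrier R" if "v \<in> J" for v
        using semilinearD(1)[OF \<gamma>[OF i]] linear_endoD(1)[OF g] that Jf by blast
      have "\<gamma> i (g u) = (\<Oplus>v\<in>J. \<kappa> u v \<otimes> \<gamma> i (g v))"
        by (rule \<kappa>e[OF u semilinear_comp[OF A \<gamma>[OF i] g]])
      also have "\<dots> = (\<Oplus>k\<in>{..<n}. \<kappa> u (w k) \<otimes> \<gamma> i (g (w k)))"
        by (rule reindex) (use \<kappa>c[OF u] gv in auto)
      also have "\<dots> = (\<Oplus>k\<in>{..<n}. \<gamma> i (g (w k)) \<otimes> \<gamma> k u)"
        by (rule R.finsum_cong') (use \<kappa>c[OF u] gv wJ in \<open>auto simp: \<gamma>_def R.m_comm\<close>)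
      finally show ?thesis .
    qed
    show "\<gamma> i (w j) = (if i = j then \<one> else \<zero>)" if i: "i < n" and j: "j < n" for i j
    proof -
      have jW: "w j \<in> carrier W" using wJ[OF j] Jf by blast
      have "(if w i = w j then \<one> else \<zero>) = \<kappa> (w j) (w i)"
      proof (rule uniq[of "w j" "\<lambda>v. if v = w j then \<one> else \<zero>" "w i", OF jW _ _ wJ[OF i]])
        fix \<theta> assume \<theta>: "\<theta> \<in> ?\<Theta>"
        have "(\<Oplus>v\<in>J. (if v = w j then \<one> else \<zero>) \<otimes> \<theta> v) = (\<Oplus>v\<in>J. if w j = v then \<theta> v else \<zero>)"
          by (rule R.finsum_cong') (use \<theta>c[OF \<theta>] in auto)
        also have "\<dots> = \<theta> (w j)" by (rule R.finsum_singleton) (use \<theta>c[OF \<theta>] wJ[OF j] Jf in auto)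
        finally show "\<theta> (w j) = (\<Oplus>v\<in>J. (if v = w j then \<one> else \<zero>) \<otimes> \<theta> v)" by simp
      qed simp
      moreover have "w i = w j \<longleftrightarrow> i = j" using w i j by (auto simp: bij_betw_def inj_on_def)
      ultimately show ?thesis unfolding \<gamma>_def by simp
    qed
    \<comment> \<open>Vanishing coordinates force every semilinear map to vanish at
      \<open>u\<close>, in particular the separating maps \<open>\<eta>\<close>.\<close>
    show "u = \<zero>\<^bsub>W\<^esub>" if u: "u \<in> carrier W" and z: "\<And>i. i < n \<Longrightarrow> \<gamma> i u = \<zero>" for u
    proof (rule \<eta>(4)[OF u], rule ballI)
      fix y assume y: "y \<in> Z"
      have "\<kappa> u v = \<zero>" if "v \<in> J" for v using z that w unfolding \<gamma>_def bij_betw_def by auto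
      then have "(\<Oplus>v\<in>J. \<kappa> u v \<otimes> \<eta> y v) = \<zero>"
        using \<theta>c[OF \<eta>(1)[OF y]] by (intro R.add.finprod_one_eqI) auto
      then show "\<eta> y u = \<zero>" using \<kappa>e[OF u \<eta>(1)[OF y]] by simp
    qed
    show "\<exists>m. \<forall>u\<in>ideal_smult R W (mpow m). \<forall>i<n. \<gamma> i u \<in> mpow j" for j
      using ideal_smult_small[OF A Y(2) \<phi>(2) Y(3), of j] \<gamma> unfolding small_elements_def
      by (intro exI[of _ "s * j"]) blast
  qed
qed

section \<open>Compactness of the automorphism group\<close>

definition level :: "nat \<Rightarrow> 'c set" where
  "level i = ideal_smult R W (mpow i)"

lemma submodule_level: "submodule (level i) R W"
proof -
  let ?A = "{a \<odot>\<^bsub>W\<^esub> w | a w. a \<in> mpow i \<and> w \<in> carrier W}"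
  have A: "?A \<subseteq> carrier W" using mpow_carr by auto
  show ?thesis unfolding level_def ideal_smult_def submodule_span_def
  proof (rule submoduleI)
    show "\<Inter>{N. submodule N R W \<and> ?A \<subseteq> N} \<subseteq> carrier W" using carrier_is_submodule A by blast
    show "\<zero>\<^bsub>W\<^esub> \<in> \<Inter>{N. submodule N R W \<and> ?A \<subseteq> N}"
      using subgroup.one_closed[OF submodule.axioms(1)] by fastforce
    fix x assume x: "x \<in> \<Inter>{N. submodule N R W \<and> ?A \<subseteq> N}"
    show "\<ominus>\<^bsub>W\<^esub> x \<in> \<Inter>{N. submodule N R W \<and> ?A \<subseteq> N}"
      using x by (auto intro: submoduleE(3))
    show "a \<odot>\<^bsub>W\<^esub> x \<in> \<Inter>{N. submodule N R W \<and> ?A \<subseteq> N}" if "a \<in> carrier R" for a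
      using x that by (auto intro: submoduleE(4))
    show "x \<oplus>\<^bsub>W\<^esub> y \<in> \<Inter>{N. submodule N R W \<and> ?A \<subseteq> N}"
      if "y \<in> \<Inter>{N. submodule N R W \<and> ?A \<subseteq> N}" for y
      using x that by (auto intro: submoduleE(5))
  qed
qed

lemma level_smult: "\<lbrakk>a \<in> mpow i; w \<in> carrier W\<rbrakk> \<Longrightarrow> a \<odot>\<^bsub>W\<^esub> w \<in> level i"
  unfolding level_def ideal_smult_def submodule_span_def by blast

lemma level_minimal:
  assumes "submodule N R W" "\<And>a w. \<lbrakk>a \<in> mpow i; w \<in> carrier W\<rbrakk> \<Longrightarrow> a \<odot>\<^bsub>W\<^esub> w \<in> N"
  shows "level i \<subseteq> N"
  unfolding level_def ideal_smult_def submodule_span_def using assms by blast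

lemma level_zero: "\<zero>\<^bsub>W\<^esub> \<in> level i"
  using subgroup.one_closed[OF submodule.axioms(1)[OF submodule_level]] by simp

lemmas levelE = submoduleE[OF submodule_level]

lemma level_mono: "i \<le> j \<Longrightarrow> level j \<subseteq> level i"
  by (rule level_minimal[OF submodule_level]) (use level_smult mpow_mono in blast)

definition near :: "nat \<Rightarrow> 'c \<Rightarrow> 'c \<Rightarrow> bool" where
  "near i u w \<longleftrightarrow> u \<in> carrier W \<and> w \<in> carrier W \<and> u \<ominus>\<^bsub>W\<^esub> w \<in> level i"

lemma near_refl: "u \<in> carrier W \<Longrightarrow> near i u u"
  unfolding near_def using level_zero by (simp add: M.minus_eq M.r_neg)

lemma near_sym:
  assumes "near i u w"
  shows "near i w u"
proof -
  have c: "u \<in> carrier W" "w \<in> carrier W" using assms unfolding near_def by auto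
  have "w \<ominus>\<^bsub>W\<^esub> u = \<ominus>\<^bsub>W\<^esub> (u \<ominus>\<^bsub>W\<^esub> w)" using c by (simp add: M.minus_eq M.minus_add M.a_comm)
  then show ?thesis using assms levelE(3) unfolding near_def by simp
qed

lemma near_trans:
  assumes "near i u w" "near i w x"
  shows "near i u x"
proof -
  have c: "u \<in> carrier W" "w \<in> carrier W" "x \<in> carrier W" using assms unfolding near_def by auto
  have "u \<ominus>\<^bsub>W\<^esub> x = (u \<ominus>\<^bsub>W\<^esub> w) \<oplus>\<^bsub>W\<^esub> (w \<ominus>\<^bsub>W\<^esub> x)" using c by (simp add: M.minus_eq M.a_assoc M.r_neg1)
  then show ?thesis using assms levelE(5) unfolding near_def by simp
qed

lemma near_add:
  assumes "near i u u'" "near i w w'"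
  shows "near i (u \<oplus>\<^bsub>W\<^esub> w) (u' \<oplus>\<^bsub>W\<^esub> w')"
proof -
  have c: "u \<in> carrier W" "w \<in> carrier W" "u' \<in> carrier W" "w' \<in> carrier W" using assms unfolding near_def by auto
  have "(u \<oplus>\<^bsub>W\<^esub> w) \<ominus>\<^bsub>W\<^esub> (u' \<oplus>\<^bsub>W\<^esub> w') = (u \<ominus>\<^bsub>W\<^esub> u') \<oplus>\<^bsub>W\<^esub> (w \<ominus>\<^bsub>W\<^esub> w')"
    using c by (simp add: M.minus_eq M.minus_add M.a_ac)
  then show ?thesis using assms levelE(5) unfolding near_def by simp
qed

lemma linear_endo_minus:
  assumes g: "linear_endo g" and c: "u \<in> carrier W" "w \<in> carrier W"
  shows "g (u \<ominus>\<^bsub>W\<^esub> w) = g u \<ominus>\<^bsub>W\<^esub> g w"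
proof -
  have "u \<ominus>\<^bsub>W\<^esub> w = u \<oplus>\<^bsub>W\<^esub> (\<ominus> \<one>) \<odot>\<^bsub>W\<^esub> w" using c by (simp add: M.minus_eq smult_l_minus)
  then have "g (u \<ominus>\<^bsub>W\<^esub> w) = g u \<oplus>\<^bsub>W\<^esub> (\<ominus> \<one>) \<odot>\<^bsub>W\<^esub> g w" using linear_endoD[OF g] c by simp
  then show ?thesis using linear_endoD(1)[OF g] c by (simp add: M.minus_eq smult_l_minus)
qed

lemma linear_endo_level:
  assumes g: "linear_endo g"
  shows "level i \<subseteq> {u \<in> carrier W. g u \<in> level i}"
proof (rule level_minimal)
  note gD = linear_endoD[OF g]
  show "submodule {u \<in> carrier W. g u \<in> level i} R W"
  proof (rule submoduleI)
    have "g \<zero>\<^bsub>W\<^esub> = \<zero>\<^bsub>W\<^esub>" using gD(3)[of \<zero> "\<zero>\<^bsub>W\<^esub>"] gD(1)[of "\<zero>\<^bsub>W\<^esub>"] by simp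
    then show "\<zero>\<^bsub>W\<^esub> \<in> {u \<in> carrier W. g u \<in> level i}" using level_zero by simp
    show "\<ominus>\<^bsub>W\<^esub> u \<in> {u \<in> carrier W. g u \<in> level i}" if "u \<in> {u \<in> carrier W. g u \<in> level i}" for u
    proof -
      have u: "u \<in> carrier W" "g u \<in> level i" using that by auto
      have "\<ominus>\<^bsub>W\<^esub> u = (\<ominus> \<one>) \<odot>\<^bsub>W\<^esub> u" using u by (simp add: smult_l_minus)
      then have "g (\<ominus>\<^bsub>W\<^esub> u) = (\<ominus> \<one>) \<odot>\<^bsub>W\<^esub> g u" using gD(3) u by simp
      then show ?thesis using u levelE(4)[of "\<ominus> \<one>"] by simp
    qed
  qed (use gD levelE in auto)
  show "a \<odot>\<^bsub>W\<^esub> w \<in> {u \<in> carrier W. g u \<in> level i}" if "a \<in> mpow i" "w \<in> carrier W" for a w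
    using that gD level_smult mpow_carr by simp
qed

lemma near_endo: "\<lbrakk>linear_endo g; near i u w\<rbrakk> \<Longrightarrow> near i (g u) (g w)"
  using linear_endo_level[of g i] linear_endo_minus[of g u w] linear_endoD(1)[of g] unfolding near_def by auto

lemma near_smult: "\<lbrakk>a \<in> carrier R; near i u w\<rbrakk> \<Longrightarrow> near i (a \<odot>\<^bsub>W\<^esub> u) (a \<odot>\<^bsub>W\<^esub> w)"
  using near_endo[OF linear_endo_smult] by blast

text \<open>The class of \<open>u\<close> modulo \<open>level i\<close>. Working with sets of near
  elements represents the quotient without a quotient module.\<close>

definition near_set :: "nat \<Rightarrow> 'c \<Rightarrow> 'c set" where
  "near_set i u = {x. near i x u}"

lemma near_set_eq: "\<lbrakk>u \<in> carrier W; w \<in> carrier W\<rbrakk> \<Longrightarrow> near_set i u = near_set i w \<longleftrightarrow> near i u w"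
  unfolding near_set_def using near_refl near_sym near_trans by blast

lemma coset_eq_near_set:
  assumes u: "u \<in> carrier W"
  shows "level i +>\<^bsub>W\<^esub> u = near_set i u"
proof
  show "level i +>\<^bsub>W\<^esub> u \<subseteq> near_set i u"
  proof
    fix x assume "x \<in> level i +>\<^bsub>W\<^esub> u"
    then obtain l where l: "l \<in> level i" "x = l \<oplus>\<^bsub>W\<^esub> u" by (auto simp: a_r_coset_def')
    then have c: "l \<in> carrier W" using levelE(1) by blast
    then have "x \<ominus>\<^bsub>W\<^esub> u = l" unfolding l(2) using u by (simp add: M.minus_eq M.a_assoc M.r_neg)
    then show "x \<in> near_set i u" using l c u unfolding near_set_def near_def by simp
  qed
  show "near_set i u \<subseteq> level i +>\<^bsub>W\<^esub> u"
  proof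
    fix x assume "x \<in> near_set i u"
    then have x: "x \<in> carrier W" "x \<ominus>\<^bsub>W\<^esub> u \<in> level i" unfolding near_set_def near_def by auto
    have "x = (x \<ominus>\<^bsub>W\<^esub> u) \<oplus>\<^bsub>W\<^esub> u" using x u by (simp add: M.minus_eq M.a_assoc M.l_neg)
    then show "x \<in> level i +>\<^bsub>W\<^esub> u" using x(2) by (auto simp: a_r_coset_def')
  qed
qed

lemma lincomb_level:
  assumes "finite V" "V \<subseteq> carrier W" "\<And>v. v \<in> V \<Longrightarrow> c v \<in> mpow i"
  shows "lincomb c V \<in> level i"
  using assms
proof (induction V rule: finite_induct)
  case (insert v V)
  have "lincomb c (insert v V) = c v \<odot>\<^bsub>W\<^esub> v \<oplus>\<^bsub>W\<^esub> lincomb c V"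
    by (rule lincomb_insert) (use insert mpow_carr in auto)
  then show ?case using insert level_smult levelE(5) by auto
qed (simp add: level_zero)

text \<open>Combinations of the fixed generators with coefficients in \<open>mpow i\<close> form a
  submodule containing all products that generate \<open>level i\<close>.\<close>

lemma level_lincomb:
  assumes V: "finite V" "V \<subseteq> carrier W" "span_over (carrier R) V = carrier W" and u: "u \<in> level i"
  shows "\<exists>c. (\<forall>v. c v \<in> mpow i) \<and> u = lincomb c V"
proof -
  interpret I: ideal "mpow i" R by (rule ideal_mpow)
  let ?N = "{lincomb c V | c. \<forall>v. c v \<in> mpow i}"
  have "submodule ?N R W"
  proof (rule submoduleI)
    show "?N \<subseteq> carrier W" using V mpow_carr by auto
    have "lincomb (\<lambda>v. \<zero>) V = lincomb (\<lambda>v. \<zero>) {}" by (rule lincomb_mono[symmetric]) (use V in auto)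
    then show "\<zero>\<^bsub>W\<^esub> \<in> ?N" using I.zero_closed by (intro CollectI exI[of _ "\<lambda>v. \<zero>"]) simp
    show sm: "a \<odot>\<^bsub>W\<^esub> x \<in> ?N" if a: "a \<in> carrier R" and x: "x \<in> ?N" for a x
    proof -
      obtain c where c: "\<And>v. c v \<in> mpow i" "x = lincomb c V" using x by blast
      have "a \<odot>\<^bsub>W\<^esub> x = lincomb (\<lambda>v. a \<otimes> c v) V"
        unfolding c(2) by (rule lincomb_smult[symmetric]) (use V a c mpow_carr in auto)
      then show ?thesis using I.I_l_closed[OF c(1) a] by blast
    qed
    show "\<ominus>\<^bsub>W\<^esub> x \<in> ?N" if x: "x \<in> ?N" for x
    proof -
      have "x \<in> carrier W" using x V mpow_carr by auto
      then have "\<ominus>\<^bsub>W\<^esub> x = (\<ominus> \<one>) \<odot>\<^bsub>W\<^esub> x" by (simp add: smult_l_minus)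
      then show ?thesis using sm[OF _ x, of "\<ominus> \<one>"] by simp
    qed
    show "x \<oplus>\<^bsub>W\<^esub> y \<in> ?N" if x: "x \<in> ?N" and y: "y \<in> ?N" for x y
    proof -
      obtain c where c: "\<And>v. c v \<in> mpow i" "x = lincomb c V" using x by blast
      obtain d where d: "\<And>v. d v \<in> mpow i" "y = lincomb d V" using y by blast
      have "x \<oplus>\<^bsub>W\<^esub> y = lincomb (\<lambda>v. c v \<oplus> d v) V"
        unfolding c(2) d(2) by (rule lincomb_add[symmetric]) (use V c d mpow_carr in auto)
      then show ?thesis using I.a_closed[OF c(1) d(1)] by blast
    qed
  qed
  then have "level i \<subseteq> ?N"
  proof (rule level_minimal)
    fix a w assume a: "a \<in> mpow i" and w: "w \<in> carrier W"
    then obtain c where c: "\<And>v. c v \<in> carrier R" "w = lincomb c V" using V(3) unfolding span_over_def by blast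
    have "a \<odot>\<^bsub>W\<^esub> w = lincomb (\<lambda>v. a \<otimes> c v) V"
      unfolding c(2) by (rule lincomb_smult[symmetric]) (use V a c mpow_carr in auto)
    then show "a \<odot>\<^bsub>W\<^esub> w \<in> ?N" using I.I_r_closed[OF a c(1)] by blast
  qed
  then show ?thesis using u by blast
qed

text \<open>Coefficients at the finitely many generators may be replaced by representatives modulo
  \<open>mpow i\<close>, which are finite in number.\<close>

lemma finite_near_sets: "finite (near_set i ` carrier W)"
proof -
  obtain V where V: "finite V" "V \<subseteq> carrier W" "span_over (carrier R) V = carrier W"
    using finitely_generated_span[OF fg] by blast
  obtain E where E: "finite E" "E \<subseteq> carrier R" "\<And>r. r \<in> carrier R \<Longrightarrow> \<exists>e\<in>E. r \<ominus> e \<in> mpow i"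
    using finite_residues[of i] by blast
  let ?U = "(\<lambda>e. lincomb e V) ` (V \<rightarrow>\<^sub>E E)"
  have "near_set i w \<in> near_set i ` ?U" if w: "w \<in> carrier W" for w
  proof -
    obtain c where c: "\<And>v. c v \<in> carrier R" "w = lincomb c V" using w V(3) unfolding span_over_def by blast
    have "\<forall>v. \<exists>e. e \<in> E \<and> c v \<ominus> e \<in> mpow i" using E(3) c(1) by blast
    then obtain e where e: "\<forall>v. e v \<in> E \<and> c v \<ominus> e v \<in> mpow i" unfolding choice_iff by blast
    have ec: "e v \<in> carrier R" for v using e E(2) by blast
    let ?e = "restrict e V"
    have re: "lincomb ?e V = lincomb e V" by (rule lincomb_cong) (use V ec in auto)
    have "lincomb c V = lincomb (\<lambda>v. (c v \<ominus> e v) \<oplus> e v) V"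
    proof (rule lincomb_cong)
      fix v
      have "x = (x \<ominus> y) \<oplus> y" if "x \<in> carrier R" "y \<in> carrier R" for x y
        using that by (simp add: a_minus_def R.a_assoc R.l_neg)
      then show "c v = (c v \<ominus> e v) \<oplus> e v" using c(1) ec by blast
    qed (use V c(1) ec in auto)
    also have "\<dots> = lincomb (\<lambda>v. c v \<ominus> e v) V \<oplus>\<^bsub>W\<^esub> lincomb e V"
      by (rule lincomb_add) (use V c(1) ec in auto)
    finally have eq: "w = lincomb (\<lambda>v. c v \<ominus> e v) V \<oplus>\<^bsub>W\<^esub> lincomb e V" unfolding c(2) .
    have l: "lincomb (\<lambda>v. c v \<ominus> e v) V \<in> level i" by (rule lincomb_level) (use V e in auto)
    have lc: "lincomb e V \<in> carrier W" using V ec by auto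
    have "w \<in> level i +>\<^bsub>W\<^esub> lincomb e V" unfolding eq a_r_coset_def' using l by blast
    then have "near i w (lincomb e V)" unfolding coset_eq_near_set[OF lc] near_set_def by blast
    then have "near_set i w = near_set i (lincomb ?e V)" unfolding re using near_set_eq w lc by blast
    moreover have "?e \<in> V \<rightarrow>\<^sub>E E" using e by auto
    ultimately show ?thesis by blast
  qed
  then have "near_set i ` carrier W \<subseteq> near_set i ` ?U" by blast
  moreover have "finite (near_set i ` ?U)" using V(1) E(1) by (simp add: finite_PiE)
  ultimately show ?thesis by (rule finite_subset)
qed

text \<open>The successive differences get coefficients in \<open>mpow i\<close> at a fixed finite
  set of generators, and these coefficients are summed in \<open>R\<close>, where completeness is
  available.\<close>

lemma level_complete:
  assumes u: "\<And>i. near i (u (Suc i)) (u i)"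
  shows "\<exists>x\<in>carrier W. \<forall>i. near i x (u i)"
proof -
  obtain V where V: "finite V" "V \<subseteq> carrier W" "span_over (carrier R) V = carrier W"
    using finitely_generated_span[OF fg] by blast
  have uc: "u i \<in> carrier W" for i using u[of i] unfolding near_def by blast
  have "\<exists>c. (\<forall>v. c v \<in> mpow i) \<and> u (Suc i) \<ominus>\<^bsub>W\<^esub> u i = lincomb c V" for i
    by (rule level_lincomb[OF V]) (use u in \<open>simp add: near_def\<close>)
  then have "\<forall>i. \<exists>c. (\<forall>v. c v \<in> mpow i) \<and> u (Suc i) \<ominus>\<^bsub>W\<^esub> u i = lincomb c V" by blast
  then obtain c where c0: "\<forall>i. (\<forall>v. c i v \<in> mpow i) \<and> u (Suc i) \<ominus>\<^bsub>W\<^esub> u i = lincomb (c i) V"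
    unfolding choice_iff by blast
  then have c: "c i v \<in> mpow i" "u (Suc i) \<ominus>\<^bsub>W\<^esub> u i = lincomb (c i) V" for i v by simp_all
  have cc: "c i v \<in> carrier R" for i v using c(1) mpow_carr by blast
  define s where "s v n = rec_nat \<zero> (\<lambda>i x. x \<oplus> c i v) n" for v n
  have s: "s v 0 = \<zero>" "s v (Suc n) = s v n \<oplus> c n v" for v n by (simp_all add: s_def)
  have sc: "s v n \<in> carrier R" for v n by (induction n) (use cc s in simp_all)
  have "\<exists>y\<in>carrier R. \<forall>i. y \<ominus> s v i \<in> mpow i" for v
  proof (rule complete[folded mpow_def])
    show "s v i \<in> carrier R" for i by (rule sc)
    have "x \<oplus> y \<ominus> x = y" if "x \<in> carrier R" "y \<in> carrier R" for x y using that by algebra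
    then show "s v (Suc i) \<ominus> s v i \<in> mpow i" for i unfolding s(2) using sc cc c(1) by simp
  qed
  then have "\<forall>v. \<exists>y. y \<in> carrier R \<and> (\<forall>i. y \<ominus> s v i \<in> mpow i)" by blast
  then obtain y where "\<forall>v. y v \<in> carrier R \<and> (\<forall>i. y v \<ominus> s v i \<in> mpow i)" unfolding choice_iff by blast
  then have y: "y v \<in> carrier R" "y v \<ominus> s v i \<in> mpow i" for v i by simp_all
  have un: "u n = lincomb (\<lambda>v. s v n) V \<oplus>\<^bsub>W\<^esub> u 0" for n
  proof (induction n)
    case 0
    have "lincomb (\<lambda>v. s v 0) V = lincomb (\<lambda>v. s v 0) {}" by (rule lincomb_mono[symmetric]) (use V s in auto)
    then show ?case using uc by simp
  next
    case (Suc n)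
    have l: "lincomb (c n) V \<in> carrier W" "lincomb (\<lambda>v. s v n) V \<in> carrier W" using V cc sc by auto
    have "u (Suc n) = (u (Suc n) \<ominus>\<^bsub>W\<^esub> u n) \<oplus>\<^bsub>W\<^esub> u n"
      using uc by (simp add: M.minus_eq M.a_assoc M.l_neg)
    also have "\<dots> = lincomb (c n) V \<oplus>\<^bsub>W\<^esub> (lincomb (\<lambda>v. s v n) V \<oplus>\<^bsub>W\<^esub> u 0)" unfolding c(2) Suc[symmetric] ..
    also have "\<dots> = (lincomb (\<lambda>v. s v n) V \<oplus>\<^bsub>W\<^esub> lincomb (c n) V) \<oplus>\<^bsub>W\<^esub> u 0" using l uc by (simp add: M.a_ac)
    also have "lincomb (\<lambda>v. s v n) V \<oplus>\<^bsub>W\<^esub> lincomb (c n) V = lincomb (\<lambda>v. s v (Suc n)) V"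
      unfolding s(2) by (rule lincomb_add[symmetric]) (use V cc sc in auto)
    finally show ?case .
  qed
  define x where "x = lincomb y V \<oplus>\<^bsub>W\<^esub> u 0"
  have "near i x (u i)" for i
  proof -
    have "lincomb y V = lincomb (\<lambda>v. (y v \<ominus> s v i) \<oplus> s v i) V"
    proof (rule lincomb_cong)
      fix v
      have "a = (a \<ominus> b) \<oplus> b" if "a \<in> carrier R" "b \<in> carrier R" for a b
        using that by (simp add: a_minus_def R.a_assoc R.l_neg)
      then show "y v = (y v \<ominus> s v i) \<oplus> s v i" using y(1) sc by blast
    qed (use V y(1) sc in auto)
    also have "\<dots> = lincomb (\<lambda>v. y v \<ominus> s v i) V \<oplus>\<^bsub>W\<^esub> lincomb (\<lambda>v. s v i) V"
      by (rule lincomb_add) (use V y(1) sc in auto)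
    finally have e: "x = lincomb (\<lambda>v. y v \<ominus> s v i) V \<oplus>\<^bsub>W\<^esub> u i"
      unfolding x_def un[of i] using V y(1) sc uc by (simp add: M.a_assoc)
    have "lincomb (\<lambda>v. y v \<ominus> s v i) V \<in> level i" by (rule lincomb_level) (use V y in auto)
    then have "x \<in> level i +>\<^bsub>W\<^esub> u i" unfolding e a_r_coset_def' by blast
    then show ?thesis unfolding coset_eq_near_set[OF uc] near_set_def by blast
  qed
  then show ?thesis unfolding near_def by blast
qed

text \<open>All coordinates of the difference supplied by the linearization lie in every power of
  the maximal ideal. So they vanish, and the coordinates detect zero.\<close>

lemma level_separated:
  assumes p: "Factorial_Ring.prime p" and u: "\<And>i. near i u w"
  shows "u = w"
proof (rule ex_linearization[OF p])
  fix n x \<gamma>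
  assume cl: "\<And>i u. \<lbrakk>i < n; u \<in> carrier W\<rbrakk> \<Longrightarrow> \<gamma> i u \<in> carrier R"
    and sep: "\<And>u. \<lbrakk>u \<in> carrier W; \<And>i. i < n \<Longrightarrow> \<gamma> i u = \<zero>\<rbrakk> \<Longrightarrow> u = \<zero>\<^bsub>W\<^esub>"
    and small: "\<And>j. \<exists>m. \<forall>u\<in>ideal_smult R W (mpow m). \<forall>i<(n::nat). \<gamma> i u \<in> mpow j"
  have c: "u \<in> carrier W" "w \<in> carrier W" "u \<ominus>\<^bsub>W\<^esub> w \<in> level i" for i using u[of i] unfolding near_def by auto
  have "u \<ominus>\<^bsub>W\<^esub> w = \<zero>\<^bsub>W\<^esub>"
  proof (rule sep)
    show "\<gamma> i (u \<ominus>\<^bsub>W\<^esub> w) = \<zero>" if "i < n" for i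
    proof (rule eq_zero_if_mem_all)
      fix j
      obtain m where "\<forall>u\<in>ideal_smult R W (mpow m). \<forall>i<n. \<gamma> i u \<in> mpow j" using small[of j] by blast
      then show "\<gamma> i (u \<ominus>\<^bsub>W\<^esub> w) \<in> mpow j" using c(3)[of m] that unfolding level_def by blast
    qed
  qed (use c in simp)
  then have "(u \<ominus>\<^bsub>W\<^esub> w) \<oplus>\<^bsub>W\<^esub> w = w" using c by simp
  then show "u = w" using c(1,2) by (simp add: M.minus_eq M.a_assoc M.l_neg)
qed

section \<open>The automorphism group and its topology\<close>

lemma module_Aut_iff:
  "f \<in> carrier (module_Aut R W) \<longleftrightarrow> f \<in> Bij (carrier W) \<and> linear_endo f"
  unfolding module_Aut_def linear_endo_def Bij_def by (auto simp: bij_betw_def)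

lemma module_Aut_subgroup: "subgroup (carrier (module_Aut R W)) (BijGroup (carrier W))"
proof -
  interpret B: group "BijGroup (carrier W)" by (rule group_BijGroup)
  show ?thesis
  proof (rule B.subgroupI)
    show "carrier (module_Aut R W) \<subseteq> carrier (BijGroup (carrier W))"
      using module_Aut_iff by (auto simp: BijGroup_def)
    have "(\<lambda>x\<in>carrier W. x) \<in> carrier (module_Aut R W)"
      unfolding module_Aut_iff linear_endo_def by (simp add: id_Bij)
    then show "carrier (module_Aut R W) \<noteq> {}" by blast
    fix f assume f: "f \<in> carrier (module_Aut R W)"
    then have fB: "f \<in> Bij (carrier W)" and fl: "linear_endo f" unfolding module_Aut_iff by auto
    have bij: "bij_betw f (carrier W) (carrier W)" using fB unfolding Bij_def by blast
    let ?i = "inv_into (carrier W) f"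
    have i: "?i x \<in> carrier W" "f (?i x) = x" if "x \<in> carrier W" for x
      using that bij by (auto simp: bij_betw_def inv_into_into f_inv_into_f)
    have eqI: "?i x = y" if "y \<in> carrier W" "f y = x" for x y
      using that bij by (auto simp: bij_betw_def)
    have "linear_endo (\<lambda>x\<in>carrier W. ?i x)"
      unfolding linear_endo_def using i linear_endoD[OF fl] by (auto intro!: eqI)
    then show "inv\<^bsub>BijGroup (carrier W)\<^esub> f \<in> carrier (module_Aut R W)"
      unfolding inv_BijGroup[OF fB] module_Aut_iff using restrict_inv_into_Bij[OF fB] by blast
    fix g assume g: "g \<in> carrier (module_Aut R W)"
    then have gB: "g \<in> Bij (carrier W)" and gl: "linear_endo g" unfolding module_Aut_iff by auto
    have "linear_endo (compose (carrier W) f g)"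
      unfolding linear_endo_def using linear_endoD[OF fl] linear_endoD[OF gl] by (simp add: compose_def)
    then show "f \<otimes>\<^bsub>BijGroup (carrier W)\<^esub> g \<in> carrier (module_Aut R W)"
      unfolding module_Aut_iff using compose_Bij[OF fB gB] fB gB by (simp add: BijGroup_def)
  qed
qed

lemma group_module_Aut: "group (module_Aut R W)"
proof -
  have "module_Aut R W = (BijGroup (carrier W))\<lparr>carrier := carrier (module_Aut R W)\<rparr>"
    by (simp add: module_Aut_def)
  then show ?thesis
    using group.subgroup_imp_group[OF group_BijGroup module_Aut_subgroup] by simp
qed

lemma module_Aut_mult:
  assumes "f \<in> carrier (module_Aut R W)" "g \<in> carrier (module_Aut R W)"
  shows "f \<otimes>\<^bsub>module_Aut R W\<^esub> g = compose (carrier W) f g"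
  using assms unfolding module_Aut_iff by (simp add: module_Aut_def BijGroup_def)

lemma module_Aut_one: "\<one>\<^bsub>module_Aut R W\<^esub> = (\<lambda>x\<in>carrier W. x)"
  by (simp add: module_Aut_def BijGroup_def)

lemma module_Aut_eqI:
  assumes "f \<in> carrier (module_Aut R W)" "g \<in> carrier (module_Aut R W)" "\<And>w. w \<in> carrier W \<Longrightarrow> f w = g w"
  shows "f = g"
  using assms unfolding module_Aut_iff Bij_def by (auto intro: extensionalityI)

lemma module_Aut_inv:
  assumes f: "f \<in> carrier (module_Aut R W)" and w: "w \<in> carrier W"
  shows "f ((inv\<^bsub>module_Aut R W\<^esub> f) w) = w" "(inv\<^bsub>module_Aut R W\<^esub> f) (f w) = w"
proof -
  interpret A: group "module_Aut R W" by (rule group_module_Aut)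
  have i: "inv\<^bsub>module_Aut R W\<^esub> f \<in> carrier (module_Aut R W)" using f by simp
  have "compose (carrier W) f (inv\<^bsub>module_Aut R W\<^esub> f) = (\<lambda>x\<in>carrier W. x)"
    using A.r_inv[OF f] unfolding module_Aut_mult[OF f i] module_Aut_one .
  then show "f ((inv\<^bsub>module_Aut R W\<^esub> f) w) = w" using w by (metis compose_eq restrict_apply')
  have "compose (carrier W) (inv\<^bsub>module_Aut R W\<^esub> f) f = (\<lambda>x\<in>carrier W. x)"
    using A.l_inv[OF f] unfolding module_Aut_mult[OF i f] module_Aut_one .
  then show "(inv\<^bsub>module_Aut R W\<^esub> f) (f w) = w" using w by (metis compose_eq restrict_apply')
qed

lemma congruence_kernel_iff:
  "f \<in> congruence_kernel R W i \<longleftrightarrow> f \<in> carrier (module_Aut R W) \<and> (\<forall>w\<in>carrier W. near i (f w) w)"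
proof -
  have "(level i +>\<^bsub>W\<^esub> f w = level i +>\<^bsub>W\<^esub> w) \<longleftrightarrow> near i (f w) w"
    if "f \<in> carrier (module_Aut R W)" "w \<in> carrier W" for w
  proof -
    have "f w \<in> carrier W" using that linear_endoD(1) unfolding module_Aut_iff by blast
    then show ?thesis using coset_eq_near_set near_set_eq that(2) by simp
  qed
  then show ?thesis unfolding congruence_kernel_def level_def mpow_def by auto
qed

text \<open>Both \<open>g\<close> and its inverse preserve nearness, so the coset is the ball of
  radius \<open>i\<close> around \<open>g\<close> for uniform approximation on
  \<open>W\<close>.\<close>

lemma kernel_coset_iff:
  assumes g: "g \<in> carrier (module_Aut R W)"
  shows "f \<in> g <#\<^bsub>module_Aut R W\<^esub> congruence_kernel R W i \<longleftrightarrow>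
    f \<in> carrier (module_Aut R W) \<and> (\<forall>w\<in>carrier W. near i (f w) (g w))"
proof
  interpret A: group "module_Aut R W" by (rule group_module_Aut)
  have gl: "linear_endo g" using g unfolding module_Aut_iff by blast
  {
    assume "f \<in> g <#\<^bsub>module_Aut R W\<^esub> congruence_kernel R W i"
    then obtain k where k: "k \<in> congruence_kernel R W i" "f = g \<otimes>\<^bsub>module_Aut R W\<^esub> k"
      unfolding l_coset_def by blast
    then have kA: "k \<in> carrier (module_Aut R W)" "\<And>w. w \<in> carrier W \<Longrightarrow> near i (k w) w"
      unfolding congruence_kernel_iff by auto
    have "near i (f w) (g w)" if "w \<in> carrier W" for w
      unfolding k(2) module_Aut_mult[OF g kA(1)] compose_eq[OF that] by (rule near_endo[OF gl kA(2)[OF that]])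
    then show "f \<in> carrier (module_Aut R W) \<and> (\<forall>w\<in>carrier W. near i (f w) (g w))"
      using k(2) g kA(1) by simp
  }
  {
    assume f: "f \<in> carrier (module_Aut R W) \<and> (\<forall>w\<in>carrier W. near i (f w) (g w))"
    let ?g = "inv\<^bsub>module_Aut R W\<^esub> g"
    let ?k = "?g \<otimes>\<^bsub>module_Aut R W\<^esub> f"
    have gi: "?g \<in> carrier (module_Aut R W)" using g by simp
    then have gil: "linear_endo ?g" unfolding module_Aut_iff by blast
    have "near i (?k w) w" if w: "w \<in> carrier W" for w
    proof -
      have "near i (?g (f w)) (?g (g w))" using near_endo[OF gil] f w by blast
      then show ?thesis using module_Aut_mult[OF gi] f w module_Aut_inv(2)[OF g w] by (simp add: compose_eq)
    qed
    then have "?k \<in> congruence_kernel R W i" unfolding congruence_kernel_iff using f gi by blast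
    moreover have "f = g \<otimes>\<^bsub>module_Aut R W\<^esub> ?k" using f g gi by (simp add: A.m_assoc[symmetric])
    ultimately show "f \<in> g <#\<^bsub>module_Aut R W\<^esub> congruence_kernel R W i" unfolding l_coset_def by blast
  }
qed

text \<open>The index is \<open>Suc i\<close> because the sets generating the topology start at
  index one.\<close>

lemma openin_kernel_coset:
  "g \<in> carrier (module_Aut R W) \<Longrightarrow>
    openin (module_Aut_topology R W) (g <#\<^bsub>module_Aut R W\<^esub> congruence_kernel R W (Suc i))"
  unfolding module_Aut_topology_def by (rule topology_generated_by_Basis) auto

lemma mem_kernel_coset:
  assumes g: "g \<in> carrier (module_Aut R W)"
  shows "g \<in> g <#\<^bsub>module_Aut R W\<^esub> congruence_kernel R W i"
  unfolding kernel_coset_iff[OF g] using g near_refl linear_endoD(1) unfolding module_Aut_iff by blast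

lemma topspace_module_Aut: "topspace (module_Aut_topology R W) = carrier (module_Aut R W)"
proof
  show "topspace (module_Aut_topology R W) \<subseteq> carrier (module_Aut R W)"
    unfolding module_Aut_topology_def topology_generated_by_topspace using kernel_coset_iff by auto
  show "carrier (module_Aut R W) \<subseteq> topspace (module_Aut_topology R W)"
    using mem_kernel_coset openin_subset[OF openin_kernel_coset] by blast
qed

text \<open>Points agreeing with a given point in three discrete coordinates form an open set on
  which the condition is constant. Addition needs three coordinates; conditions on two repeat one of
  them.\<close>

lemma closedin_discrete_coordinates:
  assumes F: "\<And>k. k \<in> I \<Longrightarrow> F k = discrete_topology (D k)" and k: "ka \<in> I" "kb \<in> I" "kc \<in> I"
  shows "closedin (product_topology F I) {c \<in> topspace (product_topology F I). P (c ka) (c kb) (c kc)}"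
proof -
  let ?T = "product_topology F I"
  have op: "openin ?T {c \<in> topspace ?T. c k \<in> {c0 k}}" if "k \<in> I" "c0 \<in> topspace ?T" for k c0
  proof (rule openin_continuous_map_preimage[OF continuous_map_product_projection[OF that(1)]])
    have "c0 k \<in> topspace (F k)" using that by (auto simp: topspace_product_topology)
    then show "openin (F k) {c0 k}" using F[OF that(1)] by simp
  qed
  have "openin ?T (topspace ?T - {c \<in> topspace ?T. P (c ka) (c kb) (c kc)})"
    unfolding openin_subopen[of ?T "topspace ?T - _"]
  proof
    fix c0 assume c0: "c0 \<in> topspace ?T - {c \<in> topspace ?T. P (c ka) (c kb) (c kc)}"
    let ?U = "{c \<in> topspace ?T. c ka \<in> {c0 ka}} \<inter> {c \<in> topspace ?T. c kb \<in> {c0 kb}} \<inter> {c \<in> topspace ?T. c kc \<in> {c0 kc}}"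
    have "openin ?T ?U" using op k c0 by blast
    moreover have "c0 \<in> ?U" using c0 by blast
    moreover have "?U \<subseteq> topspace ?T - {c \<in> topspace ?T. P (c ka) (c kb) (c kc)}" using c0 by auto
    ultimately show "\<exists>U. openin ?T U \<and> c0 \<in> U \<and> U \<subseteq> topspace ?T - {c \<in> topspace ?T. P (c ka) (c kb) (c kc)}"
      by blast
  qed
  then show ?thesis unfolding closedin_def by blast
qed

section \<open>The compact space of approximate automorphisms\<close>

definition approximations :: "(nat \<times> 'c \<times> bool \<Rightarrow> 'c set) topology" where
  "approximations = product_topology (\<lambda>(i, w, b). discrete_topology (near_set i ` carrier W))
     (UNIV \<times> carrier W \<times> UNIV)"

lemma topspace_approximations:
  "c \<in> topspace approximations \<longleftrightarrow> c \<in> extensional (UNIV \<times> carrier W \<times> UNIV) \<and>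
     (\<forall>i b. \<forall>w\<in>carrier W. c (i, w, b) \<in> near_set i ` carrier W)"
  unfolding approximations_def topspace_product_topology by (auto simp: PiE_iff)

text \<open>Tychonoff's theorem, since every quotient of \<open>W\<close> by a level is
  finite.\<close>

lemma compact_space_approximations: "compact_space approximations"
  unfolding approximations_def compact_space_product_topology
  using finite_near_sets by (auto simp: compact_space_discrete_topology)

text \<open>An automorphism \<open>f\<close> is encoded by the classes of \<open>f w\<close> (index \<^term>\<open>False\<close>) and of its
  inverse at \<open>w\<close> (index \<^term>\<open>True\<close>) modulo each \<^const>\<open>level\<close>; each constraint involves finitely
  many coordinates in discrete spaces, hence is closed.\<close>

definition decreasing_constraints :: "(nat \<times> 'c \<times> bool \<Rightarrow> 'c set) set set" where
  "decreasing_constraints = {{c \<in> topspace approximations. c (Suc i, w, b) \<subseteq> c (i, w, b)} | i w b. w \<in> carrier W}"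

definition additive_constraints :: "(nat \<times> 'c \<times> bool \<Rightarrow> 'c set) set set" where
  "additive_constraints = {{c \<in> topspace approximations. \<forall>x\<in>c (i, u, False). \<forall>y\<in>c (i, w, False). x \<oplus>\<^bsub>W\<^esub> y \<in> c (i, u \<oplus>\<^bsub>W\<^esub> w, False)}
     | i u w. u \<in> carrier W \<and> w \<in> carrier W}"

definition scaling_constraints :: "(nat \<times> 'c \<times> bool \<Rightarrow> 'c set) set set" where
  "scaling_constraints = {{c \<in> topspace approximations. \<forall>x\<in>c (i, w, False). a \<odot>\<^bsub>W\<^esub> x \<in> c (i, a \<odot>\<^bsub>W\<^esub> w, False)}
     | i a w. a \<in> carrier R \<and> w \<in> carrier W}"

text \<open>Bijectivity alone is not a condition on finitely many coordinates. With the inverse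
  recorded as a second family, it follows from conditions on two coordinates each.\<close>

definition inverse_constraints :: "(nat \<times> 'c \<times> bool \<Rightarrow> 'c set) set set" where
  "inverse_constraints = {{c \<in> topspace approximations. x \<in> c (i, w, b) \<longrightarrow> w \<in> c (i, x, \<not> b)} | i w x b. w \<in> carrier W \<and> x \<in> carrier W}"

definition constraints :: "(nat \<times> 'c \<times> bool \<Rightarrow> 'c set) set set" where
  "constraints = decreasing_constraints \<union> additive_constraints \<union> scaling_constraints \<union> inverse_constraints"

lemma constraintsE:
  assumes "S \<in> constraints"
  obtains i w b where "w \<in> carrier W" "S = {c \<in> topspace approximations. c (Suc i, w, b) \<subseteq> c (i, w, b)}"
  | i u w where "u \<in> carrier W" "w \<in> carrier W"
      "S = {c \<in> topspace approximations. \<forall>x\<in>c (i, u, False). \<forall>y\<in>c (i, w, False). x \<oplus>\<^bsub>W\<^esub> y \<in> c (i, u \<oplus>\<^bsub>W\<^esub> w, False)}"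
  | i a w where "a \<in> carrier R" "w \<in> carrier W"
      "S = {c \<in> topspace approximations. \<forall>x\<in>c (i, w, False). a \<odot>\<^bsub>W\<^esub> x \<in> c (i, a \<odot>\<^bsub>W\<^esub> w, False)}"
  | i w x b where "w \<in> carrier W" "x \<in> carrier W" "S = {c \<in> topspace approximations. x \<in> c (i, w, b) \<longrightarrow> w \<in> c (i, x, \<not> b)}"
proof -
  from assms consider "S \<in> decreasing_constraints" | "S \<in> additive_constraints"
    | "S \<in> scaling_constraints" | "S \<in> inverse_constraints"
    unfolding constraints_def by blast
  then show ?thesis
  proof cases
    case 1
    then show ?thesis unfolding decreasing_constraints_def using that(1) by blast
  next
    case 2
    then show ?thesis unfolding additive_constraints_def using that(2) by blast
  next
    case 3
    then show ?thesis unfolding scaling_constraints_def using that(3) by blast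
  next
    case 4
    then show ?thesis unfolding inverse_constraints_def using that(4) by blast
  qed
qed

definition coherent :: "(nat \<times> 'c \<times> bool \<Rightarrow> 'c set) set" where
  "coherent = \<Inter>(insert (topspace approximations) constraints)"

lemma closedin_coherent: "closedin approximations coherent"
  unfolding coherent_def
proof (rule closedin_Inter)
  have "closedin approximations S" if "S \<in> constraints" for S
    using that
  proof (cases rule: constraintsE)
    case (1 i w b)
    show ?thesis unfolding 1(2) approximations_def
      by (rule closedin_discrete_coordinates[where P = "\<lambda>x y z. x \<subseteq> y" and D = "\<lambda>(i, w, b). near_set i ` carrier W"
            and ka = "(Suc i, w, b)" and kb = "(i, w, b)" and kc = "(i, w, b)"]) (use 1 in auto)
  next
    case (2 i u w)
    show ?thesis unfolding 2(3) approximations_def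
      by (rule closedin_discrete_coordinates[where P = "\<lambda>S T U. \<forall>x\<in>S. \<forall>y\<in>T. x \<oplus>\<^bsub>W\<^esub> y \<in> U" and D = "\<lambda>(i, w, b). near_set i ` carrier W"
            and ka = "(i, u, False)" and kb = "(i, w, False)" and kc = "(i, u \<oplus>\<^bsub>W\<^esub> w, False)"]) (use 2 in auto)
  next
    case (3 i a w)
    show ?thesis unfolding 3(3) approximations_def
      by (rule closedin_discrete_coordinates[where P = "\<lambda>S T U. \<forall>x\<in>S. a \<odot>\<^bsub>W\<^esub> x \<in> T" and D = "\<lambda>(i, w, b). near_set i ` carrier W"
            and ka = "(i, w, False)" and kb = "(i, a \<odot>\<^bsub>W\<^esub> w, False)" and kc = "(i, w, False)"]) (use 3 in auto)
  next
    case (4 i w x b)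
    show ?thesis unfolding 4(3) approximations_def
      by (rule closedin_discrete_coordinates[where P = "\<lambda>S T U. x \<in> S \<longrightarrow> w \<in> T" and D = "\<lambda>(i, w, b). near_set i ` carrier W"
            and ka = "(i, w, b)" and kb = "(i, x, \<not> b)" and kc = "(i, w, b)"]) (use 4 in auto)
  qed
  then show "closedin approximations S" if "S \<in> insert (topspace approximations) constraints" for S
    using that by auto
qed simp

lemma coherentD:
  assumes "c \<in> coherent"
  shows "c \<in> topspace approximations" "w \<in> carrier W \<Longrightarrow> c (Suc i, w, b) \<subseteq> c (i, w, b)"
    "\<lbrakk>u \<in> carrier W; w \<in> carrier W; x \<in> c (i, u, False); y \<in> c (i, w, False)\<rbrakk> \<Longrightarrow> x \<oplus>\<^bsub>W\<^esub> y \<in> c (i, u \<oplus>\<^bsub>W\<^esub> w, False)"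
    "\<lbrakk>a \<in> carrier R; w \<in> carrier W; x \<in> c (i, w, False)\<rbrakk> \<Longrightarrow> a \<odot>\<^bsub>W\<^esub> x \<in> c (i, a \<odot>\<^bsub>W\<^esub> w, False)"
    "\<lbrakk>w \<in> carrier W; x \<in> carrier W; x \<in> c (i, w, b)\<rbrakk> \<Longrightarrow> w \<in> c (i, x, \<not> b)"
proof -
  have I: "c \<in> S" if "S \<in> insert (topspace approximations) constraints" for S
    using assms that unfolding coherent_def by (rule InterD)
  show "c \<in> topspace approximations" by (rule I) simp
  show "c (Suc i, w, b) \<subseteq> c (i, w, b)" if "w \<in> carrier W"
    using I[of "{c \<in> topspace approximations. c (Suc i, w, b) \<subseteq> c (i, w, b)}"] that unfolding constraints_def decreasing_constraints_def by blast
  show "x \<oplus>\<^bsub>W\<^esub> y \<in> c (i, u \<oplus>\<^bsub>W\<^esub> w, False)"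
    if "u \<in> carrier W" "w \<in> carrier W" "x \<in> c (i, u, False)" "y \<in> c (i, w, False)"
    using I[of "{c \<in> topspace approximations. \<forall>x\<in>c (i, u, False). \<forall>y\<in>c (i, w, False). x \<oplus>\<^bsub>W\<^esub> y \<in> c (i, u \<oplus>\<^bsub>W\<^esub> w, False)}"] that unfolding constraints_def additive_constraints_def by blast
  show "a \<odot>\<^bsub>W\<^esub> x \<in> c (i, a \<odot>\<^bsub>W\<^esub> w, False)" if "a \<in> carrier R" "w \<in> carrier W" "x \<in> c (i, w, False)"
    using I[of "{c \<in> topspace approximations. \<forall>x\<in>c (i, w, False). a \<odot>\<^bsub>W\<^esub> x \<in> c (i, a \<odot>\<^bsub>W\<^esub> w, False)}"] that unfolding constraints_def scaling_constraints_def by blast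
  show "w \<in> c (i, x, \<not> b)" if "w \<in> carrier W" "x \<in> carrier W" "x \<in> c (i, w, b)"
    using I[of "{c \<in> topspace approximations. x \<in> c (i, w, b) \<longrightarrow> w \<in> c (i, x, \<not> b)}"] that unfolding constraints_def inverse_constraints_def by blast
qed

text \<open>The classes of one element at increasing levels are nested: completeness gives them a
  common member and separatedness only one.\<close>

lemma coherent_limit:
  assumes p: "Factorial_Ring.prime p" and c: "c \<in> coherent" and w: "w \<in> carrier W"
  shows "\<exists>!x. \<forall>i. x \<in> c (i, w, b)"
proof -
  have cs: "\<exists>u\<in>carrier W. c (i, w, b) = near_set i u" for i
    using coherentD(1)[OF c] w unfolding topspace_approximations by blast
  then have "\<forall>i. \<exists>u. u \<in> carrier W \<and> c (i, w, b) = near_set i u" by blast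
  then obtain u where u0: "\<forall>i. u i \<in> carrier W \<and> c (i, w, b) = near_set i (u i)" unfolding choice_iff by blast
  then have u: "u i \<in> carrier W" "c (i, w, b) = near_set i (u i)" for i by simp_all
  have "near i (u (Suc i)) (u i)" for i
  proof -
    have "u (Suc i) \<in> c (Suc i, w, b)" unfolding u(2) near_set_def using near_refl[OF u(1)] by simp
    then have "u (Suc i) \<in> c (i, w, b)" using coherentD(2)[OF c w] by blast
    then show ?thesis unfolding u(2) near_set_def by simp
  qed
  from level_complete[OF this] obtain x where x: "x \<in> carrier W" "\<And>i. near i x (u i)" by blast
  show ?thesis
  proof (rule ex1I[of _ x])
    show "\<forall>i. x \<in> c (i, w, b)" unfolding u(2) near_set_def using x(2) by simp
    fix y assume "\<forall>i. y \<in> c (i, w, b)"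
    then have "near i y (u i)" for i unfolding u(2) near_set_def by simp
    then have "near i y x" for i using near_trans near_sym x(2) by blast
    then show "y = x" by (rule level_separated[OF p])
  qed
qed

definition limit_map :: "(nat \<times> 'c \<times> bool \<Rightarrow> 'c set) \<Rightarrow> bool \<Rightarrow> 'c \<Rightarrow> 'c" where
  "limit_map c b = (\<lambda>w\<in>carrier W. THE x. \<forall>i. x \<in> c (i, w, b))"

lemma limit_map_mem:
  assumes "Factorial_Ring.prime p" "c \<in> coherent" "w \<in> carrier W"
  shows "limit_map c b w \<in> c (i, w, b)"
  using theI'[OF coherent_limit[OF assms, of b]] assms(3) unfolding limit_map_def by simp

lemma limit_map_eqI:
  assumes "Factorial_Ring.prime p" "c \<in> coherent" "w \<in> carrier W" "\<And>i. x \<in> c (i, w, b)"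
  shows "limit_map c b w = x"
  using the1_equality[OF coherent_limit[OF assms(1-3), of b], of x] assms(3,4) unfolding limit_map_def by simp

lemma coherent_mem_carr: "\<lbrakk>c \<in> coherent; w \<in> carrier W; x \<in> c (i, w, b)\<rbrakk> \<Longrightarrow> x \<in> carrier W"
  using coherentD(1)[of c] unfolding topspace_approximations near_set_def near_def by blast

text \<open>The limits of the two families are inverse to each other by
  \<open>inverse_constraints\<close>. Linearity holds because the expected value lies in the
  prescribed class at every level and such a member is unique.\<close>

lemma limit_map_Aut:
  assumes p: "Factorial_Ring.prime p" and c: "c \<in> coherent"
  shows "limit_map c False \<in> carrier (module_Aut R W)"
proof -
  note mem = limit_map_mem[OF p c]
  have carr: "limit_map c b w \<in> carrier W" if "w \<in> carrier W" for b w
    using coherent_mem_carr[OF c that mem[OF that]] .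
  have inv: "limit_map c (\<not> b) (limit_map c b w) = w" if "w \<in> carrier W" for b w
    by (rule limit_map_eqI[OF p c carr[OF that]]) (rule coherentD(5)[OF c that carr[OF that] mem[OF that]])
  have "bij_betw (limit_map c False) (carrier W) (carrier W)"
    by (rule bij_betw_byWitness[of _ "limit_map c True"]) (use inv[of _ False] inv[of _ True] carr in auto)
  moreover have "limit_map c False \<in> extensional (carrier W)" unfolding limit_map_def by simp
  moreover have "linear_endo (limit_map c False)"
    unfolding linear_endo_def
  proof (intro conjI ballI)
    show "limit_map c False (u \<oplus>\<^bsub>W\<^esub> w) = limit_map c False u \<oplus>\<^bsub>W\<^esub> limit_map c False w"
      if "u \<in> carrier W" "w \<in> carrier W" for u w
      by (rule limit_map_eqI[OF p c]) (use that coherentD(3)[OF c that mem mem] in auto)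
    show "limit_map c False (a \<odot>\<^bsub>W\<^esub> w) = a \<odot>\<^bsub>W\<^esub> limit_map c False w"
      if "a \<in> carrier R" "w \<in> carrier W" for a w
      by (rule limit_map_eqI[OF p c]) (use that coherentD(4)[OF c that mem] in auto)
  qed (rule carr)
  ultimately show ?thesis unfolding module_Aut_iff Bij_def by blast
qed

text \<open>The classes of the values of an automorphism and of its inverse form a coherent family
  whose limit is that automorphism.\<close>

lemma limit_map_surj:
  assumes p: "Factorial_Ring.prime p" and g: "g \<in> carrier (module_Aut R W)"
  shows "g \<in> (\<lambda>c. limit_map c False) ` coherent"
proof -
  interpret A: group "module_Aut R W" by (rule group_module_Aut)
  define h where "h b = (if b then inv\<^bsub>module_Aut R W\<^esub> g else g)" for b
  have hA: "h b \<in> carrier (module_Aut R W)" for b using g unfolding h_def by simp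
  then have hl: "linear_endo (h b)" for b unfolding module_Aut_iff by blast
  note hD = linear_endoD[OF hl]
  have hinv: "h (\<not> b) (h b w) = w" if "w \<in> carrier W" for b w
    using module_Aut_inv[OF g that] unfolding h_def by simp
  define c where "c = (\<lambda>(i, w, b)\<in>UNIV \<times> carrier W \<times> UNIV. near_set i (h b w))"
  have cv: "c (i, w, b) = near_set i (h b w)" if "w \<in> carrier W" for i w b using that by (simp add: c_def)
  have top: "c \<in> topspace approximations" unfolding topspace_approximations
    using cv hD(1) by (auto simp: c_def)
  have dec: "c (Suc i, w, b) \<subseteq> c (i, w, b)" if "w \<in> carrier W" for i w b
    using level_mono[of i "Suc i"] unfolding cv[OF that] near_set_def near_def by auto
  have sum: "x \<oplus>\<^bsub>W\<^esub> y \<in> c (i, u \<oplus>\<^bsub>W\<^esub> w, False)"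
    if "u \<in> carrier W" "w \<in> carrier W" "x \<in> c (i, u, False)" "y \<in> c (i, w, False)" for x y u w i
    using that near_add hD(2) by (simp add: cv near_set_def)
  have scale: "a \<odot>\<^bsub>W\<^esub> x \<in> c (i, a \<odot>\<^bsub>W\<^esub> w, False)"
    if "a \<in> carrier R" "w \<in> carrier W" "x \<in> c (i, w, False)" for a x w i
    using that near_smult hD(3) by (simp add: cv near_set_def)
  have swap: "w \<in> c (i, x, \<not> b)" if "w \<in> carrier W" "x \<in> carrier W" "x \<in> c (i, w, b)" for w x i b
  proof -
    have "near i x (h b w)" using that by (simp add: cv near_set_def)
    then have "near i (h (\<not> b) x) (h (\<not> b) (h b w))" by (rule near_endo[OF hl])
    then show ?thesis using that(1,2) near_sym hinv by (simp add: cv near_set_def)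
  qed
  have "c \<in> S" if "S \<in> constraints" for S
    using that
  proof (cases rule: constraintsE)
    case (1 i w b)
    show ?thesis unfolding 1(2) using top dec[OF 1(1)] by blast
  next
    case (2 i u w)
    show ?thesis unfolding 2(3) using top sum[OF 2(1,2)] by blast
  next
    case (3 i a w)
    show ?thesis unfolding 3(3) using top scale[OF 3(1,2)] by blast
  next
    case (4 i w x b)
    show ?thesis unfolding 4(3) using top swap[OF 4(1,2)] by blast
  qed
  then have "c \<in> coherent" unfolding coherent_def using top by blast
  moreover have "limit_map c False = g"
  proof (rule module_Aut_eqI[OF limit_map_Aut[OF p \<open>c \<in> coherent\<close>] g])
    fix w assume w: "w \<in> carrier W"
    have "g w \<in> c (i, w, False)" for i
      using hD(1)[of w False] near_refl unfolding cv[OF w] near_set_def h_def using w by simp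
    then show "limit_map c False w = g w" by (rule limit_map_eqI[OF p \<open>c \<in> coherent\<close> w])
  qed
  ultimately show ?thesis by blast
qed

text \<open>Reduces approximation on all of \<open>W\<close> to finitely many elements, so that a
  neighbourhood in the automorphism group is controlled by finitely many coordinates.\<close>

lemma near_on_generators:
  assumes "finite V" "V \<subseteq> carrier W" "span_over (carrier R) V = carrier W" "linear_endo f" "linear_endo g"
    "\<And>v. v \<in> V \<Longrightarrow> near i (f v) (g v)" and w: "w \<in> carrier W"
  shows "near i (f w) (g w)"
proof -
  note fD = linear_endoD[OF assms(4)] and gD = linear_endoD[OF assms(5)]
  have main: "near i (f (lincomb a U)) (g (lincomb a U))"
    if "finite U" "U \<subseteq> V" "\<And>v. a v \<in> carrier R" for a U
    using that
  proof (induction U rule: finite_induct)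
    case empty
    have "near i (\<zero> \<odot>\<^bsub>W\<^esub> f \<zero>\<^bsub>W\<^esub>) (\<zero> \<odot>\<^bsub>W\<^esub> g \<zero>\<^bsub>W\<^esub>)" using fD(1) gD(1) near_refl[of "\<zero>\<^bsub>W\<^esub>"] by simp
    then show ?case using fD(3)[of \<zero> "\<zero>\<^bsub>W\<^esub>"] gD(3)[of \<zero> "\<zero>\<^bsub>W\<^esub>"] by simp
  next
    case (insert v U)
    have U: "U \<subseteq> carrier W" "v \<in> carrier W" using insert.prems assms(2) by auto
    have "lincomb a (insert v U) = a v \<odot>\<^bsub>W\<^esub> v \<oplus>\<^bsub>W\<^esub> lincomb a U"
      by (rule lincomb_insert) (use insert U in auto)
    moreover have "near i (a v \<odot>\<^bsub>W\<^esub> f v \<oplus>\<^bsub>W\<^esub> f (lincomb a U)) (a v \<odot>\<^bsub>W\<^esub> g v \<oplus>\<^bsub>W\<^esub> g (lincomb a U))"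
      by (rule near_add[OF near_smult[OF insert.prems(2) assms(6)] insert.IH]) (use insert.prems in auto)
    moreover have "lincomb a U \<in> carrier W" using U insert.prems by auto
    ultimately show ?case using fD gD U insert.prems by simp
  qed
  obtain a where "\<And>v. a v \<in> carrier R" "w = lincomb a V" using w assms(3) unfolding span_over_def by blast
  then show ?thesis using main[OF assms(1) order_refl] by simp
qed

lemma continuous_limit_map:
  assumes p: "Factorial_Ring.prime p"
  shows "continuous_map (subtopology approximations coherent) (module_Aut_topology R W) (\<lambda>c. limit_map c False)"
  unfolding module_Aut_topology_def
proof (rule continuous_on_generated_topo)
  let ?X = "subtopology approximations coherent"
  let ?f = "\<lambda>c. limit_map c False"
  have top: "topspace ?X = coherent" using coherentD(1) by (auto simp: topspace_subtopology)
  show "?f ` topspace ?X \<subseteq> \<Union>{g <#\<^bsub>module_Aut R W\<^esub> congruence_kernel R W i |g i. g \<in> carrier (module_Aut R W) \<and> 1 \<le> i}"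
    unfolding top using limit_map_Aut[OF p] mem_kernel_coset[of _ 1] by blast
  obtain V where V: "finite V" "V \<subseteq> carrier W" "span_over (carrier R) V = carrier W"
    using finitely_generated_span[OF fg] by blast
  fix U assume "U \<in> {g <#\<^bsub>module_Aut R W\<^esub> congruence_kernel R W i |g i. g \<in> carrier (module_Aut R W) \<and> 1 \<le> i}"
  then obtain g i where g: "g \<in> carrier (module_Aut R W)" and U: "U = g <#\<^bsub>module_Aut R W\<^esub> congruence_kernel R W i" by blast
  show "openin ?X (?f -` U \<inter> topspace ?X)"
    unfolding openin_subopen[of ?X "?f -` U \<inter> topspace ?X"]
  proof
    fix c0 assume "c0 \<in> ?f -` U \<inter> topspace ?X"
    then have c0: "c0 \<in> coherent" "?f c0 \<in> U" unfolding top by auto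
    have c0l: "linear_endo (?f c0)" using limit_map_Aut[OF p c0(1)] unfolding module_Aut_iff by blast
    \<comment> \<open>Agreement with \<open>c0\<close> at one generator \<open>v\<close> on level
      \<open>i\<close> is an open condition on one coordinate; for all generators together it puts
      the limit in the same coset.\<close>
    define S where "S v = {c \<in> topspace approximations. c (i, v, False) \<in> {c0 (i, v, False)}}" for v
    have "openin approximations (S v)" if "v \<in> V" for v
    proof -
      have v: "v \<in> carrier W" using that V by blast
      have "continuous_map approximations (discrete_topology (near_set i ` carrier W)) (\<lambda>c. c (i, v, False))"
        using continuous_map_product_projection[of "(i, v, False)" "UNIV \<times> carrier W \<times> UNIV"
            "\<lambda>(i, w, b). discrete_topology (near_set i ` carrier W)"] v
        unfolding approximations_def by simp
      moreover have "openin (discrete_topology (near_set i ` carrier W)) {c0 (i, v, False)}"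
        using coherentD(1)[OF c0(1)] v unfolding topspace_approximations by simp
      ultimately show ?thesis unfolding S_def by (rule openin_continuous_map_preimage)
    qed
    \<comment> \<open>\<open>V\<close> may be empty; intersecting with the whole space covers that
      case.\<close>
    then have "openin approximations (topspace approximations \<inter> (\<Inter>v\<in>V. S v))"
      using V(1) by (cases "V = {}") (auto intro!: openin_Int openin_INT)
    then have "openin ?X (coherent \<inter> (topspace approximations \<inter> (\<Inter>v\<in>V. S v)))"
      by (rule openin_subtopology_Int2)
    moreover have "c0 \<in> coherent \<inter> (topspace approximations \<inter> (\<Inter>v\<in>V. S v))"
      using c0(1) coherentD(1)[OF c0(1)] unfolding S_def by simp
    moreover have "coherent \<inter> (topspace approximations \<inter> (\<Inter>v\<in>V. S v)) \<subseteq> ?f -` U \<inter> topspace ?X"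
    proof
      fix c assume cc: "c \<in> coherent \<inter> (topspace approximations \<inter> (\<Inter>v\<in>V. S v))"
      then have c: "c \<in> coherent" by blast
      have cA: "?f c \<in> carrier (module_Aut R W)" by (rule limit_map_Aut[OF p c])
      then have cl: "linear_endo (?f c)" unfolding module_Aut_iff by blast
      have "near i (?f c w) (?f c0 w)" if "w \<in> carrier W" for w
      proof (rule near_on_generators[OF V cl c0l _ that])
        fix v assume v: "v \<in> V"
        then have vW: "v \<in> carrier W" using V by blast
        obtain u where u: "u \<in> carrier W" "c0 (i, v, False) = near_set i u"
          using coherentD(1)[OF c0(1)] vW unfolding topspace_approximations by blast
        have "c (i, v, False) = c0 (i, v, False)" using cc v unfolding S_def by blast
        then have "?f c v \<in> near_set i u" "?f c0 v \<in> near_set i u"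
          using limit_map_mem[OF p c vW, of False i] limit_map_mem[OF p c0(1) vW, of False i] u(2) by simp_all
        then show "near i (?f c v) (?f c0 v)" unfolding near_set_def using near_trans near_sym by blast
      qed
      moreover have "near i (?f c0 w) (g w)" if "w \<in> carrier W" for w
        using c0(2) that unfolding U kernel_coset_iff[OF g] by blast
      ultimately have "?f c \<in> U" unfolding U kernel_coset_iff[OF g] using cA near_trans by blast
      then show "c \<in> ?f -` U \<inter> topspace ?X" unfolding top using c by blast
    qed
    ultimately show "\<exists>T. openin ?X T \<and> c0 \<in> T \<and> T \<subseteq> ?f -` U \<inter> topspace ?X" by blast
  qed
qed

text \<open>The group is the continuous image of a closed subset of a compact product.\<close>

theorem compact_space_module_Aut:
  assumes p: "Factorial_Ring.prime p"
  shows "compact_space (module_Aut_topology R W)"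
proof -
  have "compactin approximations coherent"
    by (rule closedin_compact_space[OF compact_space_approximations closedin_coherent])
  then have "compactin (subtopology approximations coherent) coherent"
    by (simp add: compactin_subtopology)
  from image_compactin[OF this continuous_limit_map[OF p]]
  have "compactin (module_Aut_topology R W) ((\<lambda>c. limit_map c False) ` coherent)" .
  moreover have "(\<lambda>c. limit_map c False) ` coherent = topspace (module_Aut_topology R W)"
    unfolding topspace_module_Aut using limit_map_surj[OF p] limit_map_Aut[OF p] by blast
  ultimately show ?thesis unfolding compact_space_def by simp
qed

end

section \<open>General linear groups\<close>

lemma (in cring) finsum_swap:
  assumes "finite I" "finite J" "\<And>i j. \<lbrakk>i \<in> I; j \<in> J\<rbrakk> \<Longrightarrow> f i j \<in> carrier R"
  shows "(\<Oplus>i\<in>I. \<Oplus>j\<in>J. f i j) = (\<Oplus>j\<in>J. \<Oplus>i\<in>I. f i j)"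
  using assms(1,3)
proof (induction I rule: finite_induct)
  case (insert x I)
  have "(\<Oplus>i\<in>insert x I. \<Oplus>j\<in>J. f i j) = (\<Oplus>j\<in>J. f x j) \<oplus> (\<Oplus>i\<in>I. \<Oplus>j\<in>J. f i j)"
    by (rule finsum_insert) (use insert in \<open>auto intro!: finsum_closed\<close>)
  also have "\<dots> = (\<Oplus>j\<in>J. f x j) \<oplus> (\<Oplus>j\<in>J. \<Oplus>i\<in>I. f i j)" using insert by simp
  also have "\<dots> = (\<Oplus>j\<in>J. f x j \<oplus> (\<Oplus>i\<in>I. f i j))"
    by (rule finsum_addf[symmetric]) (use insert in \<open>auto intro!: finsum_closed\<close>)
  also have "\<dots> = (\<Oplus>j\<in>J. \<Oplus>i\<in>insert x I. f i j)"
  proof (rule finsum_cong')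
    fix j assume j: "j \<in> J"
    show "f x j \<oplus> (\<Oplus>i\<in>I. f i j) = (\<Oplus>i\<in>insert x I. f i j)"
      by (rule finsum_insert[symmetric]) (use insert j in auto)
  qed (use insert in \<open>auto intro!: finsum_closed\<close>)
  finally show ?case .
qed simp

context cring
begin

lemma matrix_monoid_carrier:
  "A \<in> carrier (matrix_monoid n R) \<longleftrightarrow>
     A \<in> extensional ({..<n} \<times> {..<n}) \<and> (\<forall>i<n. \<forall>j<n. A (i, j) \<in> carrier R)"
  by (auto simp: matrix_monoid_def PiE_iff)

lemma matrix_monoid_mult_apply:
  "\<lbrakk>i < n; j < n\<rbrakk> \<Longrightarrow> (A \<otimes>\<^bsub>matrix_monoid n R\<^esub> B) (i, j) = (\<Oplus>k\<in>{..<n}. A (i, k) \<otimes> B (k, j))"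
  by (simp add: matrix_monoid_def)

lemma matrix_monoid_one_apply:
  "\<lbrakk>i < n; j < n\<rbrakk> \<Longrightarrow> \<one>\<^bsub>matrix_monoid n R\<^esub> (i, j) = (if i = j then \<one> else \<zero>)"
  by (simp add: matrix_monoid_def)

lemma matrix_eqI:
  assumes "A \<in> carrier (matrix_monoid n R)" "B \<in> carrier (matrix_monoid n R)"
    "\<And>i j. \<lbrakk>i < n; j < n\<rbrakk> \<Longrightarrow> A (i, j) = B (i, j)"
  shows "A = B"
  using assms unfolding matrix_monoid_carrier by (auto intro: extensionalityI)

lemma matrix_mult_closed:
  assumes "A \<in> carrier (matrix_monoid n R)" "B \<in> carrier (matrix_monoid n R)"
  shows "A \<otimes>\<^bsub>matrix_monoid n R\<^esub> B \<in> carrier (matrix_monoid n R)"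
  unfolding matrix_monoid_carrier
proof (intro conjI allI impI)
  show "A \<otimes>\<^bsub>matrix_monoid n R\<^esub> B \<in> extensional ({..<n} \<times> {..<n})" by (simp add: matrix_monoid_def)
  show "(A \<otimes>\<^bsub>matrix_monoid n R\<^esub> B) (i, j) \<in> carrier R" if "i < n" "j < n" for i j
    unfolding matrix_monoid_mult_apply[OF that]
    by (rule finsum_closed) (use assms that in \<open>auto simp: matrix_monoid_carrier\<close>)
qed

lemma matrix_one_closed: "\<one>\<^bsub>matrix_monoid n R\<^esub> \<in> carrier (matrix_monoid n R)"
  unfolding matrix_monoid_carrier by (auto simp: matrix_monoid_def)

lemma monoid_matrix_monoid: "monoid (matrix_monoid n R)"
proof (rule monoidI)
  let ?M = "matrix_monoid n R"
  show "A \<otimes>\<^bsub>?M\<^esub> B \<in> carrier ?M" if "A \<in> carrier ?M" "B \<in> carrier ?M" for A B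
    using that by (rule matrix_mult_closed)
  show "\<one>\<^bsub>?M\<^esub> \<in> carrier ?M" by (rule matrix_one_closed)
  show "(A \<otimes>\<^bsub>?M\<^esub> B) \<otimes>\<^bsub>?M\<^esub> C = A \<otimes>\<^bsub>?M\<^esub> (B \<otimes>\<^bsub>?M\<^esub> C)"
    if A: "A \<in> carrier ?M" and B: "B \<in> carrier ?M" and C: "C \<in> carrier ?M" for A B C
  proof (rule matrix_eqI)
    fix i j assume ij: "i < n" "j < n"
    have c: "A (k, l) \<in> carrier R" "B (k, l) \<in> carrier R" "C (k, l) \<in> carrier R" if "k < n" "l < n" for k l
      using A B C that unfolding matrix_monoid_carrier by auto
    have "((A \<otimes>\<^bsub>?M\<^esub> B) \<otimes>\<^bsub>?M\<^esub> C) (i, j) = (\<Oplus>k\<in>{..<n}. (A \<otimes>\<^bsub>?M\<^esub> B) (i, k) \<otimes> C (k, j))"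
      by (rule matrix_monoid_mult_apply[OF ij])
    also have "\<dots> = (\<Oplus>k\<in>{..<n}. \<Oplus>l\<in>{..<n}. A (i, l) \<otimes> (B (l, k) \<otimes> C (k, j)))"
    proof (rule finsum_cong')
      fix k assume k: "k \<in> {..<n}"
      then have kn: "k < n" by simp
      have "(A \<otimes>\<^bsub>?M\<^esub> B) (i, k) \<otimes> C (k, j) = (\<Oplus>l\<in>{..<n}. A (i, l) \<otimes> B (l, k)) \<otimes> C (k, j)"
        using matrix_monoid_mult_apply[OF ij(1) kn] by simp
      also have "\<dots> = (\<Oplus>l\<in>{..<n}. (A (i, l) \<otimes> B (l, k)) \<otimes> C (k, j))"
        by (rule finsum_ldistr) (use c ij kn in auto)
      also have "\<dots> = (\<Oplus>l\<in>{..<n}. A (i, l) \<otimes> (B (l, k) \<otimes> C (k, j)))"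
        by (rule finsum_cong') (use c ij kn in \<open>auto simp: m_assoc\<close>)
      finally show "(A \<otimes>\<^bsub>?M\<^esub> B) (i, k) \<otimes> C (k, j) = (\<Oplus>l\<in>{..<n}. A (i, l) \<otimes> (B (l, k) \<otimes> C (k, j)))" .
    qed (use c ij in \<open>auto intro!: finsum_closed\<close>)
    also have "\<dots> = (\<Oplus>l\<in>{..<n}. \<Oplus>k\<in>{..<n}. A (i, l) \<otimes> (B (l, k) \<otimes> C (k, j)))"
      by (rule finsum_swap) (use c ij in auto)
    also have "\<dots> = (\<Oplus>l\<in>{..<n}. A (i, l) \<otimes> (B \<otimes>\<^bsub>?M\<^esub> C) (l, j))"
    proof (rule finsum_cong')
      fix l assume l: "l \<in> {..<n}"
      then have ln: "l < n" by simp
      show "(\<Oplus>k\<in>{..<n}. A (i, l) \<otimes> (B (l, k) \<otimes> C (k, j))) = A (i, l) \<otimes> (B \<otimes>\<^bsub>?M\<^esub> C) (l, j)"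
        unfolding matrix_monoid_mult_apply[OF ln ij(2)]
        by (rule finsum_rdistr[symmetric]) (use c ij ln in auto)
    next
      show "(\<lambda>l. A (i, l) \<otimes> (B \<otimes>\<^bsub>?M\<^esub> C) (l, j)) \<in> {..<n} \<rightarrow> carrier R"
        using c ij matrix_mult_closed[OF B C] unfolding matrix_monoid_carrier by auto
    qed simp
    also have "\<dots> = (A \<otimes>\<^bsub>?M\<^esub> (B \<otimes>\<^bsub>?M\<^esub> C)) (i, j)" by (rule matrix_monoid_mult_apply[OF ij, symmetric])
    finally show "((A \<otimes>\<^bsub>?M\<^esub> B) \<otimes>\<^bsub>?M\<^esub> C) (i, j) = (A \<otimes>\<^bsub>?M\<^esub> (B \<otimes>\<^bsub>?M\<^esub> C)) (i, j)" .
  qed (intro matrix_mult_closed A B C)+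
  show "\<one>\<^bsub>?M\<^esub> \<otimes>\<^bsub>?M\<^esub> A = A" "A \<otimes>\<^bsub>?M\<^esub> \<one>\<^bsub>?M\<^esub> = A" if A: "A \<in> carrier ?M" for A
  proof -
    have c: "A (k, l) \<in> carrier R" if "k < n" "l < n" for k l
      using A that unfolding matrix_monoid_carrier by auto
    show "\<one>\<^bsub>?M\<^esub> \<otimes>\<^bsub>?M\<^esub> A = A"
    proof (rule matrix_eqI)
      fix i j assume ij: "i < n" "j < n"
      have "(\<one>\<^bsub>?M\<^esub> \<otimes>\<^bsub>?M\<^esub> A) (i, j) = (\<Oplus>k\<in>{..<n}. \<one>\<^bsub>?M\<^esub> (i, k) \<otimes> A (k, j))"
        by (rule matrix_monoid_mult_apply[OF ij])
      also have "\<dots> = (\<Oplus>k\<in>{..<n}. if i = k then A (k, j) else \<zero>)"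
        by (rule finsum_cong') (use c ij in \<open>auto simp: matrix_monoid_one_apply\<close>)
      also have "\<dots> = A (i, j)" by (rule finsum_singleton) (use c ij in auto)
      finally show "(\<one>\<^bsub>?M\<^esub> \<otimes>\<^bsub>?M\<^esub> A) (i, j) = A (i, j)" .
    qed (intro matrix_mult_closed matrix_one_closed A)+
    show "A \<otimes>\<^bsub>?M\<^esub> \<one>\<^bsub>?M\<^esub> = A"
    proof (rule matrix_eqI)
      fix i j assume ij: "i < n" "j < n"
      have "(A \<otimes>\<^bsub>?M\<^esub> \<one>\<^bsub>?M\<^esub>) (i, j) = (\<Oplus>k\<in>{..<n}. A (i, k) \<otimes> \<one>\<^bsub>?M\<^esub> (k, j))"
        by (rule matrix_monoid_mult_apply[OF ij])
      also have "\<dots> = (\<Oplus>k\<in>{..<n}. if j = k then A (i, k) else \<zero>)"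
        by (rule finsum_cong') (use c ij in \<open>auto simp: matrix_monoid_one_apply\<close>)
      also have "\<dots> = A (i, j)" by (rule finsum_singleton) (use c ij in auto)
      finally show "(A \<otimes>\<^bsub>?M\<^esub> \<one>\<^bsub>?M\<^esub>) (i, j) = A (i, j)" .
    qed (intro matrix_mult_closed matrix_one_closed A)+
  qed
qed

lemma group_general_linear: "group (general_linear_group n R)"
  unfolding general_linear_group_def by (rule monoid.units_group[OF monoid_matrix_monoid])

end

section \<open>The adic topology is Hausdorff\<close>

context noetherian_local_pro_p_domain
begin

lemma topspace_adic: "topspace (adic_topology R) = carrier R"
proof -
  have "mpow 0 +> \<zero> = carrier R"
    by (force simp: a_r_coset_def')
  then have "carrier R \<in> {max_ideal_pow R i +> a | i a. a \<in> carrier R}" unfolding mpow_def by blast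
  moreover have "mpow i +> a \<subseteq> carrier R" if "a \<in> carrier R" for i a
    using that mpow_carr by (auto simp: a_r_coset_def')
  ultimately show ?thesis unfolding adic_topology_def topology_generated_by_topspace mpow_def by blast
qed

lemma openin_adic: "a \<in> carrier R \<Longrightarrow> openin (adic_topology R) (mpow i +> a)"
  unfolding adic_topology_def mpow_def by (rule topology_generated_by_Basis) blast

lemma mem_coset_iff:
  assumes "a \<in> carrier R" "x \<in> carrier R"
  shows "x \<in> mpow i +> a \<longleftrightarrow> x \<ominus> a \<in> mpow i"
proof
  assume "x \<in> mpow i +> a"
  then obtain m where m: "m \<in> mpow i" "x = m \<oplus> a" by (auto simp: a_r_coset_def')
  have "m \<oplus> a \<ominus> a = m" using assms mpow_carr[OF m(1)] by algebra
  then show "x \<ominus> a \<in> mpow i" using m by simp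
next
  assume "x \<ominus> a \<in> mpow i"
  moreover have "x = (x \<ominus> a) \<oplus> a" using assms by algebra
  ultimately show "x \<in> mpow i +> a" unfolding a_r_coset_def' by blast
qed

text \<open>By separatedness distinct points differ modulo some \<open>mpow i\<close>, and then
  their cosets of \<open>mpow i\<close> are disjoint open sets.\<close>

lemma Hausdorff_adic: "Hausdorff_space (adic_topology R)"
  unfolding Hausdorff_space_def topspace_adic
proof (intro allI impI)
  fix x y assume xy: "x \<in> carrier R \<and> y \<in> carrier R \<and> x \<noteq> y"
  then have "\<not> (\<forall>i. x \<ominus> y \<in> mpow i)" using eq_if_diff_mem_all[of x y] xy by blast
  then obtain i where i: "x \<ominus> y \<notin> mpow i" by blast
  interpret I: ideal "mpow i" R by (rule ideal_mpow)
  have "disjnt (mpow i +> x) (mpow i +> y)"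
    unfolding disjnt_def
  proof (rule ccontr)
    assume "(mpow i +> x) \<inter> (mpow i +> y) \<noteq> {}"
    then obtain z where z: "z \<in> mpow i +> x" "z \<in> mpow i +> y" by blast
    then have zc: "z \<in> carrier R" using xy mpow_carr by (auto simp: a_r_coset_def')
    have "z \<ominus> y \<in> mpow i" "z \<ominus> x \<in> mpow i"
      using z mem_coset_iff[of x z i] mem_coset_iff[of y z i] xy zc by simp_all
    then have "z \<ominus> y \<ominus> (z \<ominus> x) \<in> mpow i" by (rule I.minus_closed)
    moreover have "z \<ominus> y \<ominus> (z \<ominus> x) = x \<ominus> y"
    proof -
      have "z \<ominus> b \<ominus> (z \<ominus> a) = a \<ominus> b" if "a \<in> carrier R" "b \<in> carrier R" for a b
        using that zc by algebra
      then show ?thesis using xy by blast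
    qed
    ultimately show False using i by simp
  qed
  moreover have "x \<in> mpow i +> x" "y \<in> mpow i +> y"
    using xy I.cong_refl[of x] I.cong_refl[of y] mem_coset_iff[of x x i] mem_coset_iff[of y y i] by simp_all
  ultimately show "\<exists>U V. openin (adic_topology R) U \<and> openin (adic_topology R) V \<and> x \<in> U \<and> y \<in> V \<and> disjnt U V"
    using openin_adic xy by blast
qed

lemma Hausdorff_general_linear: "Hausdorff_space (general_linear_topology n R)"
  unfolding general_linear_topology_def
  by (rule Hausdorff_space_subtopology) (simp add: Hausdorff_space_product_topology Hausdorff_adic)

end

section \<open>Closed embedding in a general linear group\<close>

context fg_torsion_free_module
begin

text \<open>A continuous injection from a compact space into a Hausdorff space is a homeomorphism
  onto a closed image, so only continuity has to be checked. The hypothesis \<open>small\<close> is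
  uniform continuity of each matrix entry.\<close>

lemma linear_overI:
  assumes p: "Factorial_Ring.prime p" and n: "n \<ge> 1"
    and hom: "N \<in> hom (module_Aut R W) (general_linear_group n R)"
    and inj: "inj_on N (carrier (module_Aut R W))"
    and small: "\<And>i k l. \<lbrakk>k < n; l < n\<rbrakk> \<Longrightarrow> \<exists>m. \<forall>f\<in>carrier (module_Aut R W). \<forall>g\<in>carrier (module_Aut R W).
      (\<forall>w\<in>carrier W. near m (f w) (g w)) \<longrightarrow> N f (k, l) \<ominus> N g (k, l) \<in> mpow i"
    and G: "closed_subgroup G (module_Aut R W) (module_Aut_topology R W)"
  shows "linear_over R (module_Aut R W\<lparr>carrier := G\<rparr>) (subtopology (module_Aut_topology R W) G)"
proof -
  let ?A = "module_Aut R W" and ?T = "module_Aut_topology R W"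
  let ?L = "general_linear_group n R" and ?S = "general_linear_topology n R"
  have Lc: "M \<in> carrier (matrix_monoid n R)" if "M \<in> carrier ?L" for M
    using that unfolding general_linear_group_def units_of_carrier Units_def by blast
  have NL: "N f \<in> carrier ?L" if "f \<in> carrier ?A" for f using hom that unfolding hom_def by blast
  have Nc: "N f (k, l) \<in> carrier R" if "f \<in> carrier ?A" "k < n" "l < n" for f k l
    using Lc[OF NL[OF that(1)]] that unfolding R.matrix_monoid_carrier by blast
  have cont: "continuous_map ?T ?S N"
    unfolding general_linear_topology_def continuous_map_in_subtopology
  proof
    show "N \<in> topspace ?T \<rightarrow> carrier ?L" unfolding topspace_module_Aut using NL by blast
    show "continuous_map ?T (product_topology (\<lambda>_. adic_topology R) ({..<n} \<times> {..<n})) N"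
      unfolding continuous_map_componentwise
    proof
      show "N ` topspace ?T \<subseteq> extensional ({..<n} \<times> {..<n})"
        unfolding topspace_module_Aut using Lc[OF NL] unfolding R.matrix_monoid_carrier by blast
      show "\<forall>kl\<in>{..<n} \<times> {..<n}. continuous_map ?T (adic_topology R) (\<lambda>f. N f kl)"
      proof
        fix kl assume "kl \<in> {..<n} \<times> {..<n}"
        then obtain k l where kl: "kl = (k, l)" "k < n" "l < n" by blast
        show "continuous_map ?T (adic_topology R) (\<lambda>f. N f kl)"
          unfolding adic_topology_def
        proof (rule continuous_on_generated_topo)
          show "(\<lambda>f. N f kl) ` topspace ?T \<subseteq> \<Union>{max_ideal_pow R i +> a |i a. a \<in> carrier R}"
            using Nc[OF _ kl(2,3)] topspace_adic unfolding topspace_module_Aut kl(1) adic_topology_def topology_generated_by_topspace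
            by blast
          fix U assume "U \<in> {max_ideal_pow R i +> a |i a. a \<in> carrier R}"
          then obtain i a where a: "a \<in> carrier R" and U: "U = mpow i +> a" unfolding mpow_def by blast
          interpret I: ideal "mpow i" R by (rule ideal_mpow)
          obtain m where m: "\<And>f g. \<lbrakk>f \<in> carrier ?A; g \<in> carrier ?A; \<forall>w\<in>carrier W. near m (f w) (g w)\<rbrakk>
              \<Longrightarrow> N f (k, l) \<ominus> N g (k, l) \<in> mpow i"
            using small[OF kl(2,3), of i] by blast
          show "openin ?T ((\<lambda>f. N f kl) -` U \<inter> topspace ?T)"
            unfolding openin_subopen[of ?T "_ \<inter> topspace ?T"]
          proof
            fix g assume "g \<in> (\<lambda>f. N f kl) -` U \<inter> topspace ?T"
            then have g: "g \<in> carrier ?A" "N g (k, l) \<in> mpow i +> a" unfolding topspace_module_Aut kl(1) U by auto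
            \<comment> \<open>\<open>Suc m\<close> replaces \<open>m\<close>, which may be zero,
              because the open kernels start at index one.\<close>
            let ?K = "g <#\<^bsub>?A\<^esub> congruence_kernel R W (Suc m)"
            have "N f (k, l) \<in> U" "f \<in> carrier ?A" if "f \<in> ?K" for f
            proof -
              have f: "f \<in> carrier ?A" "\<forall>w\<in>carrier W. near (Suc m) (f w) (g w)"
                using that unfolding kernel_coset_iff[OF g(1)] by auto
              then have "\<forall>w\<in>carrier W. near m (f w) (g w)"
                using level_mono[of m "Suc m"] unfolding near_def by auto
              then have "N f (k, l) \<ominus> N g (k, l) \<in> mpow i" using m f(1) g(1) by blast
              moreover have "N g (k, l) \<ominus> a \<in> mpow i"
                using g(2) mem_coset_iff[OF a Nc[OF g(1) kl(2,3)], of i] by simp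
              ultimately have "N f (k, l) \<ominus> a \<in> mpow i"
                by (rule I.cong_trans[OF Nc[OF f(1) kl(2,3)] Nc[OF g(1) kl(2,3)] a])
              then show "N f (k, l) \<in> U" unfolding U using mem_coset_iff[OF a Nc[OF f(1) kl(2,3)], of i] by simp
              show "f \<in> carrier ?A" by (rule f(1))
            qed
            then have "?K \<subseteq> (\<lambda>f. N f kl) -` U \<inter> topspace ?T" unfolding topspace_module_Aut kl(1) by blast
            then show "\<exists>V. openin ?T V \<and> g \<in> V \<and> V \<subseteq> (\<lambda>f. N f kl) -` U \<inter> topspace ?T"
              using openin_kernel_coset[OF g(1)] mem_kernel_coset[OF g(1)] by blast
          qed
        qed
      qed
    qed
  qed
  have Gs: "subgroup G ?A" and Gc: "closedin ?T G" using G unfolding closed_subgroup_def by auto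
  have GA: "G \<subseteq> carrier ?A" using subgroup.subset[OF Gs] .
  have topG: "topspace (subtopology ?T G) = G" using GA by (auto simp: topspace_module_Aut)
  have compG: "compactin ?T G" by (rule closedin_compact_space[OF compact_space_module_Aut[OF p] Gc])
  have "embedding_map (subtopology ?T G) ?S N"
    by (rule continuous_imp_embedding_map[OF continuous_map_from_subtopology[OF cont]
          compact_space_subtopology[OF compG] Hausdorff_general_linear])
      (use inj GA topG inj_on_subset in metis)
  then have homeo: "homeomorphic_map (subtopology ?T G) (subtopology ?S (N ` G)) N"
    unfolding embedding_map_def topG .
  have "closedin ?S (N ` G)"
    by (rule compactin_imp_closedin[OF Hausdorff_general_linear image_compactin[OF compG cont]])
  moreover have "subgroup (N ` G) ?L"
  proof -
    interpret group_hom ?A ?L N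
      using group_module_Aut R.group_general_linear hom by (simp add: group_hom_def group_hom_axioms_def)
    show ?thesis by (rule subgroup_img_is_subgroup[OF Gs])
  qed
  ultimately have cl: "closed_subgroup (N ` G) ?L ?S" unfolding closed_subgroup_def by blast
  have "N \<in> hom (?A\<lparr>carrier := G\<rparr>) (?L\<lparr>carrier := N ` G\<rparr>)"
    using hom GA unfolding hom_def by auto
  moreover have "bij_betw N G (N ` G)" using inj_on_subset[OF inj GA] unfolding bij_betw_def by blast
  ultimately have "N \<in> iso (?A\<lparr>carrier := G\<rparr>) (?L\<lparr>carrier := N ` G\<rparr>)" unfolding iso_def by simp
  then show ?thesis unfolding linear_over_def using n cl homeo by blast
qed

text \<open>An automorphism \<open>f\<close> is sent to the matrix with entries
  \<open>\<gamma> i (f (w j))\<close>. Multiplicativity is the expansion formula of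
  \<open>ex_linearization\<close> applied to the vector \<open>g (w j)\<close>.\<close>

theorem closed_subgroup_linear:
  assumes p: "Factorial_Ring.prime p"
    and G: "closed_subgroup G (module_Aut R W) (module_Aut_topology R W)"
  shows "linear_over R (module_Aut R W\<lparr>carrier := G\<rparr>) (subtopology (module_Aut_topology R W) G)"
proof (rule ex_linearization[OF p])
  let ?A = "module_Aut R W"
  fix n :: nat and w \<gamma>
  assume w: "\<And>i. i < n \<Longrightarrow> w i \<in> carrier W"
    and \<gamma>: "\<And>i u. \<lbrakk>i < n; u \<in> carrier W\<rbrakk> \<Longrightarrow> \<gamma> i u \<in> carrier R"
    and add: "\<And>i u v. \<lbrakk>i < n; u \<in> carrier W; v \<in> carrier W\<rbrakk> \<Longrightarrow> \<gamma> i (u \<oplus>\<^bsub>W\<^esub> v) = \<gamma> i u \<oplus> \<gamma> i v"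
    and endo: "\<And>g i u. \<lbrakk>linear_endo g; i < n; u \<in> carrier W\<rbrakk> \<Longrightarrow>
      \<gamma> i (g u) = (\<Oplus>k\<in>{..<n}. \<gamma> i (g (w k)) \<otimes> \<gamma> k u)"
    and dual: "\<And>i j. \<lbrakk>i < n; j < n\<rbrakk> \<Longrightarrow> \<gamma> i (w j) = (if i = j then \<one> else \<zero>)"
    and sep: "\<And>u. \<lbrakk>u \<in> carrier W; \<And>i. i < n \<Longrightarrow> \<gamma> i u = \<zero>\<rbrakk> \<Longrightarrow> u = \<zero>\<^bsub>W\<^esub>"
    and small: "\<And>j. \<exists>m. \<forall>u\<in>ideal_smult R W (mpow m). \<forall>i<n. \<gamma> i u \<in> mpow j"
  interpret A: group ?A by (rule group_module_Aut)
  have Al: "linear_endo f" if "f \<in> carrier ?A" for f using that unfolding module_Aut_iff by blast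
  note AW = linear_endoD(1)[OF Al]
  have diff: "\<gamma> i (u \<ominus>\<^bsub>W\<^esub> v) = \<gamma> i u \<ominus> \<gamma> i v" if i: "i < n" and u: "u \<in> carrier W" and v: "v \<in> carrier W" for i u v
  proof -
    have "(u \<ominus>\<^bsub>W\<^esub> v) \<oplus>\<^bsub>W\<^esub> v = u" using u v by (simp add: M.minus_eq M.a_assoc M.l_neg)
    then have "\<gamma> i u = \<gamma> i (u \<ominus>\<^bsub>W\<^esub> v) \<oplus> \<gamma> i v" using add[OF i, of "u \<ominus>\<^bsub>W\<^esub> v" v] u v by simp
    moreover have "x \<oplus> y \<ominus> y = x" if "x \<in> carrier R" "y \<in> carrier R" for x y
      using that by algebra
    ultimately show ?thesis using \<gamma>[OF i] u v by simp
  qed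
  show ?thesis
  proof (cases "n = 0")
    \<comment> \<open>Without coordinates \<open>W\<close> is zero and the group is trivial. Since
      \<open>linear_over\<close> asks for positive size, the trivial map into invertible matrices of
      size one is used.\<close>
    case True
    have triv: "f = g" if "f \<in> carrier ?A" "g \<in> carrier ?A" for f g
    proof (rule module_Aut_eqI[OF that])
      fix u assume u: "u \<in> carrier W"
      then show "f u = g u" using sep[OF AW[OF that(1) u]] sep[OF AW[OF that(2) u]] True by simp
    qed
    interpret L: group "general_linear_group 1 R" by (rule R.group_general_linear)
    let ?N = "\<lambda>f :: 'c \<Rightarrow> 'c. \<one>\<^bsub>general_linear_group 1 R\<^esub>"
    show ?thesis
    proof (rule linear_overI[OF p order_refl _ _ _ G])
      show "?N \<in> hom ?A (general_linear_group 1 R)" by (rule homI) (use L.one_closed L.l_one[OF L.one_closed] in simp_all)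
      show "inj_on ?N (carrier ?A)" using triv by (intro inj_onI)
      have "\<one>\<^bsub>general_linear_group 1 R\<^esub> \<in> carrier (matrix_monoid 1 R)"
        using L.one_closed unfolding general_linear_group_def units_of_carrier Units_def by blast
      then show "\<exists>m. \<forall>f\<in>carrier ?A. \<forall>g\<in>carrier ?A. (\<forall>w\<in>carrier W. near m (f w) (g w)) \<longrightarrow>
          ?N f (k, l) \<ominus> ?N g (k, l) \<in> mpow i" if "k < 1" "l < 1" for i k l
        using that ideal.cong_refl[OF ideal_mpow] unfolding R.matrix_monoid_carrier by blast
    qed
  next
    case False
    define N where "N f = (\<lambda>(i, j)\<in>{..<n} \<times> {..<n}. \<gamma> i (f (w j)))" for f :: "'c \<Rightarrow> 'c"
    have N: "N f (i, j) = \<gamma> i (f (w j))" if "i < n" "j < n" for f i j using that by (simp add: N_def)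
    have Nc: "N f \<in> carrier (matrix_monoid n R)" if "f \<in> carrier ?A" for f
      unfolding R.matrix_monoid_carrier using N \<gamma> AW[OF that] w by (simp add: N_def)
    have mult: "N (f \<otimes>\<^bsub>?A\<^esub> g) = N f \<otimes>\<^bsub>matrix_monoid n R\<^esub> N g" if f: "f \<in> carrier ?A" and g: "g \<in> carrier ?A" for f g
    proof (rule R.matrix_eqI)
      show "N (f \<otimes>\<^bsub>?A\<^esub> g) \<in> carrier (matrix_monoid n R)" by (rule Nc) (use f g in simp)
      show "N f \<otimes>\<^bsub>matrix_monoid n R\<^esub> N g \<in> carrier (matrix_monoid n R)"
        by (intro R.matrix_mult_closed Nc f g)
      fix i j assume ij: "i < n" "j < n"
      have "N (f \<otimes>\<^bsub>?A\<^esub> g) (i, j) = \<gamma> i (f (g (w j)))"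
        unfolding N[OF ij] module_Aut_mult[OF f g] using w[OF ij(2)] by (simp add: compose_eq)
      also have "\<dots> = (\<Oplus>k\<in>{..<n}. \<gamma> i (f (w k)) \<otimes> \<gamma> k (g (w j)))"
        by (rule endo[OF Al[OF f] ij(1) AW[OF g w[OF ij(2)]]])
      also have "\<dots> = (\<Oplus>k\<in>{..<n}. N f (i, k) \<otimes> N g (k, j))"
        by (rule R.finsum_cong') (use N ij \<gamma> AW[OF f] AW[OF g] w in auto)
      also have "\<dots> = (N f \<otimes>\<^bsub>matrix_monoid n R\<^esub> N g) (i, j)" by (rule R.matrix_monoid_mult_apply[OF ij, symmetric])
      finally show "N (f \<otimes>\<^bsub>?A\<^esub> g) (i, j) = (N f \<otimes>\<^bsub>matrix_monoid n R\<^esub> N g) (i, j)" .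
    qed
    have one: "N \<one>\<^bsub>?A\<^esub> = \<one>\<^bsub>matrix_monoid n R\<^esub>"
    proof (rule R.matrix_eqI[OF Nc[OF A.one_closed] R.matrix_one_closed])
      fix i j assume ij: "i < n" "j < n"
      show "N \<one>\<^bsub>?A\<^esub> (i, j) = \<one>\<^bsub>matrix_monoid n R\<^esub> (i, j)"
        unfolding N[OF ij] module_Aut_one R.matrix_monoid_one_apply[OF ij] using dual[OF ij] w[OF ij(2)] by simp
    qed
    have units: "N f \<in> Units (matrix_monoid n R)" if f: "f \<in> carrier ?A" for f
    proof -
      have i: "inv\<^bsub>?A\<^esub> f \<in> carrier ?A" using f by simp
      have "N (inv\<^bsub>?A\<^esub> f) \<otimes>\<^bsub>matrix_monoid n R\<^esub> N f = \<one>\<^bsub>matrix_monoid n R\<^esub>"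
        "N f \<otimes>\<^bsub>matrix_monoid n R\<^esub> N (inv\<^bsub>?A\<^esub> f) = \<one>\<^bsub>matrix_monoid n R\<^esub>"
        unfolding mult[OF i f, symmetric] mult[OF f i, symmetric] using f one by simp_all
      then show ?thesis unfolding Units_def using Nc[OF f] Nc[OF i] by blast
    qed
    show ?thesis
    proof (rule linear_overI[OF p _ _ _ _ G])
      show "1 \<le> n" using False by simp
      show "N \<in> hom ?A (general_linear_group n R)"
        by (rule homI) (simp_all add: general_linear_group_def units_of_def units mult)
      show "inj_on N (carrier ?A)"
      proof (rule inj_onI)
        fix f g assume f: "f \<in> carrier ?A" and g: "g \<in> carrier ?A" and eq: "N f = N g"
        show "f = g"
        proof (rule module_Aut_eqI[OF f g])
          fix u assume u: "u \<in> carrier W"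
          \<comment> \<open>The vectors \<open>w k\<close> need not generate \<open>W\<close>, but
            the expansion formula still determines every coordinate of \<open>f u\<close> from the
            values of \<open>f\<close> at them.\<close>
          have "\<gamma> i (f u) = \<gamma> i (g u)" if i: "i < n" for i
          proof -
            have e: "\<gamma> i (f (w k)) = \<gamma> i (g (w k))" if "k < n" for k
              using N[OF i that, of f] N[OF i that, of g] eq by simp
            have "\<gamma> i (f u) = (\<Oplus>k\<in>{..<n}. \<gamma> i (f (w k)) \<otimes> \<gamma> k u)" by (rule endo[OF Al[OF f] i u])
            also have "\<dots> = (\<Oplus>k\<in>{..<n}. \<gamma> i (g (w k)) \<otimes> \<gamma> k u)"
              by (rule R.finsum_cong') (use e i \<gamma> u AW[OF g] w in auto)
            also have "\<dots> = \<gamma> i (g u)" by (rule endo[OF Al[OF g] i u, symmetric])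
            finally show ?thesis .
          qed
          then have "f u \<ominus>\<^bsub>W\<^esub> g u = \<zero>\<^bsub>W\<^esub>"
            using sep[of "f u \<ominus>\<^bsub>W\<^esub> g u"] diff AW[OF f u] AW[OF g u] \<gamma> by (simp add: a_minus_def R.r_neg)
          then have "(f u \<ominus>\<^bsub>W\<^esub> g u) \<oplus>\<^bsub>W\<^esub> g u = g u" using AW[OF g u] by simp
          then show "f u = g u" using AW[OF f u] AW[OF g u] by (simp add: M.minus_eq M.a_assoc M.l_neg)
        qed
      qed
      fix i k l assume k: "k < n" and l: "l < n"
      obtain m where m: "\<forall>u\<in>ideal_smult R W (mpow m). \<forall>i'<n. \<gamma> i' u \<in> mpow i" using small[of i] by blast
      have "N f (k, l) \<ominus> N g (k, l) \<in> mpow i"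
        if f: "f \<in> carrier ?A" and g: "g \<in> carrier ?A" and near: "\<forall>w\<in>carrier W. near m (f w) (g w)" for f g
      proof -
        have "f (w l) \<ominus>\<^bsub>W\<^esub> g (w l) \<in> ideal_smult R W (mpow m)"
          using near w[OF l] unfolding near_def level_def by blast
        then have "\<gamma> k (f (w l) \<ominus>\<^bsub>W\<^esub> g (w l)) \<in> mpow i" using m k by blast
        then show ?thesis using diff[OF k AW[OF f w[OF l]] AW[OF g w[OF l]]] N[OF k l] by simp
      qed
      then show "\<exists>m. \<forall>f\<in>carrier ?A. \<forall>g\<in>carrier ?A. (\<forall>w\<in>carrier W. near m (f w) (g w)) \<longrightarrow>
          N f (k, l) \<ominus> N g (k, l) \<in> mpow i" by blast
    qed
  qed
qed

end

theorem theorem2p2: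
  fixes p :: nat and R :: "'a ring" and W :: "('a, 'b) module" and G :: "('b \<Rightarrow> 'b) set"
  assumes "Factorial_Ring.prime p"
    and "noetherian_local_pro_p_domain p R"
    and "module R W"
    and "finitely_generated_module R W"
    and "torsion_free_module R W"
    and "closed_subgroup G (module_Aut R W) (module_Aut_topology R W)"
  shows "(\<exists>S :: 'a ring.
            noetherian_local_pro_p_domain p S \<and>
            ring_characteristic S = ring_characteristic R \<and>
            krull_dim S = krull_dim R \<and>
            linear_over S (module_Aut R W\<lparr>carrier := G\<rparr>)
              (subtopology (module_Aut_topology R W) G))
       \<and> (regular_local R \<longrightarrow>
            linear_over R (module_Aut R W\<lparr>carrier := G\<rparr>)
              (subtopology (module_Aut_topology R W) G))"
proof -
  have "fg_torsion_free_module p R W"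
    using assms(2-5) by (simp add: fg_torsion_free_module_def fg_torsion_free_module_axioms_def)
  then have "linear_over R (module_Aut R W\<lparr>carrier := G\<rparr>) (subtopology (module_Aut_topology R W) G)"
    by (rule fg_torsion_free_module.closed_subgroup_linear[OF _ assms(1,6)])
  then show ?thesis using assms(2) by blast
qed

end
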